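(* There exists a deterministic logarithmic-space algorithm that, given as input (i) a bipartite Pfaffian graph $G$ with minimum degree at least three, (ii) a Hamiltonian cycle $H$ in $G$, and (iii) an edge $e\in E(H)$, outputs a Hamiltonian cycle $H'\neq H$ in $G$ with $e\in E(H')$.
   Context: All graphs are finite, undirected, simple and loopless; the input graphs are given as adjacency lists with vertices represented as $O(\log n)$-bit integers, where $n=|V(G)|$. An orientation $\vec G$ of a graph $G$ replaces each edge $\{u,v\}$ by exactly one of the arcs $(u,v)$, $(v,u)$. A cycle $C$ of $G$ is central if $G\setminus V(C)$ has a perfect matching. An orientation of a cycle is consistent if it is a directed cycle. An orientation $\vec G$ of $G$ is Pfaffian if for every central cycle $C$ of $G$, each of the two consistent orientations of $C$ has an odd number of arcs in common with $\vec G$. A graph is Pfaffian if it admits a Pfaffian orientation. *)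

theory Defs
  imports Complex_Main
begin

section \<open>Graphs, cycles and Pfaffian orientations\<close>

type_synonym 'a graph = "'a set \<times> 'a set set"

abbreviation verts :: "'a graph \<Rightarrow> 'a set" where "verts \<equiv> fst"
abbreviation edges :: "'a graph \<Rightarrow> 'a set set" where "edges \<equiv> snd"

definition simple_graph :: "'a graph \<Rightarrow> bool" where
  "simple_graph G \<longleftrightarrow> finite (verts G) \<and>
     (\<forall>e\<in>edges G. \<exists>u\<in>verts G. \<exists>v\<in>verts G. u \<noteq> v \<and> e = {u, v})"

definition neighbours :: "'a graph \<Rightarrow> 'a \<Rightarrow> 'a set" where
  "neighbours G v = {u. {v, u} \<in> edges G}"

definition degree :: "'a graph \<Rightarrow> 'a \<Rightarrow> nat" where
  "degree G v = card (neighbours G v)"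

definition bipartite :: "'a graph \<Rightarrow> bool" where
  "bipartite G \<longleftrightarrow> (\<exists>A B. A \<union> B = verts G \<and> A \<inter> B = {} \<and>
     (\<forall>e\<in>edges G. \<exists>a\<in>A. \<exists>b\<in>B. e = {a, b}))"

definition delete_vertices :: "'a graph \<Rightarrow> 'a set \<Rightarrow> 'a graph" where
  "delete_vertices G S = (verts G - S, {e \<in> edges G. e \<inter> S = {}})"

definition perfect_matching :: "'a graph \<Rightarrow> 'a set set \<Rightarrow> bool" where
  "perfect_matching G M \<longleftrightarrow> M \<subseteq> edges G \<and> pairwise disjnt M \<and> \<Union>M = verts G"

text \<open>
  A cycle is represented by a list of its vertices in cyclic order.  The list also fixes a
  starting point and a direction of traversal, so two lists represent the same cycle of the
  graph iff they have the same set \<open>cycle_edges\<close>.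
\<close>

definition cycle_arcs :: "'a list \<Rightarrow> ('a \<times> 'a) set" where
  "cycle_arcs C = {(C ! i, C ! (Suc i mod length C)) | i. i < length C}"

definition cycle_edges :: "'a list \<Rightarrow> 'a set set" where
  "cycle_edges C = {{u, v} | u v. (u, v) \<in> cycle_arcs C}"

definition is_cycle :: "'a graph \<Rightarrow> 'a list \<Rightarrow> bool" where
  "is_cycle G C \<longleftrightarrow> length C \<ge> 3 \<and> distinct C \<and> set C \<subseteq> verts G \<and> cycle_edges C \<subseteq> edges G"

definition hamiltonian_cycle :: "'a graph \<Rightarrow> 'a list \<Rightarrow> bool" where
  "hamiltonian_cycle G C \<longleftrightarrow> is_cycle G C \<and> set C = verts G"

definition central_cycle :: "'a graph \<Rightarrow> 'a list \<Rightarrow> bool" where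
  "central_cycle G C \<longleftrightarrow> is_cycle G C \<and> (\<exists>M. perfect_matching (delete_vertices G (set C)) M)"

definition orientation :: "'a graph \<Rightarrow> ('a \<times> 'a) set \<Rightarrow> bool" where
  "orientation G D \<longleftrightarrow> (\<forall>(u, v)\<in>D. {u, v} \<in> edges G) \<and>
     (\<forall>u v. {u, v} \<in> edges G \<longrightarrow> ((u, v) \<in> D) \<noteq> ((v, u) \<in> D))"

text \<open>The two consistent orientations of \<open>C\<close> are \<open>cycle_arcs C\<close> and its converse.\<close>

definition pfaffian_orientation :: "'a graph \<Rightarrow> ('a \<times> 'a) set \<Rightarrow> bool" where
  "pfaffian_orientation G D \<longleftrightarrow> orientation G D \<and>
     (\<forall>C. central_cycle G C \<longrightarrow>
        odd (card (cycle_arcs C \<inter> D)) \<and> odd (card ((cycle_arcs C)\<inverse> \<inter> D)))"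

definition pfaffian :: "'a graph \<Rightarrow> bool" where
  "pfaffian G \<longleftrightarrow> (\<exists>D. pfaffian_orientation G D)"


section \<open>Encoding of instances as strings\<close>

datatype symbol = Bit bool | Comma | Colon | Semicolon | Hash

text \<open>Binary representation, most significant bit first, without leading zeros; zero is the
  single bit 0.\<close>

fun bits :: "nat \<Rightarrow> bool list" where
  "bits n = (if n < 2 then [n = 1] else bits (n div 2) @ [odd n])"

declare bits.simps [simp del]

definition log_bit_labels :: "real \<Rightarrow> nat graph \<Rightarrow> bool" where
  "log_bit_labels c G \<longleftrightarrow>
     (\<forall>v\<in>verts G. real (length (bits v)) \<le> c * log 2 (real (card (verts G))))"

text \<open>The rows, and the entries within a row, may come in any order.\<close>

definition adjacency_list :: "nat graph \<Rightarrow> (nat \<times> nat list) list \<Rightarrow> bool" where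
  "adjacency_list G adj \<longleftrightarrow> distinct (map fst adj) \<and> set (map fst adj) = verts G \<and>
     (\<forall>(v, ns)\<in>set adj. distinct ns \<and> set ns = neighbours G v)"

definition encode_vertex :: "nat \<Rightarrow> symbol list" where
  "encode_vertex v = map Bit (bits v)"

definition encode_vertices :: "nat list \<Rightarrow> symbol list" where
  "encode_vertices vs = concat (map (\<lambda>v. encode_vertex v @ [Comma]) vs)"

definition encode_adjacency :: "(nat \<times> nat list) list \<Rightarrow> symbol list" where
  "encode_adjacency adj =
     concat (map (\<lambda>(v, ns). encode_vertex v @ [Colon] @ encode_vertices ns @ [Semicolon]) adj)"

definition encode_input ::
  "(nat \<times> nat list) list \<Rightarrow> nat list \<Rightarrow> nat \<times> nat \<Rightarrow> symbol list" where
  "encode_input adj H e =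
     encode_adjacency adj @ [Hash] @ encode_vertices H @ [Hash] @ encode_vertices [fst e, snd e]"


section \<open>Deterministic Turing machines with sublinear space\<close>

text \<open>
  The machines have a read-only two-way input tape, finitely many read-write work tapes, and a
  write-only one-way output tape.  The input word is delimited by end markers, which the input
  head cannot leave (otherwise its position would be an unaccounted counter).  Work tapes are
  one-way infinite; moving left in cell 0 leaves the head where it is.
\<close>

datatype move = MoveLeft | Stay | MoveRight

datatype input_cell = LeftEnd | RightEnd | Letter symbol

record ('q, 'g) tm =
  tm_states :: "'q set"
  tm_start :: 'q
  tm_halt :: 'q
  tm_alphabet :: "'g set"
  tm_blank :: 'g
  tm_tapes :: nat
  tm_delta :: "'q \<Rightarrow> input_cell \<Rightarrow> 'g list \<Rightarrow> 'q \<times> move \<times> ('g \<times> move) list \<times> symbol option"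

definition valid_tm :: "('q, 'g) tm \<Rightarrow> bool" where
  "valid_tm M \<longleftrightarrow>
     finite (tm_states M) \<and> tm_start M \<in> tm_states M \<and> tm_halt M \<in> tm_states M \<and>
     finite (tm_alphabet M) \<and> tm_blank M \<in> tm_alphabet M \<and>
     (\<forall>q a gs. q \<in> tm_states M \<and> length gs = tm_tapes M \<and> set gs \<subseteq> tm_alphabet M \<longrightarrow>
        (case tm_delta M q a gs of (q', d, ws, out) \<Rightarrow>
           q' \<in> tm_states M \<and> length ws = tm_tapes M \<and> fst ` set ws \<subseteq> tm_alphabet M))"

text \<open>A work tape is given by its contents and the position of its head.\<close>

record ('q, 'g) config =
  cf_state :: 'q
  cf_input_pos :: nat
  cf_work :: "((nat \<Rightarrow> 'g) \<times> nat) list"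
  cf_output :: "symbol list"

fun move_head :: "move \<Rightarrow> nat \<Rightarrow> nat" where
  "move_head MoveLeft p = p - 1"
| "move_head Stay p = p"
| "move_head MoveRight p = p + 1"

definition read_input :: "symbol list \<Rightarrow> nat \<Rightarrow> input_cell" where
  "read_input x p =
     (if p = 0 then LeftEnd else if p \<le> length x then Letter (x ! (p - 1)) else RightEnd)"

definition initial_config :: "('q, 'g) tm \<Rightarrow> ('q, 'g) config" where
  "initial_config M =
     \<lparr>cf_state = tm_start M, cf_input_pos = 0,
      cf_work = replicate (tm_tapes M) ((\<lambda>_. tm_blank M), 0), cf_output = []\<rparr>"

definition tm_step :: "('q, 'g) tm \<Rightarrow> symbol list \<Rightarrow> ('q, 'g) config \<Rightarrow> ('q, 'g) config" where
  "tm_step M x cf =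
     (if cf_state cf = tm_halt M then cf
      else case tm_delta M (cf_state cf) (read_input x (cf_input_pos cf))
                  (map (\<lambda>(T, p). T p) (cf_work cf)) of
        (q, d, ws, out) \<Rightarrow>
          \<lparr>cf_state = q,
           cf_input_pos = min (length x + 1) (move_head d (cf_input_pos cf)),
           cf_work = map2 (\<lambda>(T, p) (g, m). (T(p := g), move_head m p)) (cf_work cf) ws,
           cf_output = cf_output cf @ (case out of None \<Rightarrow> [] | Some a \<Rightarrow> [a])\<rparr>)"

definition config_at :: "('q, 'g) tm \<Rightarrow> symbol list \<Rightarrow> nat \<Rightarrow> ('q, 'g) config" where
  "config_at M x t = (tm_step M x ^^ t) (initial_config M)"

definition halts_with_output :: "('q, 'g) tm \<Rightarrow> symbol list \<Rightarrow> symbol list \<Rightarrow> bool" where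
  "halts_with_output M x y \<longleftrightarrow>
     (\<exists>t. cf_state (config_at M x t) = tm_halt M \<and> cf_output (config_at M x t) = y)"

text \<open>
  Heads start in cell 0 and move by at most one cell per step, so a tape visits at most \<open>s\<close>
  cells iff its head position \<open>p\<close> always satisfies \<open>p + 1 \<le> s\<close>.  The bound is imposed on each
  of the (constantly many) work tapes; input and output tape are not counted.
\<close>

definition runs_in_space :: "('q, 'g) tm \<Rightarrow> symbol list \<Rightarrow> real \<Rightarrow> bool" where
  "runs_in_space M x s \<longleftrightarrow>
     (\<forall>t. \<forall>(T, p)\<in>set (cf_work (config_at M x t)). real p + 1 \<le> s)"

end

theory Submission
  imports Defs "HOL-Library.Countable"
begin

text \<open>
  Number the vertices along \<open>H\<close> by \<open>0, \<dots>, n - 1\<close> so that \<open>e\<close> joins the last one to the first; black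
  (even) and white (odd) vertices alternate.  An interval of \<open>H\<close> closed up by a chord is a central
  cycle, so up to switching at vertices the Pfaffian orientation directs every edge from lower to
  higher index.  Consider a 2-factor in which every white vertex except the last lies between its two
  neighbours.  A component avoiding the last vertex would be central, since the other components are
  even cycles, but its number of forward arcs would be even; so the 2-factor is a Hamiltonian cycle.
  To obtain such a 2-factor, choose a chord at every inner black vertex \<open>i\<close>, ending at \<open>c\<close> say, and let
  \<open>jump i\<close> be the black neighbour of \<open>c\<close> in \<open>H\<close> on the side of \<open>i\<close>.  Along a cycle of the map \<open>jump\<close> the
  chords \<open>{i, c}\<close> alternate with the edges \<open>{c, jump i}\<close> of \<open>H\<close>, and exchanging the latter for the former
  yields the 2-factor.  Finding a cycle of \<open>jump\<close> and walking along the 2-factor only needs finitely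
  many counters bounded by the input length, which fit in logarithmic space in binary.
\<close>

section \<open>Counter programs and their compilation to Turing machines\<close>

text \<open>The side on which \<open>jump\<close> steps is what keeps white vertices between their
  neighbours: a white \<open>c\<close> that receives the chord from \<open>i\<close> gives up its
  neighbour in \<open>H\<close> on the same side, and \<open>jump\<close> is injective on its cycle,
  so no side is served twice. The last vertex is the exception because its cyclic successor 0 lies
  below it. A white vertex between its neighbours contributes two arcs that are both forward or both
  backward along the component, whence the even count. Vertex 0 is left out of the choice of chords
  so that \<open>e\<close>, which joins it to the last vertex, is never exchanged. Space shapes the
  algorithm: neither the cycle of \<open>jump\<close> nor the 2-factor can be stored. Chords are
  therefore found afresh as the least admissible index, the whole cycle of \<open>jump\<close> is
  traversed again for every vertex that is printed, and the walk remembers only its last arc. No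
  cycle detection is involved: \<open>n\<close> jumps lead onto a cycle, and \<open>n\<close>
  further ones cover it.\<close>

datatype test = Zero nat | Cell "input_cell list"

datatype com = Skip | Inc nat | Dec nat | Lft | Rgt | Emit symbol
  | Seq com com | Cond test com com | Loop test com

text \<open>One command on a counter takes many machine steps: \<open>Scan\<close> moves right along
  the digits, and \<open>Back\<close> returns to cell 1 carrying the outcome of a zero test.
  \<open>Init\<close> writes the end marks once.\<close>

datatype mode = Init | Run | Scan | Back bool

text \<open>Countability lets a stack of commands together with a mode be coded as a natural number,
  the state type of the machine.\<close>

instance symbol :: countable by countable_datatype
instance input_cell :: countable by countable_datatype
instance test :: countable by countable_datatype
instance com :: countable by countable_datatype
instance mode :: countable by countable_datatype

type_synonym store = "nat \<times> (nat \<Rightarrow> nat) \<times> symbol list"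

fun holds :: "symbol list \<Rightarrow> test \<Rightarrow> store \<Rightarrow> bool" where
  "holds x (Zero r) (h, \<rho>, out) \<longleftrightarrow> \<rho> r = 0"
| "holds x (Cell cs) (h, \<rho>, out) \<longleftrightarrow> read_input x h \<in> set cs"

text \<open>A derivation is a certificate of two things: the run terminates, and no
  \<open>Inc\<close> raises a counter above \<open>length x + 1\<close>. The second is the source of
  the space bound. \<open>Loop\<close> runs until its test holds.\<close>

inductive exec :: "symbol list \<Rightarrow> com \<Rightarrow> store \<Rightarrow> store \<Rightarrow> bool" for x where
  Skip: "exec x Skip s s"
| Inc: "\<rho> r \<le> length x \<Longrightarrow> exec x (Inc r) (h, \<rho>, out) (h, \<rho>(r := Suc (\<rho> r)), out)"
| Dec: "\<rho> r \<noteq> 0 \<Longrightarrow> exec x (Dec r) (h, \<rho>, out) (h, \<rho>(r := \<rho> r - 1), out)"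
| Lft: "exec x Lft (h, \<rho>, out) (h - 1, \<rho>, out)"
| Rgt: "exec x Rgt (h, \<rho>, out) (min (length x + 1) (h + 1), \<rho>, out)"
| Emit: "exec x (Emit a) (h, \<rho>, out) (h, \<rho>, out @ [a])"
| Seq: "exec x c s s' \<Longrightarrow> exec x d s' s'' \<Longrightarrow> exec x (Seq c d) s s''"
| Cond_True: "holds x t s \<Longrightarrow> exec x c s s' \<Longrightarrow> exec x (Cond t c d) s s'"
| Cond_False: "\<not> holds x t s \<Longrightarrow> exec x d s s' \<Longrightarrow> exec x (Cond t c d) s s'"
| Loop_True: "holds x t s \<Longrightarrow> exec x (Loop t c) s s"
| Loop_False: "\<not> holds x t s \<Longrightarrow> exec x c s s' \<Longrightarrow> exec x (Loop t c) s' s'' \<Longrightarrow>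
    exec x (Loop t c) s s''"

fun regs :: "com \<Rightarrow> nat set" where
  "regs (Inc r) = {r}"
| "regs (Dec r) = {r}"
| "regs (Seq c d) = regs c \<union> regs d"
| "regs (Cond t c d) = (case t of Zero r \<Rightarrow> {r} | _ \<Rightarrow> {}) \<union> regs c \<union> regs d"
| "regs (Loop t c) = (case t of Zero r \<Rightarrow> {r} | _ \<Rightarrow> {}) \<union> regs c"
| "regs _ = {}"

text \<open>A machine state is the stack of commands that remain to be executed; only finitely many stacks
  are reachable from a given program.\<close>

fun succs :: "com list \<Rightarrow> com list set" where
  "succs [] = {[]}"
| "succs (Seq a b # K) = {a # b # K}"
| "succs (Cond t a b # K) = {a # K, b # K}"
| "succs (Loop t a # K) = {K, a # Loop t a # K}"
| "succs (c # K) = {K}"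

fun conts :: "com \<Rightarrow> com list \<Rightarrow> com list set" where
  "conts (Seq a b) K = {Seq a b # K, K} \<union> conts a (b # K) \<union> conts b K"
| "conts (Cond t a b) K = {Cond t a b # K, K} \<union> conts a K \<union> conts b K"
| "conts (Loop t a) K = {Loop t a # K, K} \<union> conts a (Loop t a # K)"
| "conts c K = {c # K, K}"

lemma conts_self: "c # K \<in> conts c K" "K \<in> conts c K"
  by (cases c; simp)+

lemma finite_conts: "finite (conts c K)"
  by (induction c K rule: conts.induct) auto

text \<open>\<open>K\<close> is the exit of the set: once it is reached, control belongs to the
  surrounding command. For \<open>K = []\<close> nothing follows, and the set is closed
  outright.\<close>

lemma conts_closed: "L \<in> conts c K \<Longrightarrow> L = K \<or> succs L \<subseteq> conts c K"
proof (induction c arbitrary: K L)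
  case (Seq a b)
  have b: "succs (b # K) \<subseteq> conts b K" using Seq.IH(2)[OF conts_self(1)] by simp
  from Seq show ?case using b conts_self by (fastforce simp: conts_self)
next
  case (Cond t a b)
  then show ?case by (fastforce simp: conts_self)
next
  case (Loop t a)
  then show ?case by (fastforce simp: conts_self)
qed auto

section \<open>Transition table of the compiled machine\<close>

fun active :: "com \<Rightarrow> nat" where
  "active (Inc r) = r"
| "active (Dec r) = r"
| "active (Cond (Zero r) c d) = r"
| "active (Loop (Zero r) c) = r"
| "active _ = 0"

fun resume :: "com \<Rightarrow> com list \<Rightarrow> bool \<Rightarrow> com list" where
  "resume (Cond t a b) K z = (if z then a # K else b # K)"
| "resume (Loop t a) K z = (if z then K else a # Loop t a # K)"
| "resume (Seq a b) K z = a # b # K"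
| "resume c K z = K"

lemma resume_succs: "resume c K z \<in> succs (c # K)"
  by (cases c) auto

text \<open>Carry, borrow and zero test on a single cell: the first component says whether to go on
  to the next digit, the second is the symbol left behind. The symbols 1 and 2 stand for the digits
  0 and 1; an increment that meets the blank 0 creates a new leading digit.\<close>

fun scan :: "com \<Rightarrow> nat \<Rightarrow> bool \<times> nat" where
  "scan (Inc r) g = (if g = 2 then (True, 1) else (False, 2))"
| "scan (Dec r) g = (if g = 1 then (True, 2) else if g = 2 then (False, 1) else (False, g))"
| "scan c g = (g = 1, g)"

text \<open>All tapes are written in every step, so the others rewrite their own symbol and stay.
  With \<open>r = k\<close> no tape is singled out, which gives the idle step.\<close>

definition upd :: "nat \<Rightarrow> nat list \<Rightarrow> nat \<Rightarrow> nat \<times> move \<Rightarrow> (nat \<times> move) list" where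
  "upd k gs r gm = map (\<lambda>j. if j = r then gm else (gs ! j, Stay)) [0..<k]"

fun run_delta :: "com \<Rightarrow> com list \<Rightarrow> input_cell \<Rightarrow> (com list \<times> mode) \<times> move \<times> symbol option" where
  "run_delta Lft K a = ((K, Run), MoveLeft, None)"
| "run_delta Rgt K a = ((K, Run), MoveRight, None)"
| "run_delta (Emit s) K a = ((K, Run), Stay, Some s)"
| "run_delta (Cond (Cell cs) c d) K a =
     ((resume (Cond (Cell cs) c d) K (a \<in> set cs), Run), Stay, None)"
| "run_delta (Loop (Cell cs) c) K a =
     ((resume (Loop (Cell cs) c) K (a \<in> set cs), Run), Stay, None)"
| "run_delta (Seq c d) K a = ((c # d # K, Run), Stay, None)"
| "run_delta Skip K a = ((K, Run), Stay, None)"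
| "run_delta c K a = ((c # K, Scan), Stay, None)"

text \<open>The flag of \<open>Back\<close> is set when the scan stops at a symbol other than 2,
  which for a zero test means that no digit 1 was met. The guard \<open>active c \<ge> k\<close>
  makes the table well formed for every program; there the machine stands still.\<close>

fun delta :: "nat \<Rightarrow> com list \<times> mode \<Rightarrow> input_cell \<Rightarrow> nat list \<Rightarrow>
    (com list \<times> mode) \<times> move \<times> (nat \<times> move) list \<times> symbol option" where
  "delta k (K, Init) a gs = ((K, Run), Stay, replicate k (3, MoveRight), None)"
| "delta k ([], m) a gs = (([], m), Stay, upd k gs k (0, Stay), None)"
| "delta k (c # K, Run) a gs =
     (case run_delta c K a of (q, d, out) \<Rightarrow> (q, d, upd k gs k (0, Stay), out))"
| "delta k (c # K, Scan) a gs =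
     (if active c \<ge> k then ((c # K, Scan), Stay, upd k gs k (0, Stay), None) else
      let g = gs ! active c; w = snd (scan c g) in
      if fst (scan c g) then ((c # K, Scan), Stay, upd k gs (active c) (w, MoveRight), None)
      else ((c # K, Back (g \<noteq> 2)), Stay, upd k gs (active c) (w, MoveLeft), None))"
| "delta k (c # K, Back z) a gs =
     (if active c \<ge> k then ((c # K, Back z), Stay, upd k gs k (0, Stay), None) else
      let g = gs ! active c in
      if g = 3 then ((resume c K z, Run), Stay, upd k gs (active c) (g, MoveRight), None)
      else ((c # K, Back z), Stay, upd k gs (active c) (g, MoveLeft), None))"

definition compile :: "nat \<Rightarrow> com \<Rightarrow> (nat, nat) tm" where
  "compile k c = \<lparr>tm_states = to_nat ` (conts c [] \<times> (UNIV :: mode set)),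
     tm_start = to_nat ([c], Init), tm_halt = to_nat ([] :: com list, Run),
     tm_alphabet = {0, 1, 2, 3}, tm_blank = 0, tm_tapes = k,
     tm_delta = (\<lambda>q a gs. case delta k (from_nat q) a gs of
        (p, d, ws, out) \<Rightarrow> (to_nat p, d, ws, out))\<rparr>"

lemma length_upd [simp]: "length (upd k gs r gm) = k"
  by (simp add: upd_def)

lemma fst_upd:
  assumes "set gs \<subseteq> S" "length gs = k" "fst gm \<in> S"
  shows "fst ` set (upd k gs r gm) \<subseteq> S"
  using assms by (auto simp: upd_def)

lemma run_delta_state: "run_delta c K a = ((L, m), d, out) \<Longrightarrow> L \<in> insert (c # K) (succs (c # K))"
  by (induction c K a rule: run_delta.induct) (auto split: if_splits)

lemma scan_alphabet: "g \<in> {0,1,2,3} \<Longrightarrow> snd (scan c g) \<in> {0,1,2,3::nat}"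
  by (cases c) (auto split: if_splits)

text \<open>A step never leaves the finite set of stacks \<open>conts c []\<close>, and only four
  symbols are ever written.\<close>

lemma valid_compile: "valid_tm (compile k c)"
proof -
  have fin: "finite (UNIV :: mode set)"
  proof (rule finite_subset)
    show "(UNIV :: mode set) \<subseteq> {Init, Run, Scan, Back True, Back False}"
    proof
      fix m :: mode
      show "m \<in> {Init, Run, Scan, Back True, Back False}" by (cases m) auto
    qed
  qed simp
  have *: "fst (fst (delta k (L, m) a gs)) \<in> conts c [] \<and>
      length (fst (snd (snd (delta k (L, m) a gs)))) = k \<and>
      fst ` set (fst (snd (snd (delta k (L, m) a gs)))) \<subseteq> {0,1,2,3}"
    if L: "L \<in> conts c []" and gs: "length gs = k" "set gs \<subseteq> {0,1,2,3}" for L m a gs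
  proof (cases L)
    case Nil
    have "fst ` set (upd k gs k (0, Stay)) \<subseteq> {0,1,2,3}"
      using fst_upd[OF gs(2) gs(1)] by simp
    then show ?thesis using Nil L
      by (cases m) (auto simp del: insert_iff)
  next
    case (Cons d K)
    have cl: "insert (d # K) (succs (d # K)) \<subseteq> conts c []"
      using conts_closed[OF L] L Cons by auto
    have up: "fst ` set (upd k gs r gm) \<subseteq> {0,1,2,3}" if "fst gm \<in> {0,1,2,3}" for r gm
      using fst_upd[OF gs(2) gs(1) that] .
    have g: "gs ! active d \<in> {0,1,2,3}" if "\<not> active d \<ge> k"
      using that gs by (meson linorder_not_le nth_mem subsetD)
    show ?thesis
    proof (cases m)
      case Init
      then show ?thesis using L by auto
    next
      case Run
      obtain p m' e out where r: "run_delta d K a = ((p, m'), e, out)" by (metis prod.exhaust)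
      have "p \<in> conts c []" using run_delta_state[OF r] cl by blast
      then show ?thesis using Run Cons r up[of "(0, Stay)" k] by simp
    next
      case Scan
      have "fst ` set (upd k gs k (0, Stay)) \<subseteq> {0,1,2,3}" by (rule up) simp
      then show ?thesis using Scan Cons L g scan_alphabet[of "gs ! active d" d]
        up[of "(snd (scan d (gs ! active d)), MoveRight)" "active d"]
        up[of "(snd (scan d (gs ! active d)), MoveLeft)" "active d"]
        by (auto simp: Let_def simp del: insert_iff scan.simps)
    next
      case (Back z)
      have "resume d K z \<in> conts c []" using resume_succs[of d K z] cl by auto
      moreover have up3: "fst ` set (upd k gs (active d) (3, MoveRight)) \<subseteq> {0,1,2,3}"
        by (rule up) simp
      moreover have "fst ` set (upd k gs k (0, Stay)) \<subseteq> {0,1,2,3}" by (rule up) simp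
      ultimately show ?thesis using Back Cons L g
        up[of "(gs ! active d, MoveRight)" "active d"]
        up[of "(gs ! active d, MoveLeft)" "active d"] up3
        by (simp add: Let_def del: insert_iff)
    qed
  qed
  have delta: "case delta k (from_nat q) a gs of (p, d, ws, out) \<Rightarrow>
      to_nat p \<in> to_nat ` (conts c [] \<times> (UNIV :: mode set)) \<and> length ws = k \<and> fst ` set ws \<subseteq> {0, 1, 2, 3}"
    if q: "q \<in> to_nat ` (conts c [] \<times> (UNIV :: mode set))" and gs: "length gs = k" "set gs \<subseteq> {0, 1, 2, 3}"
    for q a gs
  proof -
    obtain L and m :: mode where "L \<in> conts c []" "q = to_nat (L, m)" using q by auto
    then show ?thesis using *[OF _ gs, of L m a] by (cases "delta k (L, m) a gs") auto
  qed
  have "finite (conts c [] \<times> (UNIV :: mode set))" using fin finite_conts by blast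
  moreover have "([c], m) \<in> conts c [] \<times> UNIV" "([], m) \<in> conts c [] \<times> UNIV" for m :: mode
    using conts_self by auto
  ultimately show ?thesis
    unfolding valid_tm_def using delta by (simp add: compile_def split_beta)
qed

text \<open>A counter is written with the least significant digit in cell 1, leading zeros allowed; cell 0
  holds the end mark 3, and the binary digits are represented by 1 and 2, because 0 is the blank.\<close>

definition tape :: "bool list \<Rightarrow> nat \<Rightarrow> nat" where
  "tape ds i = (if i = 0 then 3 else if i \<le> length ds then (if ds ! (i - 1) then 2 else 1) else 0)"

fun val :: "bool list \<Rightarrow> nat" where
  "val [] = 0"
| "val (d # ds) = of_bool d + 2 * val ds"

definition counter :: "nat \<Rightarrow> nat \<Rightarrow> (nat \<Rightarrow> nat) \<times> nat \<Rightarrow> bool" where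
  "counter B v tp \<longleftrightarrow> (\<exists>ds. tp = (tape ds, 1) \<and> val ds = v \<and> length ds \<le> B)"

section \<open>Simulation of counter programs, with the space they take\<close>

definition conf :: "com list \<times> mode \<Rightarrow> nat \<Rightarrow> ((nat \<Rightarrow> nat) \<times> nat) list \<Rightarrow> symbol list \<Rightarrow>
    (nat, nat) config" where
  "conf q h W out = \<lparr>cf_state = to_nat q, cf_input_pos = h, cf_work = W, cf_output = out\<rparr>"

definition represents :: "nat \<Rightarrow> nat \<Rightarrow> com list \<Rightarrow> store \<Rightarrow> (nat, nat) config \<Rightarrow> bool" where
  "represents k B K s cf \<longleftrightarrow> (\<exists>W. cf = conf (K, Run) (fst s) W (snd (snd s)) \<and> length W = k \<and>
     (\<forall>r<k. counter B (fst (snd s) r) (W ! r)))"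

definition low :: "nat \<Rightarrow> ((nat \<Rightarrow> nat) \<times> nat) list \<Rightarrow> bool" where
  "low n W \<longleftrightarrow> (\<forall>tp\<in>set W. snd tp \<le> n)"

lemma low_update [simp]: "low n W \<Longrightarrow> snd tp \<le> n \<Longrightarrow> low n (W[r := tp])"
  unfolding low_def using set_update_subset_insert[of W r tp] by auto

text \<open>Cell 0 holds the end mark, cells 1 to \<open>B\<close> the digits, and a scan may look
  at the blank in cell \<open>B + 1\<close>.\<close>

definition fits :: "nat \<Rightarrow> (nat, nat) config \<Rightarrow> bool" where
  "fits B cf \<longleftrightarrow> low (B + 1) (cf_work cf)"

text \<open>A machine step that records the space bound at both ends, so that chains of
  \<open>go\<close> carry the bound through all intermediate configurations.\<close>

definition go :: "nat \<Rightarrow> com \<Rightarrow> symbol list \<Rightarrow> nat \<Rightarrow> (nat, nat) config \<Rightarrow> (nat, nat) config \<Rightarrow> bool" where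
  "go k c x B cf cf' \<longleftrightarrow> fits B cf \<and> fits B cf' \<and> cf' = tm_step (compile k c) x cf"

lemma fits_conf [simp]: "fits B (conf q h W out) \<longleftrightarrow> low (B + 1) W"
  by (simp add: fits_def conf_def)

lemma map2_upd:
  assumes "length W = k" "r < k"
  shows "map2 (\<lambda>(T, p) (g, m). (T(p := g), move_head m p)) W
      (upd k (map (\<lambda>(T, p). T p) W) r (g, m)) =
    W[r := ((fst (W ! r))(snd (W ! r) := g), move_head m (snd (W ! r)))]"
  by (rule nth_equalityI)
    (use assms in \<open>auto simp: upd_def nth_list_update case_prod_beta\<close>)

lemma map2_upd_idle:
  assumes "length W = k"
  shows "map2 (\<lambda>(T, p) (g, m). (T(p := g), move_head m p)) W
      (upd k (map (\<lambda>(T, p). T p) W) k (g, m)) = W"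
  by (rule nth_equalityI) (use assms in \<open>auto simp: upd_def case_prod_beta\<close>)

lemma step_conf:
  assumes "q \<noteq> ([], Run)"
    and "delta k q (read_input x h) (map (\<lambda>(T, p). T p) W) = (q', d, ws, a)"
  shows "tm_step (compile k c) x (conf q h W out) =
    conf q' (min (length x + 1) (move_head d h))
      (map2 (\<lambda>(T, p) (g, m). (T(p := g), move_head m p)) W ws)
      (out @ (case a of None \<Rightarrow> [] | Some s \<Rightarrow> [s]))"
  using assms by (simp add: tm_step_def compile_def conf_def)

text \<open>The counterpart of iterating \<open>scan\<close> on digit lists, where the arithmetic
  can be proved without tapes.\<close>

fun scan_digits :: "com \<Rightarrow> bool list \<Rightarrow> bool list" where
  "scan_digits (Inc r) [] = [True]"
| "scan_digits (Inc r) (d # ds) = (if d then False # scan_digits (Inc r) ds else True # ds)"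
| "scan_digits (Dec r) (d # ds) = (if d then False # ds else True # scan_digits (Dec r) ds)"
| "scan_digits c ds = ds"

lemma tape_Suc_length [simp]: "tape (pre @ d # suf) (Suc (length pre)) = (if d then 2 else 1)"
  by (simp add: tape_def)

lemma tape_blank [simp]: "tape pre (Suc (length pre)) = 0"
  by (simp add: tape_def)

lemma tape_0 [simp]: "tape ds 0 = 3" "tape ds (Suc p) \<noteq> 3"
  by (auto simp: tape_def)

lemma tape_upd: "(tape (pre @ d # suf))(Suc (length pre) := if d' then 2 else 1) =
    tape (pre @ d' # suf)"
  by (rule ext) (auto simp: tape_def nth_append nth_Cons split: nat.splits)

lemma tape_snoc: "(tape pre)(Suc (length pre) := 2) = tape (pre @ [True])"
  by (rule ext) (auto simp: tape_def nth_append)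

fun counts :: "com \<Rightarrow> bool" where
  "counts (Inc r) = True"
| "counts (Dec r) = True"
| "counts (Cond (Zero r) c d) = True"
| "counts (Loop (Zero r) c) = True"
| "counts _ = False"

text \<open>Induction on the digits \<open>suf\<close> still ahead, with \<open>pre\<close> already
  rewritten. The head ends one cell to the left of the last cell written, which bounds
  \<open>p\<close> even if the number has grown by a digit. The flag is specified for tests only,
  since \<open>resume\<close> ignores it after \<open>Inc\<close> and \<open>Dec\<close>.\<close>

lemma scan_phase:
  assumes "counts c" "active c < k" "length W = k" "W ! active c = (tape (pre @ suf), Suc (length pre))"
    "length (pre @ suf) \<le> B" "low (B + 1) W" "h \<le> length x + 1"
  shows "\<exists>p z. (go k prog x B)\<^sup>*\<^sup>* (conf (c # K, Scan) h W out)
      (conf (c # K, Back z) h (W[active c := (tape (pre @ scan_digits c suf), p)]) out) \<and>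
      p \<le> length (pre @ scan_digits c suf) \<and> p \<le> B \<and>
      ((\<exists>r. c = Inc r \<or> c = Dec r) \<or> (z \<longleftrightarrow> True \<notin> set suf))"
  using assms
proof (induction suf arbitrary: pre W)
  case Nil
  let ?W = "W[active c := (tape (pre @ scan_digits c []), length pre)]"
  have g: "map (\<lambda>(T, p). T p) W ! active c = 0"
    using Nil.prems by simp
  have w: "\<not> fst (scan c 0)" "(tape pre)(Suc (length pre) := snd (scan c 0)) = tape (pre @ scan_digits c [])"
    by (cases c; auto simp: tape_snoc fun_upd_idem)+
  have "tm_step (compile k prog) x (conf (c # K, Scan) h W out) = conf (c # K, Back True) h ?W out"
    using Nil.prems g w
    by (subst step_conf) (auto simp: Let_def map2_upd simp del: fun_upd_apply)
  then have "go k prog x B (conf (c # K, Scan) h W out) (conf (c # K, Back True) h ?W out)"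
    unfolding go_def using Nil.prems by simp
  then show ?case using Nil.prems by (intro exI[of _ "length pre"] exI[of _ True]) auto
next
  case (Cons d suf)
  have g: "map (\<lambda>(T, p). T p) W ! active c = (if d then 2 else 1)"
    using Cons.prems by simp
  define g0 :: nat where "g0 = (if d then 2 else 1)"
  define w where "w = snd (scan c g0)"
  have w12: "w = 1 \<or> w = 2"
    using Cons.prems(1) by (cases c) (auto simp: w_def g0_def)
  have tp: "(tape (pre @ d # suf))(Suc (length pre) := w) = tape (pre @ (w = 2) # suf)"
    using tape_upd[of pre d suf "w = 2"] w12 by auto
  show ?case
  proof (cases "fst (scan c g0)")
    case False
    let ?W = "W[active c := (tape (pre @ (w = 2) # suf), length pre)]"
    have "tm_step (compile k prog) x (conf (c # K, Scan) h W out) =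
        conf (c # K, Back (\<not> d)) h ?W out"
      using Cons.prems g False tp
      by (subst step_conf) (auto simp: Let_def map2_upd g0_def w_def simp del: fun_upd_apply)
    then have "go k prog x B (conf (c # K, Scan) h W out) (conf (c # K, Back (\<not> d)) h ?W out)"
      unfolding go_def using Cons.prems by simp
    moreover have "scan_digits c (d # suf) = (w = 2) # suf"
      using False Cons.prems(1) by (cases c) (auto simp: g0_def w_def split: if_splits)
    moreover have "(\<exists>r. c = Inc r \<or> c = Dec r) \<or> d"
      using False Cons.prems(1) by (cases c) (auto simp: g0_def split: if_splits)
    ultimately show ?thesis using Cons.prems
      by (intro exI[of _ "length pre"] exI[of _ "\<not> d"]) auto
  next
    case True
    let ?W = "W[active c := (tape (pre @ (w = 2) # suf), Suc (Suc (length pre)))]"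
    have "tm_step (compile k prog) x (conf (c # K, Scan) h W out) = conf (c # K, Scan) h ?W out"
      using Cons.prems g True tp
      by (subst step_conf) (auto simp: Let_def map2_upd g0_def w_def simp del: fun_upd_apply)
    then have 1: "go k prog x B (conf (c # K, Scan) h W out) (conf (c # K, Scan) h ?W out)"
      unfolding go_def using Cons.prems by simp
    have sd: "scan_digits c (d # suf) = (w = 2) # scan_digits c suf"
      using True Cons.prems(1) by (cases c) (auto simp: g0_def w_def split: if_splits)
    have dd: "(\<exists>r. c = Inc r \<or> c = Dec r) \<or> \<not> d"
      using True Cons.prems(1) by (cases c) (auto simp: g0_def split: if_splits)
    obtain p z where "(go k prog x B)\<^sup>*\<^sup>* (conf (c # K, Scan) h ?W out)
      (conf (c # K, Back z) h (?W[active c := (tape ((pre @ [w = 2]) @ scan_digits c suf), p)]) out)"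
      "p \<le> length ((pre @ [w = 2]) @ scan_digits c suf)" "p \<le> B"
      "(\<exists>r. c = Inc r \<or> c = Dec r) \<or> (z \<longleftrightarrow> True \<notin> set suf)"
      using Cons.IH[of ?W "pre @ [w = 2]"] Cons.prems by auto
    then show ?thesis using 1 dd unfolding sd
      by (intro exI[of _ p] exI[of _ z]) (auto intro: converse_rtranclp_into_rtranclp)
  qed
qed

lemma back_phase:
  assumes "active c < k" "length W = k" "W ! active c = (tape ds, p)" "p \<le> length ds"
    "low (B + 1) W" "h \<le> length x + 1" "p \<le> B"
  shows "(go k prog x B)\<^sup>*\<^sup>* (conf (c # K, Back z) h W out)
      (conf (resume c K z, Run) h (W[active c := (tape ds, 1)]) out)"
  using assms
proof (induction p arbitrary: W)
  case 0
  have "tm_step (compile k prog) x (conf (c # K, Back z) h W out) =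
      conf (resume c K z, Run) h (W[active c := (tape ds, 1)]) out"
    using 0 by (subst step_conf) (auto simp: Let_def map2_upd fun_upd_idem)
  then have "go k prog x B (conf (c # K, Back z) h W out)
      (conf (resume c K z, Run) h (W[active c := (tape ds, 1)]) out)"
    unfolding go_def using 0 by simp
  then show ?case by blast
next
  case (Suc p)
  let ?W = "W[active c := (tape ds, p)]"
  have "tm_step (compile k prog) x (conf (c # K, Back z) h W out) = conf (c # K, Back z) h ?W out"
    using Suc.prems by (subst step_conf) (auto simp: Let_def map2_upd fun_upd_idem)
  then have 1: "go k prog x B (conf (c # K, Back z) h W out) (conf (c # K, Back z) h ?W out)"
    unfolding go_def using Suc.prems by simp
  have "(go k prog x B)\<^sup>*\<^sup>* (conf (c # K, Back z) h ?W out)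
      (conf (resume c K z, Run) h (?W[active c := (tape ds, 1)]) out)"
    using Suc.IH[of ?W] Suc.prems by auto
  then show ?case using 1 by (auto intro: converse_rtranclp_into_rtranclp)
qed

lemma val_inc: "val (scan_digits (Inc r) ds) = Suc (val ds)"
  by (induction ds) auto

lemma val_zero: "val ds = 0 \<longleftrightarrow> True \<notin> set ds"
  by (induction ds) auto

lemma length_inc: "length (scan_digits (Inc r) ds) = (if False \<in> set ds then length ds else Suc (length ds))"
  by (induction ds) auto

text \<open>By \<open>length_inc\<close> only a word consisting of ones grows, and its value is the
  largest for its length; together these exclude overflow.\<close>

lemma val_full: "False \<notin> set ds \<Longrightarrow> val ds + 1 = 2 ^ length ds"
  by (induction ds) auto

lemma length_dec: "length (scan_digits (Dec r) ds) = length ds"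
  by (induction ds) auto

lemma val_dec: "val ds \<noteq> 0 \<Longrightarrow> Suc (val (scan_digits (Dec r) ds)) = val ds"
  by (induction ds) auto

text \<open>Composes the switch to \<open>Scan\<close>, the scan and the return into the effect of
  one counter command. The hypothesis \<open>len\<close> excludes overflow, which only an increment
  can cause.\<close>

lemma counting_step:
  assumes c: "counts c" "active c < k" and rep: "represents k B (c # K) (h, \<rho>, out) cf"
    and h: "h \<le> length x + 1"
    and len: "\<And>ds. val ds = \<rho> (active c) \<Longrightarrow> length ds \<le> B \<Longrightarrow> length (scan_digits c ds) \<le> B"
  obtains W z ds ds' where "(go k prog x B)\<^sup>*\<^sup>* cf (conf (resume c K z, Run) h W out)"
    "length W = k" "\<And>r. r < k \<Longrightarrow> r \<noteq> active c \<Longrightarrow> counter B (\<rho> r) (W ! r)"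
    "W ! active c = (tape (scan_digits c ds), 1)" "val ds = \<rho> (active c)"
    "length (scan_digits c ds) \<le> B"
    "(\<exists>r. c = Inc r \<or> c = Dec r) \<or> (z \<longleftrightarrow> \<rho> (active c) = 0)"
proof -
  obtain W where cf: "cf = conf (c # K, Run) h W out" and W: "length W = k"
    "\<And>r. r < k \<Longrightarrow> counter B (\<rho> r) (W ! r)"
    using rep by (auto simp: represents_def)
  obtain ds where ds: "W ! active c = (tape ds, 1)" "val ds = \<rho> (active c)" "length ds \<le> B"
    using W(2)[OF c(2)] by (auto simp: counter_def)
  have fit: "low (B + 1) W"
    using W by (fastforce simp: low_def in_set_conv_nth counter_def)
  have "run_delta c K (read_input x h) = ((c # K, Scan), Stay, None)"
    using c(1) by (cases c rule: counts.cases) auto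
  then have "tm_step (compile k prog) x cf = conf (c # K, Scan) h W out"
    unfolding cf using W h by (subst step_conf) (auto simp: map2_upd_idle)
  then have 1: "go k prog x B cf (conf (c # K, Scan) h W out)"
    using fit by (simp add: go_def cf)
  have "\<exists>p z. (go k prog x B)\<^sup>*\<^sup>* (conf (c # K, Scan) h W out)
      (conf (c # K, Back z) h (W[active c := (tape ([] @ scan_digits c ds), p)]) out) \<and>
      p \<le> length ([] @ scan_digits c ds) \<and> p \<le> B \<and>
      ((\<exists>r. c = Inc r \<or> c = Dec r) \<or> (z \<longleftrightarrow> True \<notin> set ds))"
    using c W(1) ds(1,3) fit h by (intro scan_phase) simp_all
  then obtain p z where p: "(go k prog x B)\<^sup>*\<^sup>* (conf (c # K, Scan) h W out)
      (conf (c # K, Back z) h (W[active c := (tape (scan_digits c ds), p)]) out)"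
    "p \<le> length (scan_digits c ds)" "p \<le> B"
    "(\<exists>r. c = Inc r \<or> c = Dec r) \<or> (z \<longleftrightarrow> True \<notin> set ds)"
    by auto
  let ?W = "W[active c := (tape (scan_digits c ds), p)]"
  have back1: "(go k prog x B)\<^sup>*\<^sup>* (conf (c # K, Back z) h ?W out)
      (conf (resume c K z, Run) h (?W[active c := (tape (scan_digits c ds), 1)]) out)"
    using c W(1) p(2,3) fit h by (intro back_phase) simp_all
  then have 2: "(go k prog x B)\<^sup>*\<^sup>* cf
      (conf (resume c K z, Run) h (W[active c := (tape (scan_digits c ds), 1)]) out)"
    using rtranclp_trans[OF converse_rtranclp_into_rtranclp[of "go k prog x B", OF 1 p(1)] back1]
    by simp
  show ?thesis
  proof (rule that[OF 2])
    show "length (W[active c := (tape (scan_digits c ds), 1)]) = k" using W(1) by simp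
    show "counter B (\<rho> r) (W[active c := (tape (scan_digits c ds), 1)] ! r)" if "r < k" "r \<noteq> active c" for r
      using W(2)[OF that(1)] that(2) by simp
    show "W[active c := (tape (scan_digits c ds), 1)] ! active c = (tape (scan_digits c ds), 1)"
      using W(1) c(2) by simp
    show "val ds = \<rho> (active c)" by (fact ds(2))
    show "length (scan_digits c ds) \<le> B" using len ds by blast
    show "(\<exists>r. c = Inc r \<or> c = Dec r) \<or> (z \<longleftrightarrow> \<rho> (active c) = 0)"
      using p(4) ds(2) val_zero[of ds] by simp
  qed
qed

lemma plain_step:
  assumes rep: "represents k B (c # K) (h, \<rho>, out) cf"
    and d: "run_delta c K (read_input x h) = ((L, Run), d, a)"
    and "h' = min (length x + 1) (move_head d h)"
    and "out' = out @ (case a of None \<Rightarrow> [] | Some s \<Rightarrow> [s])"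
  obtains cf' where "(go k prog x B)\<^sup>*\<^sup>* cf cf'" "represents k B L (h', \<rho>, out') cf'"
proof -
  obtain W where cf: "cf = conf (c # K, Run) h W out" and W: "length W = k"
    "\<And>r. r < k \<Longrightarrow> counter B (\<rho> r) (W ! r)"
    using rep by (auto simp: represents_def)
  have fit: "low (B + 1) W"
    using W by (fastforce simp: low_def in_set_conv_nth counter_def)
  have "tm_step (compile k prog) x cf = conf (L, Run) h' W out'"
    unfolding cf using W assms by (subst step_conf) (auto simp: map2_upd_idle)
  then have "go k prog x B cf (conf (L, Run) h' W out')"
    using fit by (simp add: go_def cf)
  then show ?thesis using that[of "conf (L, Run) h' W out'"] W
    by (auto simp: represents_def)
qed

lemma represents_head: "exec x c s s' \<Longrightarrow> fst s \<le> length x + 1 \<Longrightarrow> fst s' \<le> length x + 1"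
  by (induction rule: exec.induct) auto

lemma test_step:
  assumes rep: "represents k B (c # K) s cf" and h: "fst s \<le> length x + 1"
    and c: "c = Cond t a b \<or> c = Loop t a" and "regs c \<subseteq> {..<k}"
  obtains cf' where "(go k prog x B)\<^sup>*\<^sup>* cf cf'" "represents k B (resume c K (holds x t s)) s cf'"
proof -
  obtain h \<rho> out where s: "s = (h, \<rho>, out)" by (metis prod.exhaust)
  show ?thesis
  proof (cases t)
    case (Zero r)
    have r: "counts c" "active c = r" "r < k" using c Zero assms(4) by auto
    have sd: "scan_digits c ds = ds" for ds using c by auto
    obtain W z ds where W: "(go k prog x B)\<^sup>*\<^sup>* cf (conf (resume c K z, Run) h W out)"
      "length W = k" "\<And>r'. r' < k \<Longrightarrow> r' \<noteq> r \<Longrightarrow> counter B (\<rho> r') (W ! r')"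
      "W ! r = (tape ds, 1)" "val ds = \<rho> r" "length ds \<le> B" "z \<longleftrightarrow> \<rho> r = 0"
    proof (rule counting_step[of c k B K h \<rho> out cf x prog])
      fix W z ds
      assume "(go k prog x B)\<^sup>*\<^sup>* cf (conf (resume c K z, Run) h W out)" "length W = k"
        "\<And>r. r < k \<Longrightarrow> r \<noteq> active c \<Longrightarrow> counter B (\<rho> r) (W ! r)"
        "W ! active c = (tape (scan_digits c ds), 1)" "val ds = \<rho> (active c)"
        "length (scan_digits c ds) \<le> B"
        "(\<exists>r. c = Inc r \<or> c = Dec r) \<or> (z \<longleftrightarrow> \<rho> (active c) = 0)"
      then show thesis using c unfolding r(2) sd by (intro that[of z W ds]) auto
    qed (use r rep h s sd in auto)
    have "counter B (\<rho> r') (W ! r')" if "r' < k" for r'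
      using W(3)[OF that] W(4,5,6) by (cases "r' = r") (auto simp: counter_def)
    then have "represents k B (resume c K (holds x t s)) s (conf (resume c K z, Run) h W out)"
      using W(2,7) Zero unfolding represents_def s by auto
    then show ?thesis using that W(1) by blast
  next
    case (Cell cs)
    have "run_delta c K (read_input x h) = ((resume c K (holds x t s), Run), Stay, None)"
      using c Cell s by auto
    then show ?thesis using plain_step[of k B c K h \<rho> out cf x _ Stay None h out] rep h that
      unfolding s by auto
  qed
qed

text \<open>Induction on the derivation, hence also a proof that the machine gets there in finitely
  many steps. The stack \<open>K\<close> is general, so that the first part of a sequence or a loop
  body can run on top of what follows it.\<close>

lemma exec_simulation:
  assumes "exec x c s s'" "regs c \<subseteq> {..<k}" "length x + 1 < 2 ^ B" "fst s \<le> length x + 1"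
    "represents k B (c # K) s cf"
  shows "\<exists>cf'. (go k prog x B)\<^sup>*\<^sup>* cf cf' \<and> represents k B K s' cf'"
  using assms
proof (induction arbitrary: K cf rule: exec.induct)
  case (Skip s)
  obtain h \<rho> out where s: "s = (h, \<rho>, out)" by (metis prod.exhaust)
  show ?case using plain_step[of k B com.Skip K h \<rho> out cf x K Stay None h out prog] Skip s by auto
next
  case (Inc \<rho> r h out)
  \<comment> \<open>Growing beyond \<open>B\<close> digits takes \<open>B\<close> ones, hence the
    value \<open>2 ^ B - 1\<close>, which exceeds \<open>length x\<close>.\<close>
  have len: "length (scan_digits (com.Inc r) ds) \<le> B" if "val ds = \<rho> r" "length ds \<le> B" for ds
  proof (rule ccontr)
    assume "\<not> ?thesis"
    then have "False \<notin> set ds" "length ds = B" using that by (auto simp: length_inc split: if_splits)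
    then have "\<rho> r + 1 = 2 ^ B" using val_full[of ds] that by simp
    then show False using Inc by simp
  qed
  obtain W ds where W: "(go k prog x B)\<^sup>*\<^sup>* cf (conf (K, Run) h W out)"
      "length W = k" "\<And>r'. r' < k \<Longrightarrow> r' \<noteq> r \<Longrightarrow> counter B (\<rho> r') (W ! r')"
      "W ! r = (tape (scan_digits (com.Inc r) ds), 1)" "val ds = \<rho> r" "length (scan_digits (com.Inc r) ds) \<le> B"
  proof (rule counting_step[of "com.Inc r" k B K h \<rho> out cf x prog])
    fix W z ds
    assume "(go k prog x B)\<^sup>*\<^sup>* cf (conf (resume (com.Inc r) K z, Run) h W out)" "length W = k"
      "\<And>r'. r' < k \<Longrightarrow> r' \<noteq> active (com.Inc r) \<Longrightarrow> counter B (\<rho> r') (W ! r')"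
      "W ! active (com.Inc r) = (tape (scan_digits (com.Inc r) ds), 1)" "val ds = \<rho> (active (com.Inc r))"
      "length (scan_digits (com.Inc r) ds) \<le> B"
    then show thesis by (intro that[of W ds]) simp_all
  qed (use Inc len in simp_all)
  have "represents k B K (h, \<rho>(r := Suc (\<rho> r)), out) (conf (K, Run) h W out)"
    using W val_inc[of r ds] unfolding represents_def
    by (intro exI[of _ W]) (auto simp: counter_def)
  then show ?case using W(1) by blast
next
  case (Dec \<rho> r h out)
  obtain W ds where W: "(go k prog x B)\<^sup>*\<^sup>* cf (conf (K, Run) h W out)"
      "length W = k" "\<And>r'. r' < k \<Longrightarrow> r' \<noteq> r \<Longrightarrow> counter B (\<rho> r') (W ! r')"
      "W ! r = (tape (scan_digits (com.Dec r) ds), 1)" "val ds = \<rho> r" "length (scan_digits (com.Dec r) ds) \<le> B"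
  proof (rule counting_step[of "com.Dec r" k B K h \<rho> out cf x prog])
    fix W z ds
    assume "(go k prog x B)\<^sup>*\<^sup>* cf (conf (resume (com.Dec r) K z, Run) h W out)" "length W = k"
      "\<And>r'. r' < k \<Longrightarrow> r' \<noteq> active (com.Dec r) \<Longrightarrow> counter B (\<rho> r') (W ! r')"
      "W ! active (com.Dec r) = (tape (scan_digits (com.Dec r) ds), 1)" "val ds = \<rho> (active (com.Dec r))"
      "length (scan_digits (com.Dec r) ds) \<le> B"
    then show thesis by (intro that[of W ds]) simp_all
  qed (use Dec length_dec in simp_all)
  have "represents k B K (h, \<rho>(r := \<rho> r - 1), out) (conf (K, Run) h W out)"
    using W val_dec[of ds r] Dec(1) unfolding represents_def
    by (intro exI[of _ W]) (auto simp: counter_def)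
  then show ?case using W(1) by blast
next
  case (Lft h \<rho> out)
  show ?case using plain_step[of k B com.Lft K h \<rho> out cf x K MoveLeft None "h - 1" out prog] Lft by auto
next
  case (Rgt h \<rho> out)
  show ?case using plain_step[of k B com.Rgt K h \<rho> out cf x K MoveRight None
      "min (length x + 1) (h + 1)" out prog] Rgt by auto
next
  case (Emit a h \<rho> out)
  show ?case using plain_step[of k B "com.Emit a" K h \<rho> out cf x K Stay "Some a" h "out @ [a]" prog]
    Emit by auto
next
  case (Seq c s s' d s'')
  obtain h \<rho> out where s: "s = (h, \<rho>, out)" by (metis prod.exhaust)
  obtain cf1 where 1: "(go k prog x B)\<^sup>*\<^sup>* cf cf1" "represents k B (c # d # K) s cf1"
    using plain_step[of k B "com.Seq c d" K h \<rho> out cf x "c # d # K" Stay None h out prog] Seq s by auto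
  have h': "fst s' \<le> length x + 1" using represents_head Seq by blast
  obtain cf2 where 2: "(go k prog x B)\<^sup>*\<^sup>* cf1 cf2" "represents k B (d # K) s' cf2"
    using Seq.IH(1)[OF _ _ _ 1(2)] Seq.prems by auto
  obtain cf3 where 3: "(go k prog x B)\<^sup>*\<^sup>* cf2 cf3" "represents k B K s'' cf3"
    using Seq.IH(2)[OF _ _ h' 2(2)] Seq.prems by auto
  show ?case using 1 2 3 by (meson rtranclp_trans)
next
  case (Cond_True t s c s' d)
  obtain cf1 where 1: "(go k prog x B)\<^sup>*\<^sup>* cf cf1" "represents k B (c # K) s cf1"
    using test_step[of k B "com.Cond t c d" K s cf x t c d prog] Cond_True by auto
  obtain cf2 where 2: "(go k prog x B)\<^sup>*\<^sup>* cf1 cf2" "represents k B K s' cf2"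
    using Cond_True.IH[OF _ _ _ 1(2)] Cond_True.prems by auto
  show ?case using 1 2 by (meson rtranclp_trans)
next
  case (Cond_False t s d s' c)
  obtain cf1 where 1: "(go k prog x B)\<^sup>*\<^sup>* cf cf1" "represents k B (d # K) s cf1"
    using test_step[of k B "com.Cond t c d" K s cf x t c d prog] Cond_False by auto
  obtain cf2 where 2: "(go k prog x B)\<^sup>*\<^sup>* cf1 cf2" "represents k B K s' cf2"
    using Cond_False.IH[OF _ _ _ 1(2)] Cond_False.prems by auto
  show ?case using 1 2 by (meson rtranclp_trans)
next
  case (Loop_True t s c)
  then show ?case using test_step[of k B "com.Loop t c" K s cf x t c c prog]
    by (metis resume.simps(2))
next
  case (Loop_False t s c s' s'')
  obtain cf1 where 1: "(go k prog x B)\<^sup>*\<^sup>* cf cf1" "represents k B (c # com.Loop t c # K) s cf1"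
    using test_step[of k B "com.Loop t c" K s cf x t c c prog] Loop_False by auto
  have h': "fst s' \<le> length x + 1" using represents_head Loop_False by blast
  obtain cf2 where 2: "(go k prog x B)\<^sup>*\<^sup>* cf1 cf2" "represents k B (com.Loop t c # K) s' cf2"
    using Loop_False.IH(1)[OF _ _ _ 1(2)] Loop_False.prems by auto
  obtain cf3 where 3: "(go k prog x B)\<^sup>*\<^sup>* cf2 cf3" "represents k B K s'' cf3"
    using Loop_False.IH(2)[OF _ _ h' 2(2)] Loop_False.prems by auto
  show ?case using 1 2 3 by (meson rtranclp_trans)
qed

lemma go_run:
  assumes "(go k c x B)\<^sup>*\<^sup>* cf cf'" "fits B cf"
  obtains t where "(tm_step (compile k c) x ^^ t) cf = cf'"
    "\<And>j. j \<le> t \<Longrightarrow> fits B ((tm_step (compile k c) x ^^ j) cf)"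
proof -
  have "\<exists>t. (tm_step (compile k c) x ^^ t) cf = cf' \<and>
      (\<forall>j\<le>t. fits B ((tm_step (compile k c) x ^^ j) cf))"
    using assms
  proof (induction rule: rtranclp_induct)
    case base
    then show ?case by (intro exI[of _ 0]) auto
  next
    case (step cf1 cf2)
    then obtain t where "(tm_step (compile k c) x ^^ t) cf = cf1"
      "\<forall>j\<le>t. fits B ((tm_step (compile k c) x ^^ j) cf)" by auto
    then show ?case using step(2) by (intro exI[of _ "Suc t"]) (auto simp: go_def le_Suc_eq)
  qed
  then show thesis using that by blast
qed

lemma tm_step_halted: "cf_state cf = tm_halt M \<Longrightarrow> (tm_step M x ^^ j) cf = cf"
  by (induction j) (auto simp: tm_step_def)

text \<open>The space bound holds at all times: until halting by the chain of \<open>go\<close>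
  steps, afterwards because the configuration is frozen. \<open>B + 2\<close> counts the cells 0 to
  \<open>B + 1\<close>.\<close>

theorem compile_correct:
  assumes "exec x c (0, \<lambda>_. 0, []) (h, \<rho>, y)" "regs c \<subseteq> {..<k}" "length x + 1 < 2 ^ B" "real B + 2 \<le> s"
  shows "runs_in_space (compile k c) x s" "halts_with_output (compile k c) x y"
proof -
  let ?M = "compile k c"
  define W where "W = replicate k (tape [], 1 :: nat)"
  have init: "initial_config ?M = conf ([c], Init) 0 (replicate k (\<lambda>_. 0, 0)) []"
    by (simp add: initial_config_def compile_def conf_def)
  have up: "(\<lambda>_. 0 :: nat)(0 := 3) = tape []"
    by (rule ext) (simp add: tape_def)
  have "tm_step ?M x (initial_config ?M) = conf ([c], Run) 0 W []"
    unfolding init by (subst step_conf) (auto simp: up W_def zip_replicate)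
  then have g: "go k c x B (initial_config ?M) (conf ([c], Run) 0 W [])"
    unfolding go_def init by (auto simp: W_def low_def)
  have "represents k B [c] (0, \<lambda>_. 0, []) (conf ([c], Run) 0 W [])"
    unfolding represents_def W_def
    by (intro exI[of _ W]) (auto simp: W_def counter_def intro!: exI[of _ "[]"])
  then have "\<exists>cf. (go k c x B)\<^sup>*\<^sup>* (conf ([c], Run) 0 W []) cf \<and> represents k B [] (h, \<rho>, y) cf"
    using exec_simulation[OF assms(1,2,3)] by simp
  then obtain cf where cf: "(go k c x B)\<^sup>*\<^sup>* (conf ([c], Run) 0 W []) cf"
      "represents k B [] (h, \<rho>, y) cf"
    by blast
  obtain t where t: "(tm_step ?M x ^^ t) (initial_config ?M) = cf"
    "\<And>j. j \<le> t \<Longrightarrow> fits B ((tm_step ?M x ^^ j) (initial_config ?M))"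
    using go_run[OF converse_rtranclp_into_rtranclp[of "go k c x B", OF g cf(1)]] g
    by (metis go_def)
  have halt: "cf_state cf = tm_halt ?M" "cf_output cf = y"
    using cf(2) by (auto simp: represents_def conf_def compile_def)
  then show "halts_with_output ?M x y"
    unfolding halts_with_output_def config_at_def using t(1) by blast
  have "fits B (config_at ?M x j)" for j
  proof (cases "j \<le> t")
    case False
    then obtain i where "j = i + t" by (metis le_add_diff_inverse2 nat_le_linear)
    then have "config_at ?M x j = cf"
      using t(1) tm_step_halted[OF halt(1)] by (simp add: config_at_def funpow_add)
    then show ?thesis using t(1) t(2)[OF order_refl] by simp
  qed (use t in \<open>auto simp: config_at_def\<close>)
  then show "runs_in_space ?M x s"
    unfolding runs_in_space_def fits_def low_def using assms(4) by fastforce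
qed

section \<open>Weakest preconditions and basic subroutines\<close>

text \<open>Total correctness: a terminating run within the counter bound is asserted. In the
  backward use of the rules, \<open>Q\<close> is itself the precondition of all that remains to be
  run.\<close>

definition wp :: "symbol list \<Rightarrow> com \<Rightarrow> (store \<Rightarrow> bool) \<Rightarrow> store \<Rightarrow> bool" where
  "wp x c Q s \<longleftrightarrow> (\<exists>s'. exec x c s s' \<and> Q s')"

lemma wp_Skip: "Q s \<Longrightarrow> wp x Skip Q s"
  unfolding wp_def using exec.Skip by blast

lemma wp_Inc: "\<rho> r \<le> length x \<Longrightarrow> Q (h, \<rho>(r := Suc (\<rho> r)), out) \<Longrightarrow> wp x (Inc r) Q (h, \<rho>, out)"
  unfolding wp_def using exec.Inc by blast

lemma wp_Dec: "\<rho> r \<noteq> 0 \<Longrightarrow> Q (h, \<rho>(r := \<rho> r - 1), out) \<Longrightarrow> wp x (Dec r) Q (h, \<rho>, out)"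
  unfolding wp_def using exec.Dec by blast

lemma wp_Lft: "Q (h - 1, \<rho>, out) \<Longrightarrow> wp x Lft Q (h, \<rho>, out)"
  unfolding wp_def using exec.Lft by blast

lemma wp_Rgt: "h \<le> length x \<Longrightarrow> Q (Suc h, \<rho>, out) \<Longrightarrow> wp x Rgt Q (h, \<rho>, out)"
  unfolding wp_def using exec.Rgt[of x h \<rho> out] by auto

lemma wp_Emit: "Q (h, \<rho>, out @ [a]) \<Longrightarrow> wp x (Emit a) Q (h, \<rho>, out)"
  unfolding wp_def using exec.Emit by blast

lemma wp_Seq: "wp x c (wp x d Q) s \<Longrightarrow> wp x (Seq c d) Q s"
  unfolding wp_def using exec.Seq by blast

lemma wp_Cond: "(holds x t s \<Longrightarrow> wp x c Q s) \<Longrightarrow> (\<not> holds x t s \<Longrightarrow> wp x d Q s) \<Longrightarrow> wp x (Cond t c d) Q s"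
  unfolding wp_def using exec.Cond_True exec.Cond_False by metis

lemma wp_Loop_True: "holds x t s \<Longrightarrow> Q s \<Longrightarrow> wp x (Loop t c) Q s"
  unfolding wp_def using exec.Loop_True by blast

lemma wp_Loop_False: "\<not> holds x t s \<Longrightarrow> wp x c (wp x (Loop t c) Q) s \<Longrightarrow> wp x (Loop t c) Q s"
  unfolding wp_def using exec.Loop_False by blast

abbreviation seq (infixr \<open>;;\<close> 60) where "c ;; d \<equiv> Seq c d"

section \<open>Arithmetic on counters\<close>

definition clear :: "nat \<Rightarrow> com" where
  "clear r = Loop (Zero r) (Dec r)"

lemma wp_clear: "Q (h, \<rho>(r := 0), out) \<Longrightarrow> wp x (clear r) Q (h, \<rho>, out)"
proof (induction "\<rho> r" arbitrary: \<rho>)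
  case 0
  have eq: "\<rho>(r := 0) = \<rho>" using 0(1)[symmetric] by (simp add: fun_upd_idem)
  have "Q (h, \<rho>, out)" using 0(2) unfolding eq .
  then show ?case unfolding clear_def using 0(1)[symmetric] by (intro wp_Loop_True) simp_all
next
  case (Suc v)
  have L: "wp x (clear r) Q (h, \<rho>(r := \<rho> r - 1), out)"
    by (rule Suc.hyps(1)) (use Suc.hyps(2)[symmetric] Suc.prems in simp_all)
  show ?case unfolding clear_def
    by (rule wp_Loop_False, use Suc.hyps(2)[symmetric] in simp, intro wp_Dec) (use Suc.hyps(2)[symmetric] L[unfolded clear_def] in simp_all)
qed

definition move2 :: "nat \<Rightarrow> nat \<Rightarrow> nat \<Rightarrow> com" where
  "move2 a b c = Loop (Zero a) (Dec a ;; Inc b ;; Inc c)"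

lemma wp_move2:
  assumes "a \<noteq> b" "a \<noteq> c" "b \<noteq> c" "\<rho> b + \<rho> a \<le> length x + 1" "\<rho> c + \<rho> a \<le> length x + 1"
    and "Q (h, \<rho>(a := 0, b := \<rho> b + \<rho> a, c := \<rho> c + \<rho> a), out)"
  shows "wp x (move2 a b c) Q (h, \<rho>, out)"
  using assms
proof (induction "\<rho> a" arbitrary: \<rho>)
  case 0
  have eq: "\<rho>(a := 0, b := \<rho> b + \<rho> a, c := \<rho> c + \<rho> a) = \<rho>" using 0(1)[symmetric] by (auto simp: fun_eq_iff)
  have "Q (h, \<rho>, out)" using 0(7) unfolding eq .
  then show ?case using 0(1)[symmetric] unfolding move2_def by (intro wp_Loop_True) simp_all
next
  case (Suc v)
  let ?\<rho> = "\<rho>(a := \<rho> a - 1, b := Suc (\<rho> b), c := Suc (\<rho> c))"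
  have eq: "?\<rho>(a := 0, b := ?\<rho> b + ?\<rho> a, c := ?\<rho> c + ?\<rho> a) =
      \<rho>(a := 0, b := \<rho> b + \<rho> a, c := \<rho> c + \<rho> a)"
    using Suc.prems(1-3) Suc.hyps(2)[symmetric] by (auto simp: fun_eq_iff)
  have "Q (h, ?\<rho>(a := 0, b := ?\<rho> b + ?\<rho> a, c := ?\<rho> c + ?\<rho> a), out)"
    using Suc.prems(6) unfolding eq .
  then have L: "wp x (move2 a b c) Q (h, ?\<rho>, out)"
    by (intro Suc.hyps(1)) (use Suc.prems(1-5) Suc.hyps(2)[symmetric] in simp_all)
  show ?case unfolding move2_def
    by (rule wp_Loop_False, use Suc.prems(1-5) Suc.hyps(2)[symmetric] in simp, intro wp_Seq wp_Dec wp_Inc) (use Suc.prems(1-5) Suc.hyps(2)[symmetric] L[unfolded move2_def] in simp_all)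
qed

definition move1 :: "nat \<Rightarrow> nat \<Rightarrow> com" where
  "move1 a b = Loop (Zero a) (Dec a ;; Inc b)"

lemma wp_move1:
  assumes "a \<noteq> b" "\<rho> b + \<rho> a \<le> length x + 1"
    and "Q (h, \<rho>(a := 0, b := \<rho> b + \<rho> a), out)"
  shows "wp x (move1 a b) Q (h, \<rho>, out)"
  using assms
proof (induction "\<rho> a" arbitrary: \<rho>)
  case 0
  have eq: "\<rho>(a := 0, b := \<rho> b + \<rho> a) = \<rho>" using 0(1)[symmetric] by (auto simp: fun_eq_iff)
  have "Q (h, \<rho>, out)" using 0(4) unfolding eq .
  then show ?case using 0(1)[symmetric] unfolding move1_def by (intro wp_Loop_True) simp_all
next
  case (Suc v)
  let ?\<rho> = "\<rho>(a := \<rho> a - 1, b := Suc (\<rho> b))"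
  have eq: "?\<rho>(a := 0, b := ?\<rho> b + ?\<rho> a) = \<rho>(a := 0, b := \<rho> b + \<rho> a)"
    using Suc.prems(1) Suc.hyps(2)[symmetric] by (auto simp: fun_eq_iff)
  have "Q (h, ?\<rho>(a := 0, b := ?\<rho> b + ?\<rho> a), out)"
    using Suc.prems(3) unfolding eq .
  then have L: "wp x (move1 a b) Q (h, ?\<rho>, out)"
    by (intro Suc.hyps(1)) (use Suc.prems(1,2) Suc.hyps(2)[symmetric] in simp_all)
  show ?case unfolding move1_def
    by (rule wp_Loop_False, use Suc.prems(1,2) Suc.hyps(2)[symmetric] in simp, intro wp_Seq wp_Dec wp_Inc) (use Suc.prems(1,2) Suc.hyps(2)[symmetric] L[unfolded move1_def] in simp_all)
qed

text \<open>\<open>tidy x m \<rho>\<close>: the registers from \<open>m\<close> on are free for the local use of subroutines,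
  which leave them at 0.\<close>

definition tidy :: "symbol list \<Rightarrow> nat \<Rightarrow> (nat \<Rightarrow> nat) \<Rightarrow> bool" where
  "tidy x m \<rho> \<longleftrightarrow> (\<forall>r. \<rho> r \<le> length x + 1) \<and> (\<forall>r\<ge>m. \<rho> r = 0)"

lemma tidy_upd [simp]: "tidy x m \<rho> \<Longrightarrow> r < m \<Longrightarrow> v \<le> length x + 1 \<Longrightarrow> tidy x m (\<rho>(r := v))"
  by (auto simp: tidy_def)

lemma tidy_mono: "tidy x m \<rho> \<Longrightarrow> m \<le> m' \<Longrightarrow> tidy x m' \<rho>"
  by (auto simp: tidy_def)

lemma tidy_bound: "tidy x m \<rho> \<Longrightarrow> \<rho> r \<le> length x + 1"
  by (simp add: tidy_def)

text \<open>Counters can only be emptied into one another: the source goes into the target and into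
  register 40, from which it is then restored.\<close>

definition copy :: "nat \<Rightarrow> nat \<Rightarrow> com" where
  "copy a b = clear b ;; move2 a b 40 ;; move1 40 a"

lemma wp_copy:
  assumes "tidy x 40 \<rho>" "a \<noteq> b" "a < 40" "b < 40" "Q (h, \<rho>(b := \<rho> a), out)"
  shows "wp x (copy a b) Q (h, \<rho>, out)"
proof -
  have z: "\<rho> 40 = 0" "\<rho> a \<le> length x + 1" using assms(1) by (auto simp: tidy_def)
  let ?\<rho>1 = "\<rho>(a := 0, b := \<rho> a, 40 := \<rho> a)"
  have eq: "?\<rho>1(40 := 0, a := ?\<rho>1 a + ?\<rho>1 40) = \<rho>(b := \<rho> a)"
    using assms(2-4) z by (auto simp: fun_eq_iff)
  have "wp x (move1 40 a) Q (h, ?\<rho>1, out)"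
    by (rule wp_move1, unfold eq) (use assms(2-5) z in auto)
  moreover
  let ?\<rho>0 = "\<rho>(b := 0)"
  have eq': "?\<rho>0(a := 0, b := ?\<rho>0 b + ?\<rho>0 a, 40 := ?\<rho>0 40 + ?\<rho>0 a) = ?\<rho>1"
    using assms(2-4) z by (auto simp: fun_eq_iff)
  ultimately have "wp x (move2 a b 40) (wp x (move1 40 a) Q) (h, ?\<rho>0, out)"
    by (intro wp_move2, unfold eq') (use assms(2-4) z in auto)
  then show ?thesis unfolding copy_def by (intro wp_Seq wp_clear)
qed

text \<open>The copies in 37 and 38 are counted down together, and 39 collects what 37 has in
  excess. In the end 38 and 39 hold the two truncated differences, at most one of which is nonzero.
  It is cleared before the branch is entered, so that branches may themselves use these
  registers.\<close>

definition compare :: "nat \<Rightarrow> nat \<Rightarrow> com \<Rightarrow> com \<Rightarrow> com \<Rightarrow> com" where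
  "compare a b lt eq gt = copy a 37 ;; copy b 38 ;;
     Loop (Zero 37) (Dec 37 ;; Cond (Zero 38) (Inc 39) (Dec 38)) ;;
     Cond (Zero 38) (Cond (Zero 39) eq (clear 39 ;; gt)) (clear 38 ;; lt)"

lemma wp_compare:
  assumes t: "tidy x 37 \<rho>" and ab: "a < 37" "b < 37"
    and lt: "\<rho> a < \<rho> b \<Longrightarrow> wp x lt Q (h, \<rho>, out)"
    and eq: "\<rho> a = \<rho> b \<Longrightarrow> wp x eq Q (h, \<rho>, out)"
    and gt: "\<rho> b < \<rho> a \<Longrightarrow> wp x gt Q (h, \<rho>, out)"
  shows "wp x (compare a b lt eq gt) Q (h, \<rho>, out)"
proof -
  have bd: "\<rho> r \<le> length x + 1" for r using t tidy_bound by blast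
  have z: "\<rho> 37 = 0" "\<rho> 38 = 0" "\<rho> 39 = 0" "\<rho> 40 = 0" using t by (auto simp: tidy_def)
  have t40: "tidy x 40 \<rho>" using t tidy_mono by fastforce
  let ?fin = "wp x (Cond (Zero 38) (Cond (Zero 39) eq (clear 39 ;; gt)) (clear 38 ;; lt)) Q"
  define upd where "upd = (\<lambda>u v w. \<rho>(37 := u, 38 := v, 39 := w))"
  have upd: "(upd u v w)(37 := u') = upd u' v w" "(upd u v w)(38 := v') = upd u v' w"
    "(upd u v w)(39 := w') = upd u v w'" "upd u v w 37 = u" "upd u v w 38 = v" "upd u v w 39 = w"
    for u v w u' v' w'
    by (auto simp: upd_def fun_eq_iff)
  have upd0: "upd 0 0 0 = \<rho>"
    using z by (auto simp: upd_def fun_eq_iff)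
  have fin: "?fin (h, upd 0 (\<rho> b - \<rho> a) (\<rho> a - \<rho> b), out)"
  proof -
    consider "\<rho> a < \<rho> b" | "\<rho> a = \<rho> b" | "\<rho> b < \<rho> a" by linarith
    then show ?thesis
    proof cases
      case 1
      then show ?thesis
        by (intro wp_Cond wp_Seq wp_clear) (use lt in \<open>auto simp: upd upd0\<close>)
    next
      case 2
      then show ?thesis
        by (intro wp_Cond wp_Seq wp_clear) (use eq in \<open>auto simp: upd upd0 z\<close>)
    next
      case 3
      then show ?thesis
        by (intro wp_Cond wp_Seq wp_clear) (use gt in \<open>auto simp: upd upd0\<close>)
    qed
  qed
  \<comment> \<open>The two truncated differences in the last two hypotheses are the loop
    invariant.\<close>
  have loop: "wp x (Loop (Zero 37) (Dec 37 ;; Cond (Zero 38) (Inc 39) (Dec 38))) ?fin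
      (h, upd u v w, out)"
    if "w + u \<le> length x + 1" "v = 0 \<or> w = 0"
      "v - u = \<rho> b - \<rho> a" "w + (u - v) = \<rho> a - \<rho> b" for u v w
    using that
  proof (induction u arbitrary: v w)
    case 0
    then show ?case by (intro wp_Loop_True) (use fin in \<open>auto simp: upd\<close>)
  next
    case (Suc u)
    show ?case
    proof (cases "v = 0")
      case True
      have "wp x (Loop (Zero 37) (Dec 37 ;; Cond (Zero 38) (Inc 39) (Dec 38))) ?fin
        (h, upd u 0 (Suc w), out)" by (rule Suc.IH) (use Suc.prems True in auto)
      note L = this
      show ?thesis
        by (rule wp_Loop_False, simp add: upd, intro wp_Seq wp_Dec wp_Cond wp_Inc)
          (use L True Suc.prems in \<open>simp_all add: upd\<close>)
    next
      case False
      have "wp x (Loop (Zero 37) (Dec 37 ;; Cond (Zero 38) (Inc 39) (Dec 38))) ?fin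
        (h, upd u (v - 1) w, out)" by (rule Suc.IH) (use Suc.prems False in auto)
      note L = this
      show ?thesis
        by (rule wp_Loop_False, simp add: upd, intro wp_Seq wp_Dec wp_Cond wp_Inc)
          (use L False Suc.prems in \<open>simp_all add: upd\<close>)
    qed
  qed
  have "wp x (Loop (Zero 37) (Dec 37 ;; Cond (Zero 38) (Inc 39) (Dec 38))) ?fin
      (h, upd (\<rho> a) (\<rho> b) 0, out)"
    by (rule loop) (use bd in auto)
  moreover have "\<rho>(37 := \<rho> a, 38 := (\<rho>(37 := \<rho> a)) b) = upd (\<rho> a) (\<rho> b) 0"
    using z ab by (auto simp: upd_def fun_eq_iff)
  ultimately have "wp x (Loop (Zero 37) (Dec 37 ;; Cond (Zero 38) (Inc 39) (Dec 38))) ?fin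
      (h, \<rho>(37 := \<rho> a, 38 := (\<rho>(37 := \<rho> a)) b), out)"
    by (simp only:)
  moreover have "tidy x 40 (\<rho>(37 := \<rho> a))" using t40 bd by simp
  ultimately show ?thesis unfolding compare_def
    by (intro wp_Seq wp_copy) (use t40 ab in simp_all)
qed

section \<open>Head positions and words on the input tape\<close>

lemma read_input_LeftEnd [simp]: "read_input x h = LeftEnd \<longleftrightarrow> h = 0"
  by (simp add: read_input_def)

definition rewind :: com where
  "rewind = Loop (Cell [LeftEnd]) Lft"

lemma wp_rewind: "Q (0, \<rho>, out) \<Longrightarrow> wp x rewind Q (h, \<rho>, out)"
proof (induction h)
  case 0
  then show ?case unfolding rewind_def by (intro wp_Loop_True) simp_all
next
  case (Suc h)
  then have L: "wp x rewind Q (h, \<rho>, out)" by blast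
  show ?case unfolding rewind_def
    by (rule wp_Loop_False, simp, rule wp_Lft) (use L[unfolded rewind_def] in simp)
qed

definition forward :: "nat \<Rightarrow> com" where
  "forward r = Loop (Zero r) (Dec r ;; Inc 40 ;; Rgt)"

lemma wp_forward:
  assumes "r < 40" "\<rho> 40 + \<rho> r \<le> length x + 1" "h + \<rho> r \<le> length x + 1"
    and "Q (h + \<rho> r, \<rho>(r := 0, 40 := \<rho> 40 + \<rho> r), out)"
  shows "wp x (forward r) Q (h, \<rho>, out)"
  using assms
proof (induction "\<rho> r" arbitrary: \<rho> h)
  case 0
  have eq: "\<rho>(r := 0, 40 := \<rho> 40 + \<rho> r) = \<rho>" using 0(1)[symmetric] by (auto simp: fun_eq_iff)
  have "Q (h, \<rho>, out)" using 0(5) unfolding eq using 0(1)[symmetric] by simp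
  then show ?case using 0(1)[symmetric] unfolding forward_def by (intro wp_Loop_True) simp_all
next
  case (Suc v)
  let ?\<rho> = "\<rho>(r := \<rho> r - 1, 40 := Suc (\<rho> 40))"
  have eq: "?\<rho>(r := 0, 40 := ?\<rho> 40 + ?\<rho> r) = \<rho>(r := 0, 40 := \<rho> 40 + \<rho> r)" "Suc h + ?\<rho> r = h + \<rho> r"
    using Suc.prems(1) Suc.hyps(2)[symmetric] by (auto simp: fun_eq_iff)
  have "Q (Suc h + ?\<rho> r, ?\<rho>(r := 0, 40 := ?\<rho> 40 + ?\<rho> r), out)"
    using Suc.prems(4) unfolding eq .
  then have L: "wp x (forward r) Q (Suc h, ?\<rho>, out)"
    by (intro Suc.hyps(1)) (use Suc.prems(1-3) Suc.hyps(2)[symmetric] in simp_all)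
  show ?case unfolding forward_def
    by (rule wp_Loop_False, use Suc.hyps(2)[symmetric] in simp, intro wp_Seq wp_Dec wp_Inc wp_Rgt)
      (use Suc.prems(1-3) Suc.hyps(2)[symmetric] L[unfolded forward_def] in simp_all)
qed

text \<open>The head is rewound and then driven right by counting \<open>r\<close> down; register 40
  collects the count, from which \<open>r\<close> is restored.\<close>

definition seek :: "nat \<Rightarrow> com" where
  "seek r = rewind ;; forward r ;; move1 40 r"

lemma wp_seek:
  assumes "tidy x 40 \<rho>" "r < 40" "Q (\<rho> r, \<rho>, out)"
  shows "wp x (seek r) Q (h, \<rho>, out)"
proof -
  have z: "\<rho> 40 = 0" "\<rho> r \<le> length x + 1" using assms(1) by (auto simp: tidy_def)
  let ?\<rho>1 = "\<rho>(r := 0, 40 := \<rho> 40 + \<rho> r)"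
  have eq: "?\<rho>1(40 := 0, r := ?\<rho>1 r + ?\<rho>1 40) = \<rho>"
    using assms(2) z by (auto simp: fun_eq_iff)
  have "wp x (move1 40 r) Q (\<rho> r, ?\<rho>1, out)"
    by (rule wp_move1, unfold eq) (use assms z in auto)
  then show ?thesis unfolding seek_def
    by (intro wp_Seq wp_rewind wp_forward) (use assms(2) z in simp_all)
qed

text \<open>The converse of \<open>seek\<close>: the position is measured by driving the head back
  to the left end, so the head has to be placed anew afterwards.\<close>

definition mark :: "nat \<Rightarrow> com" where
  "mark r = clear r ;; Loop (Cell [LeftEnd]) (Lft ;; Inc r)"

lemma wp_mark:
  assumes "h \<le> length x + 1" "Q (0, \<rho>(r := h), out)"
  shows "wp x (mark r) Q (h, \<rho>, out)"
proof -
  have "wp x (Loop (Cell [LeftEnd]) (Lft ;; Inc r)) Q (h - k, \<rho>(r := k), out)" if "k \<le> h" for k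
    using that
  proof (induction "h - k" arbitrary: k)
    case 0
    then have "k = h" by simp
    then show ?case using wp_Loop_True[of x "Cell [LeftEnd]" "(0, \<rho>(r := k), out)" Q] assms(2)
      by (simp add: fun_upd_def)
  next
    case (Suc v)
    have "wp x (Loop (Cell [LeftEnd]) (Lft ;; Inc r)) Q (h - Suc k, \<rho>(r := Suc k), out)"
      by (rule Suc.hyps(1)) (use Suc.hyps(2)[symmetric] Suc.prems in simp_all)
    moreover have "h - Suc k = v" using Suc.hyps(2) by simp
    ultimately have L: "wp x (Loop (Cell [LeftEnd]) (Lft ;; Inc r)) Q (v, \<rho>(r := Suc k), out)"
      by (simp only:)
    show ?case
      by (rule wp_Loop_False, use Suc.hyps(2)[symmetric] in simp, intro wp_Seq wp_Lft wp_Inc)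
        (use L Suc.hyps(2)[symmetric] Suc.prems assms in simp_all)
  qed
  from this[of 0] show ?thesis unfolding mark_def by (intro wp_Seq wp_clear) simp_all
qed

definition skip_to :: "symbol \<Rightarrow> com" where
  "skip_to d = Loop (Cell [Letter d]) Rgt"

lemma wp_skip_to:
  assumes "x = pre @ w @ d # suf" "d \<notin> set w" "h = Suc (length pre)" "Q (Suc (length pre + length w), \<rho>, out)"
  shows "wp x (skip_to d) Q (h, \<rho>, out)"
  using assms
proof (induction w arbitrary: pre h)
  case Nil
  then show ?case unfolding skip_to_def by (intro wp_Loop_True) (auto simp: read_input_def)
next
  case (Cons e w)
  have L: "wp x (skip_to d) Q (Suc h, \<rho>, out)"
    by (rule Cons.IH[of "pre @ [e]"]) (use Cons.prems in simp_all)
  show ?case unfolding skip_to_def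
    by (rule wp_Loop_False, use Cons.prems in \<open>auto simp: read_input_def nth_append\<close>, rule wp_Rgt)
      (use L[unfolded skip_to_def] Cons.prems in simp_all)
qed

definition back_to :: "symbol \<Rightarrow> com" where
  "back_to d = Loop (Cell [Letter d]) Lft"

lemma wp_back_to:
  assumes "x = pre @ d # w @ suf" "d \<notin> set w" "h = Suc (length pre + length w)" "Q (Suc (length pre), \<rho>, out)"
  shows "wp x (back_to d) Q (h, \<rho>, out)"
  using assms
proof (induction w arbitrary: h suf rule: rev_induct)
  case Nil
  then show ?case unfolding back_to_def by (intro wp_Loop_True) (auto simp: read_input_def)
next
  case (snoc e w)
  have L: "wp x (back_to d) Q (h - 1, \<rho>, out)"
    by (rule snoc.IH[of "e # suf"]) (use snoc.prems in simp_all)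
  show ?case unfolding back_to_def
    by (rule wp_Loop_False, use snoc.prems in \<open>auto simp: read_input_def nth_append\<close>, rule wp_Lft)
      (use L[unfolded back_to_def] snoc.prems in simp_all)
qed

text \<open>\<open>p\<close> is a head position, hence one more than a list index. The symbol after
  the word is not a bit, so that its end can be recognised on the tape.\<close>

definition word_at :: "symbol list \<Rightarrow> nat \<Rightarrow> bool list \<Rightarrow> bool" where
  "word_at x p u \<longleftrightarrow> (\<exists>pre d suf. x = pre @ map Bit u @ d # suf \<and> p = Suc (length pre) \<and> d \<notin> range Bit)"

lemma word_at_Nil: "word_at x p [] \<Longrightarrow> \<exists>d. read_input x p = Letter d \<and> d \<notin> range Bit"
  by (auto simp: word_at_def read_input_def)

lemma word_at_Cons:
  assumes "word_at x p (b # u)"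
  shows "read_input x p = Letter (Bit b)" "word_at x (Suc p) u"
proof -
  obtain pre d suf where x: "x = pre @ Bit b # map Bit u @ d # suf" "p = Suc (length pre)" "d \<notin> range Bit"
    using assms by (auto simp: word_at_def)
  then show "read_input x p = Letter (Bit b)" by (simp add: read_input_def)
  have "x = (pre @ [Bit b]) @ map Bit u @ d # suf" "Suc p = Suc (length (pre @ [Bit b]))"
    using x by simp_all
  then show "word_at x (Suc p) u" unfolding word_at_def using x(3) by blast
qed

lemma word_at_bound: "word_at x p u \<Longrightarrow> p \<le> length x"
  by (auto simp: word_at_def)

text \<open>Registers 34 and 35 are positions in the two words, 36 keeps the loop running, and
  \<open>e\<close> is 1 until a mismatch is found. The three branches are a bit 1, a bit 0 and the
  end of the first word; in the last one equality fails exactly if the second word still shows a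
  bit.\<close>

definition same_word_step :: "nat \<Rightarrow> com" where
  "same_word_step e =
     seek 34 ;;
     Cond (Cell [Letter (Bit True)])
       (seek 35 ;; Cond (Cell [Letter (Bit True)]) (Inc 34 ;; Inc 35) (Dec e ;; Dec 36))
       (Cond (Cell [Letter (Bit False)])
         (seek 35 ;; Cond (Cell [Letter (Bit False)]) (Inc 34 ;; Inc 35) (Dec e ;; Dec 36))
         (seek 35 ;; Dec 36 ;; Cond (Cell [Letter (Bit True), Letter (Bit False)]) (Dec e) Skip))"

text \<open>Induction on the first word with the second one arbitrary. \<open>Q\<close> must hold
  for all final positions, which are merely bounded and will be cleared.\<close>

lemma wp_same_word_loop:
  assumes \<rho>: "tidy x 34 \<rho>" and e: "e < 34"
    and Q: "\<And>h' p' q'. p' \<le> length x + 1 \<Longrightarrow> q' \<le> length x + 1 \<Longrightarrow>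
      Q (h', \<rho>(34 := p', 35 := q', e := of_bool (u = v)), out)"
    and u: "word_at x p u" and v: "word_at x q v"
  shows "wp x (Loop (Zero 36) (same_word_step e)) Q (h, \<rho>(34 := p, 35 := q, 36 := 1, e := 1), out)"
proof -
  define upd where "upd = (\<lambda>p q g i. \<rho>(34 := p, 35 := q, 36 := g, e := i))"
  have upd: "(upd p q g i)(34 := p') = upd p' q g i" "(upd p q g i)(35 := q') = upd p q' g i"
    "(upd p q g i)(36 := g') = upd p q g' i" "(upd p q g i)(e := i') = upd p q g i'"
    "upd p q g i 34 = p" "upd p q g i 35 = q" "upd p q g i 36 = g" "upd p q g i e = i"
    for p q g i p' q' g' i'
    using e by (auto simp: upd_def fun_eq_iff)
  have upd0: "upd p q 0 i = \<rho>(34 := p, 35 := q, e := i)" for p q i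
    using \<rho> e by (auto simp: upd_def fun_eq_iff tidy_def)
  have td: "tidy x 40 (upd p q g i)"
    if "p \<le> length x + 1" "q \<le> length x + 1" "g \<le> 1" "i \<le> 1" for p q g i
    unfolding upd_def using that e \<rho> by (intro tidy_upd tidy_mono[OF \<rho>]) auto
  have "\<And>h' p' q'. p' \<le> length x + 1 \<Longrightarrow> q' \<le> length x + 1 \<Longrightarrow> Q (h', upd p' q' 0 (of_bool (u = v)), out)"
    using Q unfolding upd0 by blast
  with u v have "wp x (Loop (Zero 36) (same_word_step e)) Q (h, upd p q 1 1, out)"
  proof (induction u arbitrary: v p q h)
    case Nil
    obtain d where d: "read_input x p = Letter d" "d \<notin> range Bit" using word_at_Nil[OF Nil(1)] by blast
    have b: "p \<le> length x + 1" "q \<le> length x + 1" using Nil word_at_bound by fastforce+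
    have done_: "wp x (Loop (Zero 36) (same_word_step e)) Q (h', upd p q 0 (of_bool ([] = v)), out)" for h'
      by (rule wp_Loop_True) (use Nil(3)[of p q h'] b in \<open>simp_all add: upd\<close>)
    show ?case
    proof (cases v)
      case vNil: Nil
      obtain d' where d': "read_input x q = Letter d'" "d' \<notin> range Bit"
        using word_at_Nil Nil(2) vNil by blast
      show ?thesis
        apply (rule wp_Loop_False, simp add: upd)
        unfolding same_word_step_def
        apply (intro wp_Seq wp_seek wp_Cond wp_Dec wp_Skip)
        using done_ d d' b vNil unfolding same_word_step_def by (auto simp: upd td)
    next
      case (Cons c w)
      have c: "read_input x q = Letter (Bit c)" using word_at_Cons Nil(2) Cons by blast
      show ?thesis
        apply (rule wp_Loop_False, simp add: upd)
        unfolding same_word_step_def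
        apply (intro wp_Seq wp_seek wp_Cond wp_Dec wp_Skip)
        using done_ d c b Cons unfolding same_word_step_def by (auto simp: upd td)
    qed
  next
    case (Cons a u)
    note a = word_at_Cons[OF Cons.prems(1)]
    have b: "p \<le> length x" "q \<le> length x" using Cons.prems word_at_bound by fastforce+
    show ?case
    proof (cases "\<exists>w. v = a # w")
      case True
      then obtain w where w: "v = a # w" by blast
      note r = word_at_Cons[OF Cons.prems(2)[unfolded w]]
      have L: "wp x (Loop (Zero 36) (same_word_step e)) Q (h', upd (Suc p) (Suc q) 1 1, out)" for h'
        by (rule Cons.IH[OF a(2) r(2)]) (use Cons.prems(3) w in simp)
      show ?thesis
        apply (rule wp_Loop_False, simp add: upd)
        unfolding same_word_step_def
        apply (intro wp_Seq wp_seek wp_Cond wp_Dec wp_Inc wp_Skip)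
        using L a r b unfolding same_word_step_def by (auto simp: upd td)
    next
      case False
      have r: "read_input x q \<noteq> Letter (Bit a)"
      proof (cases v)
        case Nil
        then show ?thesis using word_at_Nil Cons.prems(2) by fastforce
      next
        case (Cons c w)
        then show ?thesis using word_at_Cons(1) Cons.prems(2) False by fastforce
      qed
      have ne: "(a # u = v) = False" using False by auto
      have done_: "wp x (Loop (Zero 36) (same_word_step e)) Q (h', upd p q 0 0, out)" for h'
        by (rule wp_Loop_True) (use Cons.prems(3)[of p q h', unfolded ne] b in \<open>simp_all add: upd\<close>)
      show ?thesis
        apply (rule wp_Loop_False, simp add: upd)
        unfolding same_word_step_def
        apply (intro wp_Seq wp_seek wp_Cond wp_Dec wp_Inc wp_Skip)
        using done_ a r b unfolding same_word_step_def by (auto simp: upd td)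
    qed
  qed
  then show ?thesis unfolding upd_def .
qed

definition same_word :: "nat \<Rightarrow> nat \<Rightarrow> nat \<Rightarrow> com" where
  "same_word p q e = copy p 34 ;; copy q 35 ;; clear e ;; Inc 36 ;; Inc e ;;
     Loop (Zero 36) (same_word_step e) ;; clear 34 ;; clear 35"

lemma wp_same_word:
  assumes \<rho>: "tidy x 34 \<rho>" and "p < 34" "q < 34" "e < 34"
    and "word_at x (\<rho> p) u" "word_at x (\<rho> q) v"
    and Q: "\<And>h'. Q (h', \<rho>(e := of_bool (u = v)), out)"
  shows "wp x (same_word p q e) Q (h, \<rho>, out)"
proof -
  have z: "\<rho> 34 = 0" "\<rho> 35 = 0" "\<rho> 36 = 0" using \<rho> by (auto simp: tidy_def)
  have b: "\<rho> p \<le> length x + 1" "\<rho> q \<le> length x + 1" using \<rho> by (auto simp: tidy_def)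
  have t: "tidy x 40 \<rho>" "tidy x 40 (\<rho>(34 := \<rho> p))" using \<rho> b tidy_mono[OF \<rho>, of 40] by auto
  have eq: "\<rho>(34 := p', 35 := q', e := i, 34 := 0, 35 := 0) = \<rho>(e := i)" for p' q' i
    using z assms(4) by (auto simp: fun_eq_iff)
  have eq2: "\<rho>(34 := \<rho> p, 35 := \<rho> q, e := 0, 36 := Suc 0, e := Suc 0) =
      \<rho>(34 := \<rho> p, 35 := \<rho> q, 36 := 1, e := 1)"
    using assms(4) by (auto simp: fun_eq_iff)
  have "wp x (Loop (Zero 36) (same_word_step e)) (wp x (clear 34 ;; clear 35) Q)
      (h, \<rho>(34 := \<rho> p, 35 := \<rho> q, 36 := 1, e := 1), out)"
    by (rule wp_same_word_loop[OF \<rho> assms(4) _ assms(5,6)], intro wp_Seq wp_clear, unfold eq, rule Q)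
  then have L: "wp x (Loop (Zero 36) (same_word_step e)) (wp x (clear 34 ;; clear 35) Q)
      (h, \<rho>(34 := \<rho> p, 35 := \<rho> q, e := 0, 36 := Suc 0, e := Suc 0), out)"
    unfolding eq2 .
  show ?thesis unfolding same_word_def
    apply (intro wp_Seq wp_copy[OF t(1)])
       apply (use assms in simp_all)
    apply (intro wp_Seq wp_copy[OF t(2)])
       apply (use assms in simp_all)
    apply (intro wp_Seq wp_clear wp_Inc)
    using z assms(4) L by (simp_all del: fun_upd_apply add: fun_upd_other fun_upd_same)
qed

section \<open>The program\<close>

text \<open>
  Register 0 holds \<open>n\<close>, register 1 the input position of the word for the vertex with index 0, register
  2 the vertex \<open>start\<close> on a cycle of \<open>jump\<close>, and registers 6 and 7 the current and the previous index on
  the walk along the second cycle.  The local registers of a subroutine have higher numbers than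
  those of its callers.
\<close>

definition advance :: com where
  "advance = skip_to Comma ;; Rgt ;; Cond (Cell [Letter Hash]) (Lft ;; back_to Hash ;; Rgt) Skip"

definition advances :: com where
  "advances = Loop (Zero 33) (Dec 33 ;; advance)"

definition locate :: "nat \<Rightarrow> nat \<Rightarrow> com" where
  "locate i r = copy i 33 ;; seek 1 ;; advances ;; mark r"

definition print_digits :: com where
  "print_digits = Loop (Cell [Letter Comma])
     (Cond (Cell [Letter (Bit True)]) (Emit (Bit True)) (Emit (Bit False)) ;; Rgt)"

definition print_vertex :: "nat \<Rightarrow> com" where
  "print_vertex i = locate i 32 ;; seek 32 ;; print_digits ;; Emit Comma ;; clear 32"

text \<open>Register 29 holds the position of the word sought, 30 the current entry, and 31 tells
  whether the row belongs to the other endpoint. Rows of other vertices are passed over entry by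
  entry as well, without any comparison.\<close>

definition scan_row :: "nat \<Rightarrow> com" where
  "scan_row f = Loop (Cell [Letter Semicolon])
     (Cond (Zero 31) Skip
       (same_word 30 29 32 ;; Cond (Zero 32) Skip (clear f ;; Inc f) ;; clear 32) ;;
      seek 30 ;; skip_to Comma ;; Rgt ;; mark 30 ;; seek 30)"

definition scan_rows :: "nat \<Rightarrow> com" where
  "scan_rows f = Loop (Cell [Letter Hash])
     (same_word 30 28 31 ;; seek 30 ;; skip_to Colon ;; Rgt ;; mark 30 ;; seek 30 ;;
      scan_row f ;; Rgt ;; mark 30 ;; seek 30 ;; clear 31)"

definition adjacent :: "nat \<Rightarrow> nat \<Rightarrow> nat \<Rightarrow> com" where
  "adjacent i j f = locate i 28 ;; locate j 29 ;; clear f ;; Inc 30 ;; seek 30 ;; scan_rows f ;;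
     clear 28 ;; clear 29 ;; clear 30"

text \<open>Register 27 keeps the loop running. An adjacent candidate is refused if it equals
  \<open>i + 1\<close> or if its successor equals \<open>i\<close>. The last branch of the inner
  comparison stands for \<open>c = i\<close>, which adjacency has already ruled out.\<close>

definition find_chord_loop :: "nat \<Rightarrow> nat \<Rightarrow> com" where
  "find_chord_loop i c = Loop (Zero 27)
     (adjacent i c 26 ;;
      Cond (Zero 26) (Inc c)
        (copy i 26 ;; Inc 26 ;;
         compare 26 c (Dec 27) (Inc c)
           (copy c 26 ;; Inc 26 ;; compare 26 i (Dec 27) (Inc c) (Dec 27)) ;;
         clear 26))"

definition find_chord :: "nat \<Rightarrow> nat \<Rightarrow> com" where
  "find_chord i c = clear c ;; Inc 27 ;; find_chord_loop i c"

definition find_jump :: "nat \<Rightarrow> nat \<Rightarrow> nat \<Rightarrow> com" where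
  "find_jump i c j = find_chord i c ;; copy c j ;; compare c i (Inc j) Skip (Dec j)"

definition count :: com where
  "count = Loop (Cell [Letter Hash]) (skip_to Comma ;; Rgt ;; Inc 0)"

definition find_first_loop :: com where
  "find_first_loop = Loop (Zero 17)
     (same_word 1 14 16 ;; Cond (Zero 16) (seek 1 ;; advance ;; mark 1) (clear 16 ;; Dec 17))"

text \<open>Registers 14 and 15 point to the words for the two ends \<open>a\<close> and
  \<open>b\<close> of \<open>e\<close>. After \<open>a\<close> has been found in \<open>H\<close>,
  register 18 points to its successor there. If that is \<open>b\<close>, indexing starts at
  \<open>b\<close> and \<open>a\<close> becomes the last vertex; otherwise it starts at
  \<open>a\<close>, whose predecessor is \<open>b\<close>.\<close>

definition setup_registers :: com where
  "setup_registers =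
     Rgt ;; skip_to Hash ;; Rgt ;; count ;; Rgt ;; mark 14 ;; seek 14 ;; skip_to Comma ;; Rgt ;; mark 15 ;;
     Rgt ;; skip_to Hash ;; Rgt ;; mark 1 ;; Inc 17 ;; find_first_loop ;;
     seek 1 ;; advance ;; mark 18 ;; same_word 18 15 16 ;; Cond (Zero 16) Skip (copy 18 1) ;;
     clear 14 ;; clear 15 ;; clear 16 ;; clear 18"

definition start_loop :: com where
  "start_loop = Loop (Zero 3) (Dec 3 ;; find_jump 2 5 4 ;; copy 4 2 ;; clear 4 ;; clear 5)"

text \<open>Register 12 runs through \<open>n\<close> iterates of \<open>jump\<close>, with their
  chords in 5 and their images in 4. Register 6 is the vertex whose neighbours are wanted, 10 its
  chord, and 8 and 9 the two neighbours found so far.\<close>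

definition neighbour_loop :: com where
  "neighbour_loop = Loop (Zero 13) (Dec 13 ;; find_jump 12 5 4 ;;
     compare 5 6 Skip (compare 12 6 (copy 12 8) Skip (copy 12 9)) Skip ;;
     compare 4 6 Skip (compare 12 6 (copy 10 9) Skip (copy 10 8)) Skip ;;
     copy 4 12 ;; clear 4 ;; clear 5)"

definition neighbours_of :: com where
  "neighbours_of =
     copy 6 8 ;; copy 6 9 ;; Cond (Zero 8) (copy 0 8) Skip ;; Dec 8 ;; Inc 9 ;;
     compare 9 0 Skip (clear 9) Skip ;;
     find_chord 6 10 ;; copy 2 12 ;; copy 0 13 ;; neighbour_loop ;; clear 10 ;; clear 12"

definition walk_loop :: com where
  "walk_loop = Loop (Zero 3) (Dec 3 ;; print_vertex 6 ;; neighbours_of ;;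
     compare 7 8 (copy 8 11) (copy 9 11) (copy 8 11) ;; copy 6 7 ;; copy 11 6 ;;
     clear 8 ;; clear 9 ;; clear 11)"

text \<open>Index 2 is the first inner black vertex, and \<open>n\<close> jumps from it end on a
  cycle. Register 7 starts at \<open>n - 1\<close>, as if the walk had just come across
  \<open>e\<close> to index 0.\<close>

definition second_cycle :: com where
  "second_cycle = copy 0 3 ;; Inc 2 ;; Inc 2 ;; start_loop ;; copy 0 3 ;; copy 0 7 ;; Dec 7 ;; walk_loop"

definition main :: com where
  "main = setup_registers ;; second_cycle"

section \<open>Correctness of the program\<close>

lemma bits_ne: "bits n \<noteq> []"
  by (subst bits.simps) simp

text \<open>The number is recovered from its word by Horner's rule. Comparing words on the tape
  therefore decides equality of vertices.\<close>

lemma bits_inj: "bits m = bits n \<longleftrightarrow> m = n"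
proof
  have decode: "foldl (\<lambda>v b. 2 * v + of_bool b) 0 (bits n) = n" for n
  proof (induction n rule: bits.induct)
    case (1 n)
    then show ?case by (cases "n < 2") (simp_all add: bits.simps[of n])
  qed
  show "bits m = bits n \<Longrightarrow> m = n" using decode by metis
qed simp

lemma encode_vertices_simps [simp]:
  "encode_vertices [] = []"
  "encode_vertices (v # vs) = map Bit (bits v) @ Comma # encode_vertices vs"
  "encode_vertices (us @ vs) = encode_vertices us @ encode_vertices vs"
  by (simp_all add: encode_vertices_def encode_vertex_def)

lemma encode_adjacency_simps [simp]:
  "encode_adjacency [] = []"
  "encode_adjacency ((v, ns) # rows) =
     map Bit (bits v) @ Colon # encode_vertices ns @ Semicolon # encode_adjacency rows"
  by (simp_all add: encode_adjacency_def encode_vertex_def)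

lemma encode_vertices_symbols: "set (encode_vertices vs) \<subseteq> insert Comma (range Bit)"
  by (induction vs) auto

lemma encode_adjacency_symbols: "set (encode_adjacency rows) \<subseteq> {Comma, Colon, Semicolon} \<union> range Bit"
proof (induction rows)
  case (Cons row rows)
  then show ?case using encode_vertices_symbols[of "snd row"] by (cases row) auto
qed simp

lemma Hash_notin_encode [simp]: "Hash \<notin> set (encode_vertices vs)" "Hash \<notin> set (encode_adjacency rows)"
  "Semicolon \<notin> set (encode_vertices vs)"
  using encode_vertices_symbols encode_adjacency_symbols by fastforce+

lemma length_encode_vertices: "length vs \<le> length (encode_vertices vs)"
  by (induction vs) auto

locale input =
  fixes adj :: "(nat \<times> nat list) list" and H :: "nat list" and a b :: nat and x :: "symbol list" and n :: nat
  assumes x: "x = encode_input adj H (a, b)" and H: "H \<noteq> []" and n: "n = length H"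
begin

lemma n_pos: "0 < n"
  using H n by simp

lemma x_expand: "x = encode_adjacency adj @ Hash # encode_vertices H @ Hash # encode_vertices [a, b]"
  unfolding x encode_input_def by simp

lemma n_le: "n + 2 < length x"
proof -
  have "0 < length (bits a)" "0 < length (bits b)" using bits_ne by auto
  then show ?thesis using length_encode_vertices[of H] by (simp add: x_expand n)
qed

text \<open>\<open>Suc\<close> accounts for the first \<open>Hash\<close>, and the final 1 for head
  positions starting behind the left end marker. From \<open>j = n\<close> on the value is the
  position of the second \<open>Hash\<close>, which is how the end of \<open>H\<close> is
  noticed.\<close>

definition pos :: "nat \<Rightarrow> nat" where
  "pos j = length (encode_adjacency adj) + Suc (length (encode_vertices (take j H))) + 1"

lemma x_split:
  assumes "j < n"
  shows "x = (encode_adjacency adj @ Hash # encode_vertices (take j H)) @ map Bit (bits (H ! j)) @ Comma #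
    (encode_vertices (drop (Suc j) H) @ Hash # encode_vertices [a, b])"
proof -
  have "H = take j H @ H ! j # drop (Suc j) H" using assms n id_take_nth_drop by blast
  then have "encode_vertices H = encode_vertices (take j H) @ encode_vertices (H ! j # drop (Suc j) H)"
    by (metis encode_vertices_simps(3))
  then show ?thesis unfolding x_expand by simp
qed

lemma pos_word: "j < n \<Longrightarrow> word_at x (pos j) (bits (H ! j))"
  using x_split unfolding word_at_def pos_def by fastforce

lemma pos_Suc: "j < n \<Longrightarrow> pos (Suc j) = Suc (pos j + length (bits (H ! j)))"
  using n by (simp add: pos_def take_Suc_conv_app_nth)

lemma read_pos: "read_input x (pos j) = Letter Hash \<longleftrightarrow> j \<ge> n"
proof (cases "j < n")
  case True
  obtain c u where "bits (H ! j) = c # u" using bits_ne by (metis neq_Nil_conv)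
  then show ?thesis using word_at_Cons(1)[of x "pos j" c u] pos_word[OF True] True by simp
next
  case False
  then show ?thesis by (simp add: x_expand pos_def read_input_def nth_append n)
qed

lemma pos_bound: "pos j \<le> length x"
proof -
  have "length (encode_vertices (take j H)) \<le> length (encode_vertices H)"
    by (metis append_take_drop_id encode_vertices_simps(3) length_append le_add1)
  then show ?thesis by (simp add: x_expand pos_def)
qed

lemma wp_advance:
  assumes "j < n" and Q: "Q (pos (Suc j mod n), \<rho>, out)"
  shows "wp x advance Q (pos j, \<rho>, out)"
proof -
  have 1: "wp x (skip_to Comma) R (pos j, \<rho>, out)" if "R (pos (Suc j) - 1, \<rho>, out)" for R
    by (rule wp_skip_to[OF x_split[OF assms(1)]]) (use that pos_Suc[OF assms(1)] in \<open>auto simp: pos_def ac_simps\<close>)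
  have 2: "wp x (back_to Hash) R (h, \<rho>, out)" if "R (pos 0 - 1, \<rho>, out)" "h = pos n - 1" for R h
    by (rule wp_back_to[OF x_expand]) (use that n in \<open>auto simp: pos_def\<close>)
  have b: "Suc (pos j - 1) = pos j" "pos j - 1 \<le> length x" for j
    using pos_bound[of j] by (auto simp: pos_def)
  show ?thesis
  proof (cases "Suc j = n")
    case True
    then show ?thesis unfolding advance_def
      by (intro wp_Seq 1 wp_Rgt wp_Cond wp_Lft 2) (use Q b read_pos[of "Suc j"] in simp_all)
  next
    case False
    then have "Suc j < n" using assms(1) by simp
    then show ?thesis unfolding advance_def
      by (intro wp_Seq 1 wp_Rgt wp_Cond wp_Skip) (use Q b read_pos[of "Suc j"] in simp_all)
  qed
qed

lemma wp_advances:
  assumes "j < n" "Q (pos ((j + \<rho> 33) mod n), \<rho>(33 := 0), out)"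
  shows "wp x advances Q (pos j, \<rho>, out)"
proof -
  define upd where "upd i = \<rho>(33 := i)" for i
  have upd: "upd i 33 = i" "(upd i)(33 := i') = upd i'" "upd (\<rho> 33) = \<rho>" for i i'
    by (auto simp: upd_def)
  have "wp x advances Q (pos j, upd i, out)" if "j < n" "Q (pos ((j + i) mod n), upd 0, out)" for i j
    using that
  proof (induction i arbitrary: j)
    case 0
    then show ?case unfolding advances_def by (intro wp_Loop_True) (simp_all add: upd)
  next
    case (Suc i)
    have L: "wp x advances Q (pos (Suc j mod n), upd i, out)"
      by (rule Suc.IH) (use Suc.prems in \<open>simp_all add: mod_simps\<close>)
    show ?case unfolding advances_def
      by (rule wp_Loop_False, simp add: upd, intro wp_Seq wp_Dec wp_advance)
        (use L[unfolded advances_def] Suc.prems in \<open>simp_all add: upd\<close>)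
  qed
  from this[of j "\<rho> 33"] show ?thesis using assms by (simp add: upd) (simp add: upd_def)
qed

lemma wp_locate:
  assumes "tidy x 33 \<rho>" "i < 33" "r < 33" "\<rho> 1 = pos k" "k < n"
    and "Q (0, \<rho>(r := pos ((k + \<rho> i) mod n)), out)"
  shows "wp x (locate i r) Q (h, \<rho>, out)"
proof -
  have t: "tidy x 40 \<rho>" "tidy x 40 (\<rho>(33 := \<rho> i))"
    using assms(1) tidy_mono[OF assms(1), of 40] tidy_bound[OF assms(1), of i] by auto
  have eq: "\<rho>(33 := \<rho> i, 33 := 0) = \<rho>" using assms(1) by (auto simp: tidy_def fun_eq_iff)
  have "wp x advances (wp x (mark r) Q) (pos k, \<rho>(33 := \<rho> i), out)"
    by (rule wp_advances[OF assms(5)], unfold eq, rule wp_mark)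
      (use assms pos_bound in \<open>simp_all add: le_SucI\<close>)
  then show ?thesis unfolding locate_def
    by (intro wp_Seq wp_copy[OF t(1)] wp_seek[OF t(2)]) (use assms in simp_all)
qed

lemma wp_print_digits:
  assumes "x = pre @ map Bit u @ Comma # suf" "h = Suc (length pre)"
    and "\<And>h'. Q (h', \<rho>, out @ map Bit u)"
  shows "wp x print_digits Q (h, \<rho>, out)"
  using assms
proof (induction u arbitrary: pre h out)
  case Nil
  then have "Q (h, \<rho>, out)" by simp
  then show ?case unfolding print_digits_def using Nil
    by (intro wp_Loop_True) (auto simp: read_input_def)
next
  case (Cons c u)
  have L: "wp x print_digits Q (Suc h, \<rho>, out @ [Bit c])"
    by (rule Cons.IH[of "pre @ [Bit c]"]) (use Cons.prems in simp_all)
  have r: "read_input x h = Letter (Bit c)" "h \<le> length x"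
    using Cons.prems by (auto simp: read_input_def)
  show ?case unfolding print_digits_def
    by (rule wp_Loop_False, use r in simp, intro wp_Seq wp_Cond wp_Emit wp_Rgt)
      (use L[unfolded print_digits_def] r in simp_all)
qed

lemma wp_print_vertex:
  assumes "tidy x 32 \<rho>" "i < 32" "\<rho> 1 = pos k" "k < n"
    and "\<And>h'. Q (h', \<rho>, out @ encode_vertex (H ! ((k + \<rho> i) mod n)) @ [Comma])"
  shows "wp x (print_vertex i) Q (h, \<rho>, out)"
proof -
  let ?j = "(k + \<rho> i) mod n"
  have t: "tidy x 33 \<rho>" "tidy x 40 (\<rho>(32 := pos ?j))"
    using assms(1) tidy_mono[OF assms(1), of 33] tidy_mono[OF assms(1), of 40] pos_bound[of ?j] by auto
  have eq: "\<rho>(32 := pos ?j, 32 := 0) = \<rho>" using assms(1) by (auto simp: tidy_def fun_eq_iff)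
  have j: "?j < n" using assms(4) by simp
  have p: "wp x print_digits R (pos ?j, \<rho>', out)"
    if "\<And>h'. R (h', \<rho>', out @ map Bit (bits (H ! ?j)))" for R \<rho>'
    by (rule wp_print_digits[OF x_split[OF j]]) (use that in \<open>simp_all add: pos_def\<close>)
  have "wp x print_digits (wp x (Emit Comma ;; clear 32) Q) (pos ?j, \<rho>(32 := pos ?j), out)"
    by (rule p, intro wp_Seq wp_Emit wp_clear, unfold eq) (use assms(5) in \<open>simp add: encode_vertex_def\<close>)
  then show ?thesis unfolding print_vertex_def
    by (intro wp_Seq wp_locate[OF t(1) _ _ assms(3,4)] wp_seek[OF t(2)]) (use assms in simp_all)
qed

end

section \<open>Deciding adjacency from the adjacency list\<close>

lemma wp_scan_row:
  assumes \<rho>: "tidy x 32 \<rho>" and f: "f < 28" and w: "word_at x (\<rho> 29) (bits w)" and m: "m \<le> 1"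
    and "x = pre @ encode_vertices ns @ Semicolon # suf" "p = Suc (length pre)" "i \<le> 1"
    and "q = Suc (length pre + length (encode_vertices ns))"
    and "j = (if m = 1 \<and> w \<in> set ns then 1 else i)"
    and "Q (q, \<rho>(30 := q, 31 := m, f := j), out)"
  shows "wp x (scan_row f) Q (p, \<rho>(30 := p, 31 := m, f := i), out)"
proof -
  define upd where "upd p i = \<rho>(30 := p, 31 := m, f := i)" for p i
  have upd: "(upd p i)(30 := p') = upd p' i" "(upd p i)(f := i') = upd p i'"
    "upd p i 30 = p" "upd p i 31 = m" "upd p i f = i" "upd p i 29 = \<rho> 29" "upd p i 32 = 0"
    "(upd p i)(32 := 0) = upd p i" "(upd p i)(32 := v, f := i', 32 := 0) = upd p i'"
    "(upd p i)(32 := v, 32 := 0) = upd p i"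
    for p p' i i' v
    using f \<rho> by (auto simp: upd_def fun_eq_iff tidy_def)
  have td: "tidy x 40 (upd p i)" "tidy x 34 (upd p i)" if "p \<le> length x + 1" "i \<le> 1" for p i
    unfolding upd_def using that f m \<rho> tidy_mono[OF \<rho>, of 40] tidy_mono[OF \<rho>, of 34] by auto
  have "Q (q, upd q j, out)" using assms(10) unfolding upd_def .
  with assms(5-9) have "wp x (scan_row f) Q (p, upd p i, out)"
  proof (induction ns arbitrary: pre p i)
    case Nil
    have "Q (p, upd p i, out)" using Nil by auto
    then show ?case unfolding scan_row_def using Nil(1,2)
      by (intro wp_Loop_True) (auto simp: read_input_def)
  next
    case (Cons v ns)
    note xs = Cons.prems(1)[simplified]
    let ?i = "if m = 1 \<and> v = w then 1 else i"
    let ?p = "Suc (p + length (bits v))"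
    have px: "p \<le> length x" "?p \<le> length x" using Cons.prems(1,2) by auto
    have v: "word_at x p (bits v)" unfolding word_at_def using xs Cons.prems(2) by fastforce
    obtain b u where bv: "bits v = b # u" using bits_ne by (metis neq_Nil_conv)
    have r: "read_input x p = Letter (Bit b)" using word_at_Cons(1) v bv by metis
    have L: "wp x (scan_row f) Q (?p, upd ?p ?i, out)"
      by (rule Cons.IH[of "pre @ map Bit (bits v) @ [Comma]"]) (use Cons.prems in auto)
    have sk: "wp x (skip_to Comma) R (h, \<rho>', out)" if "h = p" "R (p + length (bits v), \<rho>', out)" for R h \<rho>'
      by (rule wp_skip_to[of x pre "map Bit (bits v)" Comma]) (use that xs Cons.prems(2) in auto)
    have td': "tidy x 40 (upd p ?i)" "tidy x 40 (upd ?p ?i)"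
      using px Cons.prems(3) by (intro td(1); simp)+
    have rest: "wp x (seek 30 ;; skip_to Comma ;; Rgt ;; mark 30 ;; seek 30) (wp x (scan_row f) Q) (h, upd p ?i, out)" for h
      by (intro wp_Seq wp_seek wp_Rgt wp_mark sk) (use L px td' in \<open>simp_all add: upd del: if_split\<close>)
    have sw: "wp x (same_word 30 29 32) R (p, upd p i, out)"
      if "\<And>h. R (h, (upd p i)(32 := of_bool (v = w)), out)" for R
      by (rule wp_same_word[where u = "bits v" and v = "bits w"])
        (use that td px Cons.prems(3) v w in \<open>simp_all add: upd bits_inj\<close>)
    have len: "0 < length x" using px by linarith
    have fst: "wp x (Cond (Zero 31) Skip
       (same_word 30 29 32 ;; Cond (Zero 32) Skip (clear f ;; Inc f) ;; clear 32)) R (p, upd p i, out)"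
      if "\<And>h. R (h, upd p ?i, out)" for R
    proof (cases "m = 1 \<and> v = w")
      case True
      have "((upd p i)(32 := Suc 0, f := 0)) f = 0" by simp
      moreover have "(upd p i)(32 := Suc 0, f := 0, f := Suc 0, 32 := 0) = upd p 1"
        using upd(9)[of p i "Suc 0" 1] by simp
      ultimately show ?thesis
        by (intro wp_Cond wp_Skip wp_Seq sw wp_clear wp_Inc) (use that True len in \<open>simp_all add: upd\<close>)
    next
      case False
      then show ?thesis
        by (intro wp_Cond wp_Skip wp_Seq sw wp_clear wp_Inc)
          (use that m in \<open>auto simp: upd simp del: fun_upd_apply simp: fun_upd_same\<close>)
    qed
    show ?case unfolding scan_row_def
      by (rule wp_Loop_False, use r in simp, rule wp_Seq, rule fst) (fact rest[unfolded scan_row_def])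
  qed
  then show ?thesis unfolding upd_def .
qed

lemma wp_scan_rows:
  assumes \<rho>: "tidy x 31 \<rho>" and f: "f < 28" and u: "word_at x (\<rho> 28) (bits u)"
    and w: "word_at x (\<rho> 29) (bits w)"
    and "x = pre @ encode_adjacency rows @ Hash # suf" "p = Suc (length pre)" "i \<le> 1"
    and "j = (if \<exists>(v, ns)\<in>set rows. v = u \<and> w \<in> set ns then 1 else i)"
    and "\<And>h q. q \<le> length x + 1 \<Longrightarrow> Q (h, \<rho>(30 := q, f := j), out)"
  shows "wp x (scan_rows f) Q (p, \<rho>(30 := p, f := i), out)"
proof -
  define upd where "upd p m i = \<rho>(30 := p, 31 := m, f := i)" for p m i
  have upd: "(upd p m i)(30 := p') = upd p' m i" "(upd p m i)(f := i') = upd p m i'"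
    "(upd p m i)(31 := m') = upd p m' i"
    "upd p m i 30 = p" "upd p m i 31 = m" "upd p m i f = i" "upd p m i 29 = \<rho> 29" "upd p m i 28 = \<rho> 28"
    for p p' i i' m m'
    using f by (auto simp: upd_def fun_eq_iff)
  have upd0: "upd p 0 i = \<rho>(30 := p, f := i)" for p i
    using f \<rho> by (auto simp: upd_def fun_eq_iff tidy_def)
  have td: "tidy x 40 (upd p m i)" "tidy x 34 (upd p m i)"
    if "p \<le> length x + 1" "i \<le> 1" "m \<le> 1" for p m i
    unfolding upd_def using that f tidy_mono[OF \<rho>, of 40] tidy_mono[OF \<rho>, of 34] by auto
  have "\<And>h q. q \<le> length x + 1 \<Longrightarrow> Q (h, upd q 0 j, out)" using assms(9) unfolding upd0 .
  with assms(5-8) have "wp x (scan_rows f) Q (p, upd p 0 i, out)"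
  proof (induction rows arbitrary: pre p i)
    case Nil
    have p: "p \<le> length x + 1" using Nil(1,2) by auto
    have "Q (p, upd p 0 i, out)" using Nil(5)[OF p] Nil(4) by simp
    then show ?case unfolding scan_rows_def using Nil(1,2)
      by (intro wp_Loop_True) (auto simp: read_input_def)
  next
    case (Cons row rows)
    obtain v ns where row: "row = (v, ns)" by (cases row)
    note xs = Cons.prems(1)[unfolded row, simplified]
    let ?m = "of_bool (v = u) :: nat"
    let ?i = "if ?m = 1 \<and> w \<in> set ns then 1 else i"
    let ?p1 = "Suc (p + length (bits v))"
    let ?p2 = "?p1 + length (encode_vertices ns)"
    have px: "p \<le> length x" "?p1 \<le> length x" "?p2 \<le> length x" "Suc ?p2 \<le> length x"
      using xs Cons.prems(2) by auto
    have v: "word_at x p (bits v)" unfolding word_at_def using xs Cons.prems(2) by fastforce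
    obtain b l where bv: "bits v = b # l" using bits_ne by (metis neq_Nil_conv)
    have r: "read_input x p = Letter (Bit b)" using word_at_Cons(1) v bv by metis
    have L: "wp x (scan_rows f) Q (Suc ?p2, upd (Suc ?p2) 0 ?i, out)"
      by (rule Cons.IH[of "pre @ map Bit (bits v) @ Colon # encode_vertices ns @ [Semicolon]"])
        (use Cons.prems row in auto)
    have sk: "wp x (skip_to Colon) R (h, \<rho>', out)" if "h = p" "R (p + length (bits v), \<rho>', out)" for R h \<rho>'
      by (rule wp_skip_to[of x pre "map Bit (bits v)" Colon]) (use that xs Cons.prems(2) in auto)
    have sw: "wp x (same_word 30 28 31) R (p, upd p 0 i, out)" if "\<And>h. R (h, upd p ?m i, out)" for R
      by (rule wp_same_word[where u = "bits v" and v = "bits u"])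
        (use that td px Cons.prems(3) v u in \<open>simp_all add: upd bits_inj\<close>)
    have sr: "wp x (scan_row f) R (h, \<rho>', out)"
      if "h = ?p1" "\<rho>' = upd ?p1 ?m i" "R (?p2, upd ?p2 ?m ?i, out)" for R h \<rho>'
      unfolding that(1,2) upd_def
      by (rule wp_scan_row[where pre = "pre @ map Bit (bits v) @ [Colon]" and ns = ns and w = w])
        (use tidy_mono[OF \<rho>, of 32] f w that(3) xs Cons.prems(2,3) in \<open>simp_all add: upd_def\<close>)
    show ?case unfolding scan_rows_def
      by (rule wp_Loop_False, use r in simp, intro wp_Seq sw wp_seek wp_Rgt wp_mark sk sr wp_clear)
        (use L[unfolded scan_rows_def] px Cons.prems(3) in \<open>simp_all add: upd td del: if_split\<close>)
  qed
  then show ?thesis unfolding upd0 .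
qed

context input
begin

definition listed :: "nat \<Rightarrow> nat \<Rightarrow> bool" where
  "listed u w \<longleftrightarrow> (\<exists>(v, ns)\<in>set adj. v = u \<and> w \<in> set ns)"

definition vertex :: "nat \<Rightarrow> nat \<Rightarrow> nat" where
  "vertex k i = H ! ((k + i) mod n)"

lemma wp_adjacent:
  assumes \<rho>: "tidy x 28 \<rho>" and ij: "i < 28" "j < 28" "f < 28" "f \<noteq> 1" and k: "\<rho> 1 = pos k" "k < n"
    and Q: "\<And>h'. Q (h', \<rho>(f := of_bool (listed (vertex k (\<rho> i)) (vertex k (\<rho> j)))), out)"
  shows "wp x (adjacent i j f) Q (h, \<rho>, out)"
proof -
  define u w where "u = vertex k (\<rho> i)" and "w = vertex k (\<rho> j)"
  define pu pw where "pu = pos ((k + \<rho> i) mod n)" and "pw = pos ((k + \<rho> j) mod n)"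
  have pb: "pu \<le> length x" "pw \<le> length x" unfolding pu_def pw_def by (rule pos_bound)+
  have w: "word_at x pu (bits u)" "word_at x pw (bits w)"
    unfolding pu_def pw_def u_def w_def vertex_def using pos_word k n_pos by auto
  let ?\<rho> = "\<rho>(28 := pu, 29 := pw)"
  have t: "tidy x 33 \<rho>" "tidy x 33 (\<rho>(28 := pu))" "tidy x 31 ?\<rho>" "tidy x 40 (?\<rho>(30 := Suc 0, f := 0))"
    using ij pb tidy_mono[OF \<rho>, of 33] tidy_mono[OF \<rho>, of 31] tidy_mono[OF \<rho>, of 40] by auto
  have eq1: "?\<rho>(f := 0, 30 := Suc 0) = ?\<rho>(30 := Suc 0, f := 0)"
    using ij by (auto simp: fun_eq_iff)
  have eq2: "?\<rho>(30 := q, f := v, 28 := 0, 29 := 0, 30 := 0) = \<rho>(f := v)" for q v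
    using ij \<rho> by (auto simp: fun_eq_iff tidy_def)
  have z: "(?\<rho>(f := 0)) 30 = 0" using ij \<rho> by (auto simp: tidy_def)
  have "wp x (scan_rows f) (wp x (clear 28 ;; clear 29 ;; clear 30) Q) (Suc 0, ?\<rho>(30 := Suc 0, f := 0), out)"
  proof (rule wp_scan_rows[where pre = "[]" and rows = adj and u = u and w = w
        and j = "of_bool (listed u w)"])
    show "x = [] @ encode_adjacency adj @ Hash # encode_vertices H @ Hash # encode_vertices [a, b]"
      using x_expand by simp
    show "wp x (clear 28 ;; clear 29 ;; clear 30) Q (h, ?\<rho>(30 := q, f := of_bool (listed u w)), out)" for h q
      by (intro wp_Seq wp_clear, unfold eq2) (use Q in \<open>simp add: u_def w_def\<close>)
  qed (use t(3) ij w in \<open>auto simp: listed_def\<close>)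
  then have L: "wp x (scan_rows f ;; clear 28 ;; clear 29 ;; clear 30) Q
      ((?\<rho>(30 := Suc 0, f := 0)) 30, ?\<rho>(30 := Suc 0, f := 0), out)"
    using ij by (intro wp_Seq) simp
  have S: "wp x (seek 30) (wp x (scan_rows f ;; clear 28 ;; clear 29 ;; clear 30) Q)
      (h, ?\<rho>(f := 0, 30 := Suc ((?\<rho>(f := 0)) 30)), out)" for h
    unfolding z eq1 by (rule wp_seek[OF t(4)]) (simp, rule L)
  have I: "wp x (clear f ;; Inc 30 ;; seek 30 ;; scan_rows f ;; clear 28 ;; clear 29 ;; clear 30) Q (0, ?\<rho>, out)"
    by (intro wp_Seq wp_clear, rule wp_Inc, unfold z, simp, rule wp_Seq, rule S[unfolded z])
  have "wp x (locate j 29) (wp x (clear f ;; Inc 30 ;; seek 30 ;; scan_rows f ;; clear 28 ;; clear 29 ;; clear 30) Q)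
      (0, \<rho>(28 := pu), out)"
    by (rule wp_locate[OF t(2) _ _ _ k(2)]) (use I ij k in \<open>simp_all add: pw_def\<close>)
  then show ?thesis unfolding adjacent_def
    by (intro wp_Seq wp_locate[OF t(1) _ _ k]) (use ij in \<open>simp_all add: pu_def\<close>)
qed

end

text \<open>Stated for an arbitrary relation \<open>A\<close> because it is used twice: with the
  relation read off the input, where it specifies the program, and with the edges of the graph,
  where the walk is shown to be Hamiltonian. The two instances are identified in the end.\<close>

locale chords =
  fixes n :: nat and A :: "nat \<Rightarrow> nat \<Rightarrow> bool"
  assumes chord_exists: "i < n \<Longrightarrow> \<exists>j<n. A i j \<and> j \<noteq> Suc i \<and> Suc j \<noteq> i"
    and irreflexive: "\<not> A i i"
begin

text \<open>Only indices at distance 1 are barred, so the edge between 0 and \<open>n - 1\<close>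
  counts as a chord at its ends. The iteration of \<open>jump\<close> stays among inner black
  vertices, where the barred indices are exactly the neighbours in \<open>H\<close>.\<close>

definition is_chord :: "nat \<Rightarrow> nat \<Rightarrow> bool" where
  "is_chord i j \<longleftrightarrow> j < n \<and> A i j \<and> j \<noteq> Suc i \<and> Suc j \<noteq> i"

definition chord :: "nat \<Rightarrow> nat" where
  "chord i = (LEAST j. is_chord i j)"

definition jump :: "nat \<Rightarrow> nat" where
  "jump i = (if i < chord i then chord i - 1 else Suc (chord i))"

text \<open>Among \<open>n + 1\<close> iterates below \<open>n\<close> two agree, so after
  \<open>n\<close> jumps the sequence has become periodic.\<close>

definition start :: nat where
  "start = (jump ^^ n) 2"

text \<open>The effect on the two neighbours of \<open>v\<close> of exchanging
  \<open>{chord i, jump i}\<close> for the chord at \<open>i\<close>. At \<open>v = chord i\<close>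
  the new neighbour \<open>i\<close> replaces the one on its side. At \<open>v = jump i\<close> the
  neighbour lost is \<open>chord i\<close>, on the side away from \<open>i\<close>, and the chord of
  \<open>v\<close> takes its place. So for a black \<open>v\<close> the components are the slots of
  its predecessor and successor in \<open>H\<close>, not necessarily in increasing order.\<close>

definition update :: "nat \<Rightarrow> nat \<Rightarrow> nat \<times> nat \<Rightarrow> nat \<times> nat" where
  "update v i lh =
     (let (l, h) = (if chord i = v then if i < v then (i, snd lh) else (fst lh, i) else lh)
      in if jump i = v then if i < v then (l, chord v) else (chord v, h) else (l, h))"

text \<open>The initial value consists of the cyclic neighbours in \<open>H\<close>. The
  \<open>n\<close> iterates may run around the cycle of \<open>jump\<close> several times, which is
  harmless because a repeated update writes the same value.\<close>

primrec scan_cycle :: "nat \<Rightarrow> nat \<Rightarrow> nat \<times> nat" where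
  "scan_cycle v 0 = ((if v = 0 then n - 1 else v - 1), (if Suc v = n then 0 else Suc v))"
| "scan_cycle v (Suc m) = update v ((jump ^^ m) start) (scan_cycle v m)"

definition lower :: "nat \<Rightarrow> nat" where "lower v = fst (scan_cycle v n)"
definition upper :: "nat \<Rightarrow> nat" where "upper v = snd (scan_cycle v n)"

definition advance_walk :: "nat \<times> nat \<Rightarrow> nat \<times> nat" where
  "advance_walk pc = (snd pc, if fst pc = lower (snd pc) then upper (snd pc) else lower (snd pc))"

text \<open>Starting with \<open>n - 1\<close> as the previous index makes \<open>e\<close> the edge
  on which the walk finally closes.\<close>

definition walk :: "nat \<Rightarrow> nat" where
  "walk m = snd ((advance_walk ^^ m) (n - 1, 0))"

lemma is_chord_chord: "i < n \<Longrightarrow> is_chord i (chord i)"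
  unfolding chord_def by (rule LeastI_ex) (use chord_exists[of i] in \<open>simp add: is_chord_def\<close>)

lemma not_is_chord_less: "j < chord i \<Longrightarrow> \<not> is_chord i j"
  unfolding chord_def by (rule not_less_Least)

lemma chord_less: "i < n \<Longrightarrow> chord i < n"
  using is_chord_chord[of i] unfolding is_chord_def by blast

lemma chord_neq: "i < n \<Longrightarrow> chord i \<noteq> i" "i < n \<Longrightarrow> chord i \<noteq> Suc i" "i < n \<Longrightarrow> Suc (chord i) \<noteq> i"
  using is_chord_chord[of i] irreflexive[of i] unfolding is_chord_def by auto

lemma jump_less: "i < n \<Longrightarrow> jump i < n"
  unfolding jump_def using chord_less[of i] chord_neq[of i] by auto

lemma jump_funpow_less: "i < n \<Longrightarrow> (jump ^^ m) i < n"
  by (induction m) (auto simp: jump_less)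

end

section \<open>The program computes chords, jumps and the walk\<close>

locale program = input adj H a b x n + chords n "\<lambda>i j. listed (input.vertex H n k i) (input.vertex H n k j)"
  for adj H a b x n k +
  assumes k: "k < n" and two: "2 < n"
begin

lemma wp_find_chord_loop:
  assumes \<rho>: "tidy x 26 \<rho>" and ic: "i < 26" "c < 26" "i \<noteq> c" "c \<noteq> 1" and S: "\<rho> 1 = pos k"
    and i: "\<rho> i < n" and j: "j \<le> chord (\<rho> i)" and Q: "\<And>h. Q (h, \<rho>(c := chord (\<rho> i)), out)"
  shows "wp x (find_chord_loop i c) Q (h, \<rho>(c := j, 27 := 1), out)"
proof -
  define upd where "upd j g t = \<rho>(c := j, 27 := g, 26 := t)" for j g t
  have upd: "(upd j g t)(c := j') = upd j' g t" "(upd j g t)(27 := g') = upd j g' t"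
    "(upd j g t)(26 := t') = upd j g t'" "upd j g t c = j" "upd j g t 26 = t" "upd j g t 27 = g"
    "upd j g t i = \<rho> i" "upd j g t 1 = pos k" "upd j g t (Suc 0) = pos k" for j g t j' g' t'
    using ic S by (auto simp: upd_def fun_eq_iff)
  have upd0: "upd j 1 0 = \<rho>(c := j, 27 := 1)" "upd j 0 0 = \<rho>(c := j)" for j
    using ic \<rho> by (auto simp: upd_def fun_eq_iff tidy_def)
  have bn: "chord (\<rho> i) < length x" using chord_less[OF i] n_le by linarith
  have bi: "\<rho> i < length x" using i n_le by linarith
  have td: "tidy x m (upd j g t)" if "28 \<le> m" "j \<le> length x + 1" "g \<le> 1" "t \<le> length x + 1" for j g t m
    unfolding upd_def using that ic tidy_mono[OF \<rho>, of m] by auto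
  have Q': "Q (h, upd (chord (\<rho> i)) 0 0, out)" for h using Q unfolding upd0 .
  have "wp x (find_chord_loop i c) Q (h, upd j 1 0, out)"
    using j
  proof (induction "chord (\<rho> i) - j" arbitrary: j h)
    case 0
    then have j: "j = chord (\<rho> i)" by simp
    have fin: "wp x (find_chord_loop i c) Q (h, upd j 0 0, out)" for h
      unfolding find_chord_loop_def by (rule wp_Loop_True) (use Q' j in \<open>simp_all add: upd\<close>)
    have ch: "listed (vertex k (\<rho> i)) (vertex k j)" "j \<noteq> Suc (\<rho> i)" "Suc j \<noteq> \<rho> i"
      using is_chord_chord[OF i] j by (auto simp: is_chord_def)
    have "wp x (adjacent i c 26) R (h, upd j 1 0, out)" if "\<And>h. R (h, upd j 1 1, out)" for R h
      by (rule wp_adjacent[OF _ _ _ _ _ _ k]) (use td bn j ic ch that in \<open>simp_all add: upd\<close>)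
    note adj = this
    show ?case unfolding find_chord_loop_def
      by (rule wp_Loop_False, simp add: upd,
          intro wp_Seq adj wp_Cond wp_copy wp_compare wp_Dec wp_Inc wp_clear)
        (use td bn bi j ic ch fin[unfolded find_chord_loop_def] in \<open>simp_all add: upd\<close>)
  next
    case (Suc d)
    then have jl: "j < chord (\<rho> i)" by simp
    have IH: "wp x (find_chord_loop i c) Q (h, upd (Suc j) 1 0, out)" for h
      by (rule Suc.hyps(1)) (use Suc.hyps(2) jl in simp_all)
    have jn: "j < n" "j \<le> length x" using jl chord_less[OF i] bn by linarith+
    have ch: "\<not> listed (vertex k (\<rho> i)) (vertex k j) \<or> j = Suc (\<rho> i) \<or> Suc j = \<rho> i"
      using not_is_chord_less[OF jl] jn by (auto simp: is_chord_def)
    have "wp x (adjacent i c 26) R (h, upd j 1 0, out)"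
      if "\<And>h. R (h, upd j 1 (of_bool (listed (vertex k (\<rho> i)) (vertex k j))), out)" for R h
      by (rule wp_adjacent[OF _ _ _ _ _ _ k]) (use td jn ic that in \<open>simp_all add: upd\<close>)
    note adj = this
    show ?case unfolding find_chord_loop_def
      by (rule wp_Loop_False, simp add: upd,
          intro wp_Seq adj wp_Cond wp_copy wp_compare wp_Dec wp_Inc wp_clear)
        (use td bn bi jn ic ch IH[unfolded find_chord_loop_def] in \<open>auto simp: upd\<close>)
  qed
  then show ?thesis unfolding upd0 .
qed

lemma wp_find_chord:
  assumes \<rho>: "tidy x 26 \<rho>" and ic: "i < 26" "c < 26" "i \<noteq> c" "c \<noteq> 1" and S: "\<rho> 1 = pos k"
    and i: "\<rho> i < n" and Q: "\<And>h. Q (h, \<rho>(c := chord (\<rho> i)), out)"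
  shows "wp x (find_chord i c) Q (h, \<rho>, out)"
proof -
  have "(\<rho>(c := 0)) 27 = 0" using \<rho> ic by (auto simp: tidy_def)
  moreover have "wp x (find_chord_loop i c) Q (h, \<rho>(c := 0, 27 := 1), out)"
    by (rule wp_find_chord_loop) (use assms in simp_all)
  ultimately show ?thesis unfolding find_chord_def by (intro wp_Seq wp_clear wp_Inc) simp_all
qed

lemma wp_find_jump:
  assumes \<rho>: "tidy x 26 \<rho>" and ic: "i < 26" "c < 26" "j < 26" "i \<noteq> c" "i \<noteq> j" "c \<noteq> j" "c \<noteq> 1"
    and S: "\<rho> 1 = pos k" and i: "\<rho> i < n"
    and Q: "\<And>h. Q (h, \<rho>(c := chord (\<rho> i), j := jump (\<rho> i)), out)"
  shows "wp x (find_jump i c j) Q (h, \<rho>, out)"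
proof -
  have b: "chord (\<rho> i) < length x" using chord_less[OF i] n_le by linarith
  have t: "tidy x 40 (\<rho>(c := chord (\<rho> i)))" "tidy x 37 (\<rho>(c := chord (\<rho> i), j := chord (\<rho> i)))"
    using tidy_mono[OF \<rho>, of 40] tidy_mono[OF \<rho>, of 37] ic b by auto
  show ?thesis unfolding find_jump_def
    by (intro wp_Seq wp_find_chord[OF \<rho>] wp_copy wp_compare wp_Inc wp_Skip wp_Dec)
      (use t ic S i Q b chord_neq[OF i] in \<open>auto simp: jump_def\<close>)
qed

end

context chords
begin

lemma scan_cycle_less:
  assumes "v < n" "start < n"
  shows "fst (scan_cycle v m) < n \<and> snd (scan_cycle v m) < n"
proof (induction m)
  case 0
  then show ?case using assms by auto
next
  case (Suc m)
  have "(jump ^^ m) start < n" using jump_funpow_less assms(2) by blast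
  then show ?case using Suc assms(1) chord_less[OF assms(1)]
    by (auto simp: update_def Let_def split: prod.splits)
qed

lemma advance_walk_less:
  assumes "start < n" "0 < n"
  shows "fst ((advance_walk ^^ m) (n - 1, 0)) < n \<and> snd ((advance_walk ^^ m) (n - 1, 0)) < n"
  by (induction m) (use assms scan_cycle_less in \<open>auto simp: advance_walk_def lower_def upper_def\<close>)

end

context input
begin

lemma words: "word_at x (Suc (pos n)) (bits a)" "word_at x (pos n + length (bits a) + 2) (bits b)"
proof -
  have "x = (encode_adjacency adj @ Hash # encode_vertices H @ [Hash]) @ map Bit (bits a) @ Comma #
      map Bit (bits b) @ [Comma]"
    "x = (encode_adjacency adj @ Hash # encode_vertices H @ Hash # map Bit (bits a) @ [Comma]) @
      map Bit (bits b) @ Comma # []"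
    by (simp_all add: x_expand)
  moreover have "Suc (pos n) = Suc (length (encode_adjacency adj @ Hash # encode_vertices H @ [Hash]))"
    "pos n + length (bits a) + 2 =
      Suc (length (encode_adjacency adj @ Hash # encode_vertices H @ Hash # map Bit (bits a) @ [Comma]))"
    by (simp_all add: pos_def n)
  moreover have "Comma \<notin> range Bit" by auto
  ultimately show "word_at x (Suc (pos n)) (bits a)" "word_at x (pos n + length (bits a) + 2) (bits b)"
    unfolding word_at_def by blast+
qed

lemma wp_count:
  assumes "Q (pos n, \<rho>(0 := n), out)" "\<rho> 0 = 0"
  shows "wp x count Q (pos 0, \<rho>, out)"
proof -
  define upd where "upd j = \<rho>(0 := j)" for j
  have upd: "upd j 0 = j" "(upd j)(0 := j') = upd j'" "upd 0 = \<rho>" for j j'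
    using assms(2) by (auto simp: upd_def fun_eq_iff)
  have "Q (pos n, upd n, out)" using assms(1) unfolding upd_def .
  moreover have "wp x count Q (pos j, upd j, out)" if "Q (pos n, upd n, out)" "j \<le> n" for j
    using that
  proof (induction "n - j" arbitrary: j)
    case 0
    then have "j = n" by simp
    then show ?case unfolding count_def
      by (intro wp_Loop_True) (use 0(2) read_pos[of n] in simp_all)
  next
    case (Suc d)
    then have j: "j < n" by simp
    have L: "wp x count Q (pos (Suc j), upd (Suc j), out)"
      by (rule Suc.hyps(1)) (use Suc.hyps(2) Suc.prems j in simp_all)
    have sk: "wp x (skip_to Comma) R (pos j, \<rho>', out)" if "R (pos (Suc j) - 1, \<rho>', out)" for R \<rho>'
      by (rule wp_skip_to[OF x_split[OF j]]) (use that pos_Suc[OF j] in \<open>auto simp: pos_def ac_simps\<close>)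
    have b: "Suc (pos (Suc j) - 1) = pos (Suc j)" "pos (Suc j) - 1 \<le> length x"
      using pos_bound[of "Suc j"] by (auto simp: pos_def)
    have "\<not> holds x (Cell [Letter Hash]) (pos j, upd j, out)"
      using read_pos[of j] j by simp
    then show ?case unfolding count_def
      by (rule wp_Loop_False, intro wp_Seq sk wp_Rgt wp_Inc)
        (use L[unfolded count_def] b j n_le in \<open>simp_all add: upd\<close>)
  qed
  ultimately have "wp x count Q (pos 0, upd 0, out)" by blast
  then show ?thesis unfolding upd .
qed

lemma wp_find_first_loop:
  assumes \<rho>: "tidy x 20 \<rho>" "\<rho> 16 = 0" "\<rho> 17 = 0" and w: "word_at x (\<rho> 14) (bits a)" and a: "a \<in> set H"
    and Q: "\<And>h i. i < n \<Longrightarrow> H ! i = a \<Longrightarrow> Q (h, \<rho>(1 := pos i), out)"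
  shows "wp x find_first_loop Q (h, \<rho>(1 := pos 0, 17 := 1), out)"
proof -
  define upd where "upd j g = \<rho>(1 := pos j, 17 := g)" for j g
  have upd: "upd j g 17 = g" "upd j g 1 = pos j" "upd j g (Suc 0) = pos j" "upd j g 14 = \<rho> 14" "upd j g 16 = 0"
    "(upd j g)(17 := g') = upd j g'" "(upd j g)(1 := pos j') = upd j' g" "(upd j g)(Suc 0 := pos j') = upd j' g"
    "(upd j g)(16 := v, 16 := 0) = upd j g" "(upd j g)(16 := 0) = upd j g"
    for j g g' j' v using \<rho> by (auto simp: upd_def fun_eq_iff)
  have upd0: "upd j 0 = \<rho>(1 := pos j)" for j using \<rho> by (auto simp: upd_def fun_eq_iff)
  have td: "tidy x m (upd j g)" if "20 \<le> m" "g \<le> 1" for j g m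
    unfolding upd_def using that tidy_mono[OF \<rho>(1), of m] pos_bound[of j] by auto
  have Q': "Q (h, upd i 0, out)" if "i < n" "H ! i = a" for h i using Q that unfolding upd0 by blast
  obtain i where i: "i < n" "H ! i = a" using a n by (metis in_set_conv_nth)
  have "wp x find_first_loop Q (h, upd j 1, out)" if "j \<le> i" for j h
    using that
  proof (induction "i - j" arbitrary: j h rule: less_induct)
    case less
    have j: "j < n" using less.prems i by simp
    have sw: "wp x (same_word 1 14 16) R (h, upd j 1, out)"
      if "\<And>h. R (h, (upd j 1)(16 := of_bool (H ! j = a)), out)" for R h
      by (rule wp_same_word[where u = "bits (H ! j)" and v = "bits a"])
        (use that td w pos_word[OF j] in \<open>simp_all add: upd bits_inj\<close>)
    show ?case
    proof (cases "H ! j = a")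
      case True
      have fin: "wp x find_first_loop Q (h, upd j 0, out)" for h
        unfolding find_first_loop_def
        by (rule wp_Loop_True) (use Q'[OF j True] in \<open>simp_all add: upd\<close>)
      show ?thesis unfolding find_first_loop_def
        by (rule wp_Loop_False, simp add: upd, intro wp_Seq sw wp_Cond wp_clear wp_Dec)
          (use fin[unfolded find_first_loop_def] True in \<open>simp_all add: upd\<close>)
    next
      case False
      have ji: "j < i" using False i less.prems by (metis le_neq_implies_less)
      have L: "wp x find_first_loop Q (h, upd (Suc j) 1, out)" for h
        by (rule less.hyps) (use ji in auto)
      have adv: "wp x advance R (pos j, upd j 1, out)" if "R (pos (Suc j), upd j 1, out)" for R
        by (rule wp_advance[OF j]) (use that ji i in simp)
      have step: "wp x (seek 1 ;; advance ;; mark 1) (wp x find_first_loop Q) (h, upd j 1, out)" for h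
        by (rule wp_Seq, rule wp_seek, rule td, simp, simp, simp, unfold upd, rule wp_Seq, rule adv,
            rule wp_mark, simp add: pos_bound le_SucI, unfold upd, rule L)
      show ?thesis unfolding find_first_loop_def
        by (rule wp_Loop_False, simp add: upd, rule wp_Seq, rule sw, rule wp_Cond)
          (use False step[unfolded find_first_loop_def] in \<open>simp_all add: upd\<close>)
    qed
  qed
  from this[of 0 h] show ?thesis unfolding upd_def by simp
qed

lemma wp_setup_registers:
  assumes a: "a \<in> set H"
    and Q: "\<And>h i. i < n \<Longrightarrow> H ! i = a \<Longrightarrow>
      Q (h, (\<lambda>_. 0)(0 := n, 1 := pos (if H ! (Suc i mod n) = b then Suc i mod n else i)), out)"
  shows "wp x setup_registers Q (0, \<lambda>_. 0, out)"
proof -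
  define pa pb where "pa = Suc (pos n)" and "pb = pos n + length (bits a) + 2"
  note w = words[folded pa_def pb_def]
  have b: "pa \<le> length x" "pb \<le> length x" using w word_at_bound by auto
  have tdy: "tidy x m (\<lambda>_. 0)" for m by (simp add: tidy_def)
  have nl: "n \<le> length x" using n_le by simp
  let ?\<rho> = "(\<lambda>_ :: nat. 0 :: nat)(0 := n, 14 := pa, 15 := pb)"
  have sk: "wp x (skip_to Hash) R (Suc 0, \<rho>', out)" if "R (pos 0 - 1, \<rho>', out)" for R \<rho>'
    by (rule wp_skip_to[of x "[]" "encode_adjacency adj"])
      (use that in \<open>simp_all add: pos_def x_expand\<close>)
  have sk2: "wp x (skip_to Comma) R (h, \<rho>', out)" if "h = pa" "R (pb - 1, \<rho>', out)" for R h \<rho>'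
    by (rule wp_skip_to[of x "encode_adjacency adj @ Hash # encode_vertices H @ [Hash]" "map Bit (bits a)" Comma])
      (use that in \<open>auto simp: pos_def x_expand pa_def pb_def n\<close>)
  have p0: "Suc (pos 0 - 1) = pos 0" "pos 0 - 1 \<le> length x" "pos 0 \<le> length x + 1"
    using pos_bound[of 0] by (auto simp: pos_def)
  have pn: "pos n \<le> length x" "Suc (pb - 1) = pb" "pb - 1 \<le> length x" "pb \<le> length x + 1"
    using pos_bound b by (auto simp: pb_def)
  let ?rest = "seek 1 ;; advance ;; mark 18 ;; same_word 18 15 16 ;; Cond (Zero 16) Skip (copy 18 1) ;;
     clear 14 ;; clear 15 ;; clear 16 ;; clear 18"
  have rest: "wp x ?rest Q (h, ?\<rho>(1 := pos i), out)" if i: "i < n" "H ! i = a" for h i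
  proof -
    let ?j = "Suc i mod n"
    have j: "?j < n" using n_pos by simp
    have t1: "tidy x m (?\<rho>(1 := pos i))" if "19 \<le> m" for m
      using that b nl pos_bound[of i] tdy by simp
    have t2: "tidy x m (?\<rho>(1 := pos i, 18 := pos ?j))" if "19 \<le> m" for m
      using that t1[OF that] pos_bound[of ?j] by simp
    have t3: "tidy x m (?\<rho>(1 := pos i, 18 := pos ?j, 16 := of_bool c))" if "19 \<le> m" for m c
      using that t2[OF that] by simp
    have adv: "wp x advance R (h, \<rho>', out)" if "h = pos i" "R (pos ?j, \<rho>', out)" for R h \<rho>'
      unfolding that(1) by (rule wp_advance[OF i(1)]) (use that in simp)
    let ?c = "H ! ?j = b"
    have fin: "wp x (clear 14 ;; clear 15 ;; clear 16 ;; clear 18) Q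
        (h, ?\<rho>(1 := pos i', 18 := pos ?j, 16 := c), out)"
      if "i' = (if H ! (Suc i mod n) = b then Suc i mod n else i)" for i' h c
    proof -
      have "?\<rho>(1 := pos i', 18 := pos ?j, 16 := c, 14 := 0, 15 := 0, 16 := 0, 18 := 0) =
        (\<lambda>_ :: nat. 0 :: nat)(0 := n, 1 := pos i')" by (auto simp: fun_eq_iff)
      note eq = this
      show ?thesis
        by (intro wp_Seq wp_clear, unfold eq, unfold that) (use Q[OF i] in simp)
    qed
    have cond: "wp x (Cond (Zero 16) Skip (copy 18 1)) (wp x (clear 14 ;; clear 15 ;; clear 16 ;; clear 18) Q)
        (h, ?\<rho>(1 := pos i, 18 := pos ?j, 16 := of_bool ?c), out)" for h
    proof (cases ?c)
      case True
      have eq: "?\<rho>(1 := pos i, 18 := pos ?j, 16 := of_bool ?c,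
          1 := (?\<rho>(1 := pos i, 18 := pos ?j, 16 := of_bool ?c)) 18) =
          ?\<rho>(1 := pos ?j, 18 := pos ?j, 16 := 1)" using True by (auto simp: fun_eq_iff)
      show ?thesis
        by (rule wp_Cond, use True in simp, rule wp_copy[OF t3], simp, simp, simp, simp, unfold eq, rule fin)
          (use True in simp)
    next
      case False
      show ?thesis
        by (rule wp_Cond, rule wp_Skip, rule fin) (use False in simp_all)
    qed
    have sw: "wp x (same_word 18 15 16) R (h, ?\<rho>(1 := pos i, 18 := pos ?j), out)"
      if "\<And>h. R (h, ?\<rho>(1 := pos i, 18 := pos ?j, 16 := of_bool ?c), out)" for R h
      by (rule wp_same_word[where u = "bits (H ! ?j)" and v = "bits b"])
        (use that t2 w pos_word[OF j] in \<open>simp_all add: bits_inj\<close>)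
    have S: "wp x (same_word 18 15 16 ;; Cond (Zero 16) Skip (copy 18 1) ;;
       clear 14 ;; clear 15 ;; clear 16 ;; clear 18) Q (h, ?\<rho>(1 := pos i, 18 := pos ?j), out)" for h
      by (rule wp_Seq, rule sw, rule wp_Seq, rule cond)
    show ?thesis
      by (rule wp_Seq, rule wp_seek, rule t1, simp, simp, rule wp_Seq, rule adv, simp, rule wp_Seq,
          rule wp_mark, simp add: pos_bound le_SucI, rule S)
  qed
  have t0: "tidy x 20 ?\<rho>" using b nl tdy by simp
  have L: "wp x find_first_loop (wp x ?rest Q) (0, ?\<rho>(1 := pos 0, 17 := 1), out)"
    by (rule wp_find_first_loop[OF t0]) (use w(1) a rest in simp_all)
  have t14: "tidy x 40 ((\<lambda>_ :: nat. 0 :: nat)(0 := n, 14 := pa))" using b nl tdy by simp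
  show ?thesis unfolding setup_registers_def
    by (rule wp_Seq, rule wp_Rgt, simp, rule wp_Seq, rule sk, rule wp_Seq, rule wp_Rgt, rule p0,
        unfold p0(1), rule wp_Seq, rule wp_count, rule wp_Seq, rule wp_Rgt, rule pn, fold pa_def,
        rule wp_Seq, rule wp_mark, use b in simp, rule wp_Seq, rule wp_seek, rule t14, simp,
        rule wp_Seq, rule sk2, simp, rule wp_Seq, rule wp_Rgt, rule pn, unfold pn(2),
        rule wp_Seq, rule wp_mark, rule pn, rule wp_Seq, rule wp_Rgt, simp, rule wp_Seq, rule sk,
        rule wp_Seq, rule wp_Rgt, rule p0, unfold p0(1), rule wp_Seq, rule wp_mark, rule p0,
        rule wp_Seq, rule wp_Inc, simp, rule wp_Seq) (use L in simp_all)
qed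

end

context program
begin

lemma start_less: "start < n"
  unfolding start_def using jump_funpow_less two by blast

lemma less_length: "i < n \<Longrightarrow> i \<le> length x" "i < n \<Longrightarrow> i \<le> Suc (length x)"
  using n_le by auto

lemma wp_start_loop:
  assumes \<rho>: "tidy x 26 \<rho>" "\<rho> 1 = pos k" "\<rho> 3 = 0" "\<rho> 4 = 0" "\<rho> 5 = 0"
    and i: "i < n" "m \<le> n" and Q: "\<And>h. Q (h, \<rho>(2 := (jump ^^ m) i), out)"
  shows "wp x start_loop Q (h, \<rho>(2 := i, 3 := m), out)"
proof -
  define upd where "upd i m = \<rho>(2 := i, 3 := m)" for i m
  have upd: "upd i m 3 = m" "upd i m 2 = i" "upd i m 1 = pos k" "upd i m (Suc 0) = pos k"
    "(upd i m)(3 := m') = upd i m'" "(upd i m)(5 := c, 4 := j, 2 := i', 4 := 0, 5 := 0) = upd i' m"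
    "(upd i m)(2 := i', 4 := 0, 5 := 0) = upd i' m"
    for i i' m m' c j using \<rho> by (auto simp: upd_def fun_eq_iff)
  have upd0: "upd i 0 = \<rho>(2 := i)" for i using \<rho> by (auto simp: upd_def fun_eq_iff)
  have td: "tidy x 26 (upd i m)" if "i < n" "m \<le> n" for i m
    unfolding upd_def using that \<rho>(1) n_le by simp
  have "\<And>h. Q (h, upd ((jump ^^ m) i) 0, out)" using Q unfolding upd0 .
  then have "wp x start_loop Q (h, upd i m, out)" using i
  proof (induction m arbitrary: i h)
    case 0
    then show ?case unfolding start_loop_def by (intro wp_Loop_True) (simp_all add: upd)
  next
    case (Suc m)
    have L: "wp x start_loop Q (h, upd (jump i) m, out)" for h
      by (rule Suc.IH) (use Suc.prems jump_less in \<open>simp_all add: funpow_swap1\<close>)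
    have c: "chord i \<le> Suc (length x)" "jump i \<le> Suc (length x)"
      using Suc.prems chord_less jump_less less_length by auto
    have "tidy x 40 ((upd i m)(5 := chord i, 4 := jump i))"
      using td[of i m] tidy_mono[of x 26 _ 40] Suc.prems c by simp
    then have cp: "wp x (copy 4 2) (wp x (clear 4 ;; clear 5) (wp x start_loop Q))
       (h, (upd i m)(5 := chord i, 4 := jump i), out)" for h
      by (rule wp_copy) (simp, simp, simp, intro wp_Seq wp_clear, use L in \<open>simp add: upd\<close>)
    have J: "wp x (find_jump 2 5 4) (wp x (copy 4 2 ;; clear 4 ;; clear 5) (wp x start_loop Q)) (h, upd i m, out)" for h
      by (rule wp_find_jump, rule td) (use Suc.prems cp in \<open>simp_all add: upd wp_Seq\<close>)
    show ?case unfolding start_loop_def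
      by (rule wp_Loop_False, simp add: upd, rule wp_Seq, rule wp_Dec, simp add: upd, rule wp_Seq)
        (use J[unfolded start_loop_def] in \<open>simp add: upd\<close>)
  qed
  then show ?thesis unfolding upd_def .
qed

text \<open>Splits the update into two successive overwrites, in the order of the two comparisons in
  \<open>neighbour_loop\<close>.\<close>

lemma update_alt: "update v i lh =
  (let lh = (if chord i = v then if i < v then (i, snd lh) else (fst lh, i) else lh)
   in if jump i = v then if i < v then (fst lh, chord v) else (chord v, snd lh) else lh)"
  unfolding update_def Let_def by (cases lh) auto

lemma wp_neighbour_loop:
  assumes \<rho>: "tidy x 26 \<rho>" "\<rho> 1 = pos k" "\<rho> 4 = 0" "\<rho> 5 = 0" "\<rho> 13 = 0"
    and v: "\<rho> 6 = v" "\<rho> 10 = chord v" "v < n" and m: "m \<le> n" and i: "i = (jump ^^ (n - m)) start"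
    and Q: "\<And>h i. Q (h, \<rho>(12 := i, 8 := lower v, 9 := upper v), out)"
    and lh: "l = fst (scan_cycle v (n - m))" "u = snd (scan_cycle v (n - m))"
  shows "wp x neighbour_loop Q (h, \<rho>(12 := i, 13 := m, 8 := l, 9 := u), out)"
proof -
  define upd where "upd i m l u = \<rho>(12 := i, 13 := m, 8 := l, 9 := u)" for i m l u
  have upd: "upd i m l u 13 = m" "upd i m l u 12 = i" "upd i m l u 1 = pos k" "upd i m l u (Suc 0) = pos k"
    "upd i m l u 6 = v" "upd i m l u 10 = chord v"
    "(upd i m l u)(13 := m') = upd i m' l u"
    "(upd i m l u)(5 := c, 4 := j, 8 := l') = (upd i m l' u)(5 := c, 4 := j)"
    "(upd i m l u)(5 := c, 4 := j, 9 := u') = (upd i m l u')(5 := c, 4 := j)"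
    "(upd i m l u)(5 := c, 4 := j, 12 := i', 4 := 0, 5 := 0) = upd i' m l u"
    "(upd i m l u)(12 := i', 4 := 0, 5 := 0) = upd i' m l u"
    for i i' m m' l l' u u' c j using \<rho> v by (auto simp: upd_def fun_eq_iff)
  have upd0: "upd i 0 l u = \<rho>(12 := i, 8 := l, 9 := u)" for i l u using \<rho> by (auto simp: upd_def fun_eq_iff)
  have td: "tidy x 26 (upd i m l u)" if "i < n" "m \<le> n" "l < n" "u < n" for i m l u
    unfolding upd_def using that \<rho>(1) n_le by simp
  have td': "tidy x m' ((upd i m l u)(5 := c, 4 := j))"
    if "i < n" "m \<le> n" "l < n" "u < n" "c < n" "j < n" "26 \<le> m'" for i m l u c j m'
  proof -
    have "tidy x 26 ((upd i m l u)(5 := c, 4 := j))" using td[OF that(1-4)] that(5,6) less_length by simp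
    then show ?thesis using tidy_mono that(7) by blast
  qed
  have "Q (h, upd i 0 (lower v) (upper v), out)" for h i using Q unfolding upd0 .
  then have "wp x neighbour_loop Q (h, upd i m l u, out)" using m i lh
  proof (induction m arbitrary: i l u h)
    case 0
    then show ?case unfolding neighbour_loop_def
      by (intro wp_Loop_True) (simp_all add: upd lower_def upper_def)
  next
    case (Suc m)
    have iless: "i < n" using Suc.prems(3) jump_funpow_less start_less by blast
    have lu: "l < n" "u < n" "(l, u) = scan_cycle v (n - Suc m)"
      using Suc.prems(4,5) scan_cycle_less[OF v(3) start_less] by auto
    have nm: "n - m = Suc (n - Suc m)" using Suc.prems(2) by simp
    have less: "chord i < n" "jump i < n" "chord v < n" using iless v(3) chord_less jump_less by auto
    have next_i: "jump i = (jump ^^ (n - m)) start" unfolding nm Suc.prems(3) by simp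
    have next_lu: "scan_cycle v (n - m) = update v i (l, u)"
      unfolding nm scan_cycle.simps lu(3) Suc.prems(3) by simp
    \<comment> \<open>The slots between the two comparisons of the loop body; \<open>l2\<close> and
      \<open>u2\<close> are those after both.\<close>
    define l1 u1 where "l1 = fst (if chord i = v then if i < v then (i, u) else (l, i) else (l, u))"
      and "u1 = snd (if chord i = v then if i < v then (i, u) else (l, i) else (l, u))"
    define l2 u2 where "l2 = fst (update v i (l, u))" and "u2 = snd (update v i (l, u))"
    have b1: "l1 < n" "u1 < n" using lu(1,2) iless by (auto simp: l1_def u1_def)
    have b2: "l2 < n" "u2 < n"
      using scan_cycle_less[OF v(3) start_less, of "n - m"] by (auto simp: l2_def u2_def next_lu)
    have lu2: "(l2, u2) = (if jump i = v then if i < v then (l1, chord v) else (chord v, u1) else (l1, u1))"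
      unfolding l2_def u2_def l1_def u1_def update_alt Let_def by auto
    have jv: "jump i \<noteq> i" using chord_neq[OF iless] by (auto simp: jump_def)
    have L: "wp x neighbour_loop Q (h, upd (jump i) m l2 u2, out)" for h
      by (rule Suc.IH[OF Suc.prems(1)]) (use Suc.prems(2) next_i next_lu in \<open>simp_all add: l2_def u2_def\<close>)
    let ?Q3 = "wp x neighbour_loop Q"
    have 3: "wp x (copy 4 12 ;; clear 4 ;; clear 5) ?Q3 (h, (upd i m l2 u2)(5 := chord i, 4 := jump i), out)" for h
      by (rule wp_Seq, rule wp_copy, rule td') (use Suc.prems(2) iless less b2 in simp_all,
          intro wp_Seq wp_clear, use L in \<open>simp add: upd\<close>)
    have t1: "tidy x m' ((upd i m l1 u1)(5 := chord i, 4 := jump i))" if "26 \<le> m'" for m'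
      by (rule td') (use that Suc.prems(2) iless less b1 in simp_all)
    have 2: "wp x (compare 4 6 Skip (compare 12 6 (copy 10 9) Skip (copy 10 8)) Skip)
      (wp x (copy 4 12 ;; clear 4 ;; clear 5) ?Q3) (h, (upd i m l1 u1)(5 := chord i, 4 := jump i), out)" for h
      by (intro wp_compare wp_Skip wp_copy t1)
        (use 3[of h] lu2 jv in \<open>auto simp: upd split: if_splits\<close>)
    have t0: "tidy x m' ((upd i m l u)(5 := chord i, 4 := jump i))" if "26 \<le> m'" for m'
      by (rule td') (use that Suc.prems(2) iless less lu in simp_all)
    have 1: "wp x (compare 5 6 Skip (compare 12 6 (copy 12 8) Skip (copy 12 9)) Skip)
      (wp x (compare 4 6 Skip (compare 12 6 (copy 10 9) Skip (copy 10 8)) Skip ;; copy 4 12 ;; clear 4 ;; clear 5) ?Q3)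
      (h, (upd i m l u)(5 := chord i, 4 := jump i), out)" for h
      by (intro wp_compare wp_Skip wp_copy t0)
        (use wp_Seq[OF 2[of h]] chord_neq[OF iless] in \<open>auto simp: upd l1_def u1_def split: if_splits\<close>)
    have J: "wp x (find_jump 12 5 4)
      (wp x (compare 5 6 Skip (compare 12 6 (copy 12 8) Skip (copy 12 9)) Skip ;;
       compare 4 6 Skip (compare 12 6 (copy 10 9) Skip (copy 10 8)) Skip ;; copy 4 12 ;; clear 4 ;; clear 5) ?Q3)
      (h, upd i m l u, out)" for h
      by (rule wp_find_jump, rule td) (use Suc.prems(2) iless lu 1 in \<open>simp_all add: upd wp_Seq\<close>)
    show ?case unfolding neighbour_loop_def
      by (rule wp_Loop_False, simp add: upd, rule wp_Seq, rule wp_Dec, simp add: upd, rule wp_Seq)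
        (use J[unfolded neighbour_loop_def] in \<open>simp add: upd\<close>)
  qed
  then show ?thesis unfolding upd_def .
qed

lemma wp_neighbours_of:
  assumes \<rho>: "tidy x 26 \<rho>" "\<rho> 0 = n" "\<rho> 1 = pos k" "\<rho> 2 = start"
    "\<And>r. r \<in> {4, 5, 8, 9, 10, 12, 13} \<Longrightarrow> \<rho> r = 0"
    and v: "\<rho> 6 = v" "v < n"
    and Q: "\<And>h. Q (h, \<rho>(8 := lower v, 9 := upper v), out)"
  shows "wp x neighbours_of Q (h, \<rho>, out)"
proof -
  define l u where "l = fst (scan_cycle v 0)" and "u = snd (scan_cycle v 0)"
  have lu: "l < n" "u < n" using scan_cycle_less[OF v(2) start_less, of 0] by (auto simp: l_def u_def)
  have bd: "n \<le> Suc (length x)" "v \<le> length x" "l \<le> Suc (length x)" "u \<le> Suc (length x)" "start \<le> Suc (length x)"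
    "chord v \<le> Suc (length x)" "Suc v \<le> Suc (length x)"
    using n_le v lu start_less chord_less[OF v(2)] by auto
  have t: "tidy x m \<rho>" if "26 \<le> m" for m using tidy_mono[OF \<rho>(1)] that by blast
  let ?r4 = "clear 10 ;; clear 12"
  have 4: "wp x ?r4 Q (h, \<rho>(10 := chord v, 12 := i, 8 := lower v, 9 := upper v), out)" for h i
  proof -
    have eq: "\<rho>(10 := chord v, 12 := i, 8 := lower v, 9 := upper v, 10 := 0, 12 := 0) =
      \<rho>(8 := lower v, 9 := upper v)" using \<rho>(5) by (auto simp: fun_eq_iff)
    show ?thesis by (intro wp_Seq wp_clear, unfold eq, rule Q)
  qed
  have "wp x neighbour_loop (wp x ?r4 Q) (h, \<rho>(10 := chord v, 12 := start, 13 := n, 8 := l, 9 := u), out)" for h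
    by (rule wp_neighbour_loop[where v = v])
      (use \<rho> v bd 4 in \<open>simp_all add: l_def u_def\<close>)
  moreover have "\<rho>(8 := l, 9 := u, 10 := chord v, 12 := start, 13 := n) =
      \<rho>(10 := chord v, 12 := start, 13 := n, 8 := l, 9 := u)" by (auto simp: fun_eq_iff)
  ultimately have 3: "wp x neighbour_loop (wp x ?r4 Q) (h, \<rho>(8 := l, 9 := u, 10 := chord v, 12 := start, 13 := n), out)" for h
    by (simp only:)
  define upd where "upd l u = \<rho>(8 := l, 9 := u)" for l u
  have z: "\<rho> 8 = 0" "\<rho> 9 = 0" using \<rho>(5) by simp_all
  have upd: "(upd l u)(8 := l') = upd l' u" "(upd l u)(9 := u') = upd l u'" "upd l u 8 = l" "upd l u 9 = u"
    "upd l u 6 = v" "upd l u 0 = n" "upd l u 1 = pos k" "upd l u (Suc 0) = pos k" "upd l u 2 = start"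
    for l u l' u' using \<rho>(2-4) v by (auto simp: upd_def fun_eq_iff)
  have upd0: "\<rho> = upd 0 0" using z by (auto simp: upd_def fun_eq_iff)
  have td: "tidy x m (upd l u)" if "26 \<le> m" "l \<le> Suc (length x)" "u \<le> Suc (length x)" for m l u
    unfolding upd_def using t[OF that(1)] that by simp
  have td1: "tidy x m ((upd l u)(10 := chord v))" if "26 \<le> m" "l \<le> Suc (length x)" "u \<le> Suc (length x)" for m l u
    using td[OF that] that bd by simp
  have td2: "tidy x m ((upd l u)(10 := chord v, 12 := start))" if "26 \<le> m" "l \<le> Suc (length x)" "u \<le> Suc (length x)" for m l u
    using td1[OF that] that bd by simp
  let ?r3 = "find_chord 6 10 ;; copy 2 12 ;; copy 0 13 ;; neighbour_loop ;; clear 10 ;; clear 12"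
  have 2: "wp x ?r3 Q (h, upd l u, out)" for h
  proof (rule wp_Seq, rule wp_find_chord)
    show "wp x (copy 2 12 ;; copy 0 13 ;; neighbour_loop ;; clear 10 ;; clear 12) Q
      (h, (upd l u)(10 := chord (upd l u 6)), out)" for h
      unfolding upd
      by (rule wp_Seq, rule wp_copy, rule td1, simp, rule bd, rule bd, simp, simp, simp,
          rule wp_Seq, simp add: upd, rule wp_copy, rule td2, simp, rule bd, rule bd, simp, simp, simp,
          rule wp_Seq) (use 3[folded upd_def] in \<open>simp add: upd\<close>)
  qed (use td bd v in \<open>simp_all add: upd\<close>)
  let ?r2 = "compare 9 0 Skip (clear 9) Skip ;; ?r3"
  have 1: "wp x ?r2 Q (h, upd l (Suc v), out)" for h
  proof (rule wp_Seq, rule wp_compare, rule td)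
    show "upd l (Suc v) 9 < upd l (Suc v) 0 \<Longrightarrow> wp x Skip (wp x ?r3 Q) (h, upd l (Suc v), out)"
      by (rule wp_Skip) (use 2[of h] in \<open>simp add: upd u_def\<close>)
    show "upd l (Suc v) 9 = upd l (Suc v) 0 \<Longrightarrow> wp x (clear 9) (wp x ?r3 Q) (h, upd l (Suc v), out)"
      by (rule wp_clear) (use 2[of h] in \<open>simp add: upd u_def\<close>)
    show "upd l (Suc v) 0 < upd l (Suc v) 9 \<Longrightarrow> wp x Skip (wp x ?r3 Q) (h, upd l (Suc v), out)"
      using v(2) by (simp add: upd)
  qed (use bd in simp_all)
  have I: "wp x (Inc 9 ;; ?r2) Q (h, upd l v, out)" for h
    by (rule wp_Seq, rule wp_Inc) (use 1 bd in \<open>simp_all add: upd\<close>)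
  have D: "wp x (Dec 8 ;; Inc 9 ;; ?r2) Q (h, upd l' v, out)" if "l' \<noteq> 0" "l' - 1 = l" for l' h
    by (rule wp_Seq, rule wp_Dec) (use I that in \<open>simp_all add: upd\<close>)
  have C: "wp x (Cond (Zero 8) (copy 0 8) Skip ;; Dec 8 ;; Inc 9 ;; ?r2) Q (h, upd v v, out)"
  proof (rule wp_Seq, rule wp_Cond)
    assume "holds x (Zero 8) (h, upd v v, out)"
    then have "n \<noteq> 0" "n - 1 = l" using n_pos by (simp_all add: upd l_def)
    from D[OF this, of h] show "wp x (copy 0 8) (wp x (Dec 8 ;; Inc 9 ;; ?r2) Q) (h, upd v v, out)"
      by (intro wp_copy td) (use bd in \<open>simp_all add: upd\<close>)
  next
    assume "\<not> holds x (Zero 8) (h, upd v v, out)"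
    then have "v \<noteq> 0" "v - 1 = l" by (simp_all add: upd l_def)
    from D[OF this, of h] show "wp x Skip (wp x (Dec 8 ;; Inc 9 ;; ?r2) Q) (h, upd v v, out)"
      by (rule wp_Skip)
  qed
  have B: "wp x (copy 6 9 ;; Cond (Zero 8) (copy 0 8) Skip ;; Dec 8 ;; Inc 9 ;; ?r2) Q (h, upd v 0, out)"
    by (rule wp_Seq, rule wp_copy, rule td) (use C bd in \<open>simp_all add: upd\<close>)
  show ?thesis unfolding neighbours_of_def upd0
    by (rule wp_Seq, rule wp_copy, rule td) (use B bd in \<open>simp_all add: upd\<close>)
qed

text \<open>Induction on the number \<open>m\<close> of vertices still to be printed; the arc
  \<open>(p, c)\<close> is all that is kept of the walk so far.\<close>

lemma wp_walk_loop:
  assumes \<rho>: "tidy x 26 \<rho>" "\<rho> 0 = n" "\<rho> 1 = pos k" "\<rho> 2 = start"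
    "\<And>r. r \<in> {3, 4, 5, 8, 9, 10, 11, 12, 13} \<Longrightarrow> \<rho> r = 0"
    and m: "m \<le> n"
    and pc: "(p, c) = (advance_walk ^^ (n - m)) (n - 1, 0)"
    and Q: "\<And>s. snd (snd s) = out @ encode_vertices (map (vertex k) (map walk [n - m..<n])) \<Longrightarrow> Q s"
  shows "wp x walk_loop Q (h, \<rho>(3 := m, 6 := c, 7 := p), out)"
  using m pc Q
proof (induction m arbitrary: p c h out)
  case 0
  then show ?case unfolding walk_loop_def by (intro wp_Loop_True) simp_all
next
  case (Suc m)
  define upd where "upd m c p = \<rho>(3 := m, 6 := c, 7 := p)" for m c p
  have z: "\<rho> 8 = 0" "\<rho> 9 = 0" "\<rho> 11 = 0" using \<rho>(5) by simp_all
  have upd: "upd m c p 3 = m" "upd m c p 6 = c" "upd m c p 7 = p" "upd m c p 0 = n" "upd m c p 1 = pos k"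
    "upd m c p (Suc 0) = pos k" "upd m c p 2 = start"
    "(upd m c p)(3 := m') = upd m' c p"
    "(upd m c p)(8 := l, 9 := u, 11 := c', 7 := p', 6 := c'', 8 := 0, 9 := 0, 11 := 0) = upd m c'' p'"
    for m c p m' l u c' p' c'' using \<rho>(2-4) z by (auto simp: upd_def fun_eq_iff)
  have zs: "upd m c p r = 0" if "r \<in> {4, 5, 8, 9, 10, 12, 13}" for m c p r
    using that \<rho>(5)[of r] by (auto simp: upd_def)
  have pcn: "p < n" "c < n"
    using advance_walk_less[OF start_less n_pos, of "n - Suc m"] Suc.prems(2)[symmetric] by simp_all
  define l u where "l = lower c" and "u = upper c"
  have lu: "l < n" "u < n" using scan_cycle_less[OF pcn(2) start_less] by (auto simp: l_def u_def lower_def upper_def)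
  define c' where "c' = (if p = l then u else l)"
  have nm: "n - m = Suc (n - Suc m)" using Suc.prems(1) by simp
  have step: "(c, c') = (advance_walk ^^ (n - m)) (n - 1, 0)"
    unfolding nm funpow.simps comp_def Suc.prems(2)[symmetric] by (simp add: advance_walk_def c'_def l_def u_def)
  have td: "tidy x j (upd m c p)" if "26 \<le> j" for j
  proof -
    have "tidy x 26 (upd m c p)" unfolding upd_def using \<rho>(1) Suc.prems(1) n_le pcn by simp
    then show ?thesis using tidy_mono that by blast
  qed
  have td1: "tidy x j ((upd m c p)(8 := l, 9 := u))" if "26 \<le> j" for j
    using td[OF that] lu that less_length by simp
  have c'n: "c' < n" using lu by (simp add: c'_def)
  have td2: "tidy x j ((upd m c p)(8 := l, 9 := u, 11 := c'))" if "26 \<le> j" for j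
    using td1[OF that] c'n that less_length by simp
  have td3: "tidy x j ((upd m c p)(8 := l, 9 := u, 11 := c', 7 := c))" if "26 \<le> j" for j
    using td2[OF that] pcn that less_length by simp
  let ?v = "encode_vertex (vertex k c) @ [Comma]"
  have w: "walk (n - Suc m) = c" unfolding walk_def Suc.prems(2)[symmetric] by simp
  have out: "[n - Suc m..<n] = (n - Suc m) # [n - m..<n]" using Suc.prems(1) by (simp add: upt_conv_Cons nm)
  have IH: "wp x walk_loop Q (h, upd m c' c, out @ ?v)" for h
    unfolding upd_def
    by (rule Suc.IH) (use Suc.prems(1,3) step out w in \<open>simp_all add: encode_vertex_def\<close>)
  have 5: "wp x (clear 8 ;; clear 9 ;; clear 11) (wp x walk_loop Q)
      (h, (upd m c p)(8 := l, 9 := u, 11 := c', 7 := c, 6 := c'), out @ ?v)" for h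
    by (intro wp_Seq wp_clear, unfold upd, rule IH)
  have 4: "wp x (copy 6 7 ;; copy 11 6 ;; clear 8 ;; clear 9 ;; clear 11) (wp x walk_loop Q)
      (h, (upd m c p)(8 := l, 9 := u, 11 := c'), out @ ?v)" for h
  proof (rule wp_Seq, rule wp_copy, rule td2)
    have eq: "((upd m c p)(8 := l, 9 := u, 11 := c')) 6 = c" by (simp add: upd)
    have eq': "((upd m c p)(8 := l, 9 := u, 11 := c', 7 := c)) 11 = c'" by simp
    show "wp x (copy 11 6 ;; clear 8 ;; clear 9 ;; clear 11) (wp x walk_loop Q)
      (h, (upd m c p)(8 := l, 9 := u, 11 := c', 7 := ((upd m c p)(8 := l, 9 := u, 11 := c')) 6), out @ ?v)"
      unfolding eq by (rule wp_Seq, rule wp_copy, rule td3, simp, simp, simp, simp, unfold eq', rule 5)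
  qed simp_all
  have 3: "wp x (compare 7 8 (copy 8 11) (copy 9 11) (copy 8 11))
      (wp x (copy 6 7 ;; copy 11 6 ;; clear 8 ;; clear 9 ;; clear 11) (wp x walk_loop Q))
      (h, (upd m c p)(8 := l, 9 := u), out @ ?v)" for h
    by (intro wp_compare wp_copy td1) (use 4[of h] in \<open>auto simp: upd c'_def split: if_splits\<close>)
  have 2: "wp x (neighbours_of ;; compare 7 8 (copy 8 11) (copy 9 11) (copy 8 11) ;;
      copy 6 7 ;; copy 11 6 ;; clear 8 ;; clear 9 ;; clear 11) (wp x walk_loop Q) (h, upd m c p, out @ ?v)" for h
    by (rule wp_Seq, rule wp_neighbours_of[where v = c])
      (use td[of 26] zs pcn wp_Seq[OF 3, folded l_def u_def] in \<open>simp_all add: upd l_def u_def\<close>)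
  have 1: "wp x (print_vertex 6) (wp x (neighbours_of ;; compare 7 8 (copy 8 11) (copy 9 11) (copy 8 11) ;;
      copy 6 7 ;; copy 11 6 ;; clear 8 ;; clear 9 ;; clear 11) (wp x walk_loop Q)) (h, upd m c p, out)" for h
    by (rule wp_print_vertex[OF _ _ _ k]) (use td[of 32] 2 in \<open>simp_all add: upd vertex_def\<close>)
  have "wp x walk_loop Q (h, upd (Suc m) c p, out)" unfolding walk_loop_def
    by (rule wp_Loop_False, simp add: upd, rule wp_Seq, rule wp_Dec, simp add: upd, rule wp_Seq)
      (use 1[unfolded walk_loop_def] in \<open>simp add: upd\<close>)
  then show ?case unfolding upd_def .
qed

lemma wp_second_cycle:
  assumes Q: "\<And>s. snd (snd s) = out @ encode_vertices (map (vertex k) (map walk [0..<n])) \<Longrightarrow> Q s"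
  shows "wp x second_cycle Q (h, (\<lambda>_. 0)(0 := n, 1 := pos k), out)"
proof -
  define upd :: "nat \<Rightarrow> nat \<Rightarrow> nat \<Rightarrow> nat \<Rightarrow> nat"
    where "upd i m p = (\<lambda>_. 0)(0 := n, 1 := pos k, 2 := i, 3 := m, 7 := p)" for i m p
  have upd: "(upd i m p)(2 := i') = upd i' m p" "(upd i m p)(3 := m') = upd i m' p" "(upd i m p)(7 := p') = upd i m p'"
    "upd i m p 0 = n" "upd i m p 1 = pos k" "upd i m p (Suc 0) = pos k" "upd i m p 2 = i" "upd i m p 3 = m" "upd i m p 7 = p"
    for i m p i' m' p' by (auto simp: upd_def fun_eq_iff)
  have zs: "upd i 0 p r = 0" if "r \<in> {3, 4, 5, 8, 9, 10, 11, 12, 13}" for i p r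
    using that by (auto simp: upd_def)
  have upd0: "(\<lambda>_. 0)(0 := n, 1 := pos k) = upd 0 0 0" by (auto simp: upd_def fun_eq_iff)
  have td: "tidy x j (upd i m p)" if "26 \<le> j" "i \<le> n" "m \<le> n" "p \<le> n" for i m p j
    unfolding upd_def using that pos_bound[of k] n_le by (intro tidy_upd) (auto simp: tidy_def)
  have bd: "n \<le> length x" "0 < length x" "2 < n" using n_le two by auto
  have "wp x walk_loop Q (h, (upd start 0 0)(3 := n, 6 := 0, 7 := n - 1), out)" for h
    by (rule wp_walk_loop[OF _ _ _ _ zs]) (use td start_less Q in \<open>simp_all add: upd\<close>)
  moreover have "(upd start 0 0)(3 := n, 6 := 0, 7 := n - 1) = upd start n (n - 1)"
    by (auto simp: upd_def fun_eq_iff)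
  ultimately have 3: "wp x walk_loop Q (h, upd start n (n - 1), out)" for h by (simp only:)
  have 2: "wp x (copy 0 3 ;; copy 0 7 ;; Dec 7 ;; walk_loop) Q (h, upd start 0 0, out)" for h
    by (rule wp_Seq, rule wp_copy, rule td, simp, use start_less in simp, simp, simp, simp, simp, simp,
        unfold upd, rule wp_Seq, rule wp_copy, rule td, simp, use start_less in simp, simp, simp, simp, simp, simp,
        unfold upd, rule wp_Seq, rule wp_Dec, use n_pos in \<open>simp add: upd\<close>) (use 3 in \<open>simp add: upd\<close>)
  have "wp x start_loop (wp x (copy 0 3 ;; copy 0 7 ;; Dec 7 ;; walk_loop) Q) (h, (upd 0 0 0)(2 := 2, 3 := n), out)" for h
    by (rule wp_start_loop) (use td[of 26 0 0 0] zs 2 two in \<open>simp_all add: upd start_def\<close>)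
  then have 1: "wp x start_loop (wp x (copy 0 3 ;; copy 0 7 ;; Dec 7 ;; walk_loop) Q) (h, upd 2 n 0, out)" for h
    by (simp add: upd)
  show ?thesis unfolding second_cycle_def upd0
    by (rule wp_Seq, rule wp_copy, rule td, simp, simp, simp, simp, simp, simp, simp, unfold upd,
        rule wp_Seq, rule wp_Inc, simp add: upd, unfold upd, rule wp_Seq, rule wp_Inc, use bd in \<open>simp add: upd\<close>,
        unfold upd, rule wp_Seq) (use 1 in \<open>simp add: numeral_2_eq_2\<close>)
qed

end

section \<open>Bipartite 2-regular graphs\<close>

text \<open>\<open>N1\<close> and \<open>N2\<close> list the two neighbours of an index without any
  order between them, and the parity of the index serves as its colour.\<close>

locale two_regular =
  fixes n :: nat and N1 N2 :: "nat \<Rightarrow> nat"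
  assumes nbr_less: "v < n \<Longrightarrow> u \<in> {N1 v, N2 v} \<Longrightarrow> u < n"
    and nbr_distinct: "v < n \<Longrightarrow> N1 v \<noteq> N2 v"
    and nbr_sym: "v < n \<Longrightarrow> u \<in> {N1 v, N2 v} \<Longrightarrow> v \<in> {N1 u, N2 u}"
    and nbr_parity: "v < n \<Longrightarrow> u \<in> {N1 v, N2 v} \<Longrightarrow> odd (u + v)"
begin

text \<open>A step that does not turn back, acting on arcs (previous, current). It is
  \<open>advance_walk\<close> for abstract neighbours.\<close>

definition other :: "nat \<times> nat \<Rightarrow> nat \<times> nat" where
  "other pc = (snd pc, if fst pc = N1 (snd pc) then N2 (snd pc) else N1 (snd pc))"

definition trace :: "nat \<Rightarrow> nat \<Rightarrow> nat \<Rightarrow> nat" where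
  "trace p c m = snd ((other ^^ m) (p, c))"

text \<open>Among indices below \<open>n\<close> these are the unions of components.\<close>

definition closed :: "nat set \<Rightarrow> bool" where
  "closed X \<longleftrightarrow> (\<forall>v\<in>X. N1 v \<in> X \<and> N2 v \<in> X)"

context
  fixes p c :: nat
  assumes c: "c < n" and p: "p \<in> {N1 c, N2 c}"
begin

lemma fst_other_Suc: "fst ((other ^^ Suc m) (p, c)) = trace p c m"
  by (simp add: trace_def other_def)

lemma trace_less_nbr:
  "trace p c m < n \<and> fst ((other ^^ m) (p, c)) \<in> {N1 (trace p c m), N2 (trace p c m)}"
proof (induction m)
  case 0
  then show ?case using c p by (simp add: trace_def)
next
  case (Suc m)
  have "trace p c (Suc m) \<in> {N1 (trace p c m), N2 (trace p c m)}"
    by (simp add: trace_def other_def)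
  then show ?case using Suc nbr_less nbr_sym fst_other_Suc by metis
qed

lemma trace_less: "trace p c m < n"
  using trace_less_nbr by blast

lemma nbrs_trace:
  "{N1 (trace p c m), N2 (trace p c m)} = {fst ((other ^^ m) (p, c)), trace p c (Suc m)}"
  "fst ((other ^^ m) (p, c)) \<noteq> trace p c (Suc m)"
  using trace_less_nbr[of m] nbr_distinct[OF trace_less[of m]]
  by (auto simp: trace_def other_def)

lemma nbrs_trace_Suc:
  "{N1 (trace p c (Suc m)), N2 (trace p c (Suc m))} = {trace p c m, trace p c (Suc (Suc m))}"
  "trace p c m \<noteq> trace p c (Suc (Suc m))"
  using nbrs_trace[of "Suc m"] unfolding fst_other_Suc by auto

lemma trace_parity: "even (trace p c m + c + m)"
proof (induction m)
  case 0
  then show ?case by (simp add: trace_def)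
next
  case (Suc m)
  have "odd (trace p c (Suc m) + trace p c m)"
    using nbr_parity[OF trace_less[of m]] nbrs_trace(1)[of m] by blast
  then show ?case using Suc by simp presburger
qed

text \<open>The first repetition on a walk that never turns back closes it up at its start.\<close>

lemma cycle_through:
  "\<exists>j\<ge>3. even j \<and> inj_on (trace p c) {..<j} \<and> trace p c (j - 1) = p \<and>
    closed (trace p c ` {..<j}) \<and> (\<forall>m<j. {N1 (trace p c m), N2 (trace p c m)} =
      {trace p c (if m = 0 then j - 1 else m - 1), trace p c (Suc m mod j)})"
proof -
  let ?w = "trace p c"
  have "\<not> inj_on ?w {..n}"
  proof
    assume "inj_on ?w {..n}"
    moreover have "?w ` {..n} \<subseteq> {..<n}" using trace_less by blast
    ultimately have "card {..n} \<le> card {..<n}" by (metis card_inj_on_le finite_lessThan)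
    then show False by simp
  qed
  then have ex: "\<exists>j. \<exists>i<j. ?w i = ?w j" unfolding inj_on_def by (metis linorder_neqE_nat)
  define j where "j = (LEAST j. \<exists>i<j. ?w i = ?w j)"
  obtain i where i: "i < j" "?w i = ?w j" using LeastI_ex[OF ex] unfolding j_def by blast
  have fresh: "?w i' \<noteq> ?w j'" if "i' < j'" "j' < j" for i' j'
    using not_less_Least that unfolding j_def by blast
  have inj: "inj_on ?w {..<j}"
    unfolding inj_on_def using fresh by (metis lessThan_iff linorder_neqE_nat)
  have nsucc: "?w m \<noteq> ?w (Suc m)" for m
    using trace_parity[of m] trace_parity[of "Suc m"] by (metis add_Suc_right even_Suc)
  have nsucc2: "?w m \<noteq> ?w (Suc (Suc m))" for m using nbrs_trace_Suc(2) .
  obtain j' where j': "j = Suc j'" using i(1) by (cases j) auto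
  \<comment> \<open>The predecessor of the repeated index is one of its two neighbours; identifying
    it locates the repetition.\<close>
  have last: "?w j' \<in> {N1 (?w j), N2 (?w j)}" unfolding j' using nbrs_trace_Suc(1)[of j'] nbr_sym trace_less
    by (metis insertI1)
  have j3: "3 \<le> j"
  proof (rule ccontr)
    assume "\<not> 3 \<le> j"
    then have "(i = 0 \<and> j = 1) \<or> (i = 0 \<and> j = 2) \<or> (i = 1 \<and> j = 2)" using i(1) by auto
    then show False using i(2) nsucc[of 0] nsucc[of 1] nsucc2[of 0] by (auto simp: numeral_2_eq_2)
  qed
  \<comment> \<open>Otherwise \<open>?w j'\<close> would be \<open>?w (i - 1)\<close> or
    \<open>?w (i + 1)\<close>: either an earlier repetition, or, if these indices are too close
    together, a conflict with parity or with not turning back.\<close>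
  have i0: "i = 0"
  proof (rule ccontr)
    assume "i \<noteq> 0"
    then obtain i' where i': "i = Suc i'" by (cases i) auto
    have "?w j' \<in> {?w i', ?w (Suc i)}"
      using last unfolding i(2)[symmetric] i' nbrs_trace_Suc(1)[of i'] .
    moreover have "?w j' \<noteq> ?w i'" using fresh[of i' j'] i(1) i' j' by auto
    moreover have "?w j' \<noteq> ?w (Suc i)"
    proof
      assume e: "?w j' = ?w (Suc i)"
      then have "Suc i = j' \<or> Suc i = j" using fresh[of "Suc i" j'] i(1) j' by (metis Suc_leI le_neq_implies_less less_Suc_eq not_less_eq)
      then show False
      proof
        assume "Suc i = j'"
        then show False using i(2) j' nsucc2[of i] by simp
      next
        assume "Suc i = j"
        then show False using i(2) nsucc[of i] by simp
      qed
    qed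
    ultimately show False by blast
  qed
  have wj: "?w j = ?w 0" using i(2) i0 by simp
  \<comment> \<open>The walk re-enters \<open>c\<close> from one of its neighbours;
    \<open>?w (Suc 0)\<close> would be an earlier repetition, so it is the other one.\<close>
  have p': "?w j' = p"
  proof -
    have "?w 0 = c" "fst ((other ^^ 0) (p, c)) = p" by (simp_all add: trace_def)
    then have "{N1 (?w 0), N2 (?w 0)} = {p, ?w (Suc 0)}" using nbrs_trace(1)[of 0] by simp
    then have "?w j' \<in> {p, ?w (Suc 0)}" using last unfolding wj by blast
    moreover have "?w j' \<noteq> ?w (Suc 0)" using fresh[of "Suc 0" j'] j3 j' by auto
    ultimately show ?thesis by blast
  qed
  have nb: "{N1 (?w m), N2 (?w m)} = {?w (if m = 0 then j - 1 else m - 1), ?w (Suc m mod j)}" if "m < j" for m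
  proof -
    have sm: "?w (Suc m mod j) = ?w (Suc m)"
    proof (cases "Suc m = j")
      case True
      then show ?thesis using wj by simp
    next
      case False
      then show ?thesis using that by simp
    qed
    show ?thesis
    proof (cases m)
      case 0
      have "fst ((other ^^ 0) (p, c)) = p" by simp
      then show ?thesis using nbrs_trace(1)[of 0] p' sm unfolding 0 j' by simp
    next
      case (Suc m')
      then show ?thesis using nbrs_trace_Suc(1)[of m'] sm by simp
    qed
  qed
  have "closed (?w ` {..<j})"
    unfolding closed_def
  proof (intro ballI)
    fix v assume "v \<in> ?w ` {..<j}"
    then obtain m where m: "m < j" "v = ?w m" by blast
    have "(if m = 0 then j - 1 else m - 1) < j" "Suc m mod j < j" using m j3 by auto
    then have "{N1 v, N2 v} \<subseteq> ?w ` {..<j}" unfolding m(2) nb[OF m(1)] by blast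
    then show "N1 v \<in> ?w ` {..<j} \<and> N2 v \<in> ?w ` {..<j}" by blast
  qed
  \<comment> \<open>\<open>p\<close> and \<open>c\<close> are neighbours of opposite parity, and
    parity alternates along the trace.\<close>
  moreover have "even j"
  proof -
    have "odd (p + c)" using nbr_parity[OF c p] by simp
    then show ?thesis using trace_parity[of j'] unfolding p' j' by simp
  qed
  moreover have "?w (j - 1) = p" using p' j' by simp
  moreover have "\<forall>m<j. {N1 (?w m), N2 (?w m)} = {?w (if m = 0 then j - 1 else m - 1), ?w (Suc m mod j)}"
    using nb by blast
  ultimately show ?thesis using j3 inj by blast
qed

end

lemma closed_all: "closed {..<n}"
  unfolding closed_def
proof
  fix v assume "v \<in> {..<n}"
  then show "N1 v \<in> {..<n} \<and> N2 v \<in> {..<n}"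
    using nbr_less[of v "N1 v"] nbr_less[of v "N2 v"] by simp
qed

lemma trace_closed:
  assumes "c < n" "p \<in> {N1 c, N2 c}" "closed X" "c \<in> X"
  shows "trace p c m \<in> X"
proof (induction m)
  case 0
  then show ?case using assms(4) by (simp add: trace_def)
next
  case (Suc m)
  have "trace p c (Suc m) \<in> {N1 (trace p c m), N2 (trace p c m)}"
    using nbrs_trace(1)[OF assms(1,2), of m] by simp
  moreover have "N1 (trace p c m) \<in> X" "N2 (trace p c m) \<in> X"
    using Suc assms(3) unfolding closed_def by auto
  ultimately show ?case by auto
qed

text \<open>By symmetry an edge from outside into \<open>C\<close> would also be an edge leaving
  \<open>C\<close>.\<close>

lemma closed_Diff:
  assumes "X \<subseteq> {..<n}" "closed X" "closed C"
  shows "closed (X - C)"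
  unfolding closed_def
proof (intro ballI)
  fix u assume u: "u \<in> X - C"
  have un: "u < n" using u assms(1) by blast
  have "t \<notin> C" if "t \<in> {N1 u, N2 u}" for t
  proof
    assume "t \<in> C"
    then have "N1 t \<in> C" "N2 t \<in> C" using assms(3) unfolding closed_def by blast+
    moreover have "u \<in> {N1 t, N2 t}" using nbr_sym[OF un that] .
    ultimately show False using u by auto
  qed
  moreover have "N1 u \<in> X" "N2 u \<in> X" using u assms(2) unfolding closed_def by blast+
  ultimately show "N1 u \<in> X - C \<and> N2 u \<in> X - C" by blast
qed

text \<open>A closed set falls into cycles of even length, each of which is matched by every other
  edge. Induction on the size, splitting off one cycle at a time.\<close>

lemma closed_matching:
  assumes "X \<subseteq> {..<n}" "closed X"
  shows "\<exists>g. bij_betw g {v \<in> X. even v} {v \<in> X. odd v} \<and> (\<forall>v\<in>X. g v \<in> {N1 v, N2 v} \<or> odd v)"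
  using assms
proof (induction "card X" arbitrary: X rule: less_induct)
  case less
  show ?case
  proof (cases "X = {}")
    case True
    then show ?thesis by (intro exI[of _ id]) (auto simp: bij_betw_def)
  next
    case False
    then obtain v where v: "v \<in> X" by blast
    \<comment> \<open>An even vertex as starting point, so that the parity of a position on the
      cycle is the parity of the vertex there.\<close>
    define b where "b = (if even v then v else N1 v)"
    have vn: "v < n" using v less.prems(1) by blast
    have "N1 v \<in> X" using v less.prems(2) unfolding closed_def by blast
    then have bX: "b \<in> X" using v unfolding b_def by simp
    have "odd (N1 v + v)" using nbr_parity[OF vn] by blast
    then have be: "even b" unfolding b_def by simp
    have b: "b \<in> X" "even b" "b < n" using bX be less.prems(1) by auto
    let ?w = "trace (N1 b) b"
    have "N1 b \<in> {N1 b, N2 b}" by blast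
    from cycle_through[OF b(3) this] obtain j where j: "3 \<le> j" "even j" "inj_on ?w {..<j}" "closed (?w ` {..<j})"
      "\<forall>m<j. {N1 (?w m), N2 (?w m)} = {?w (if m = 0 then j - 1 else m - 1), ?w (Suc m mod j)}"
      by blast
    let ?C = "?w ` {..<j}"
    have "even (?w m + b + m)" for m by (rule trace_parity[OF b(3)]) simp
    then have par: "even (?w m) \<longleftrightarrow> even m" for m using b(2) by (metis even_add)
    have wX: "?w m \<in> X" for m by (rule trace_closed) (use b less.prems in auto)
    have CX: "?C \<subseteq> X" using wX by blast
    have fin: "finite X" using less.prems(1) finite_subset by blast
    have "?w 0 \<in> ?C" using j(1) by auto
    then have "X - ?C \<subset> X" using wX by blast
    then have "card (X - ?C) < card X" using fin psubset_card_mono by blast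
    moreover have "closed (X - ?C)" by (rule closed_Diff) (use less.prems j in auto)
    ultimately obtain g where g: "bij_betw g {v \<in> X - ?C. even v} {v \<in> X - ?C. odd v}"
      "\<forall>v\<in>X - ?C. g v \<in> {N1 v, N2 v} \<or> odd v"
      using less.hyps[of "X - ?C"] less.prems(1) by blast
    define i where "i = inv_into {..<j} ?w"
    have i: "i (?w m) = m" if "m < j" for m unfolding i_def using inv_into_f_f[OF j(3)] that by simp
    \<comment> \<open>Matches every even vertex of the cycle with the next vertex on it;
      \<open>Suc\<close> cannot overrun, since the length is even.\<close>
    define f where "f = (\<lambda>v. ?w (Suc (i v)))"
    have fw: "f (?w m) = ?w (Suc m)" if "m < j" for m unfolding f_def i[OF that] ..
    have f: "bij_betw f {v \<in> ?C. even v} {v \<in> ?C. odd v}"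
    proof (rule bij_betwI')
      fix u v assume "u \<in> {v \<in> ?C. even v}" "v \<in> {v \<in> ?C. even v}"
      then obtain r s where rs: "u = ?w r" "v = ?w s" "r < j" "s < j" "even r" "even s" using par by auto
      have "Suc r < j" "Suc s < j" using rs j(2) by (metis Suc_lessI even_Suc)+
      then show "(f u = f v) = (u = v)"
        using rs fw inj_on_eq_iff[OF j(3)] by simp
    next
      fix u assume "u \<in> {v \<in> ?C. even v}"
      then obtain r where r: "u = ?w r" "r < j" "even r" using par by auto
      have "Suc r < j" using r j(2) by (metis Suc_lessI even_Suc)
      then show "f u \<in> {v \<in> ?C. odd v}" using r fw par by auto
    next
      fix u assume "u \<in> {v \<in> ?C. odd v}"
      then obtain r where r: "u = ?w r" "r < j" "odd r" using par by auto
      then obtain s where "r = Suc s" by (cases r) auto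
      then show "\<exists>x\<in>{v \<in> ?C. even v}. u = f x" using r fw par by (intro bexI[of _ "?w s"]) auto
    qed
    have fn: "f v \<in> {N1 v, N2 v} \<or> odd v" if vC: "v \<in> ?C" for v
    proof (cases "even v")
      case True
      then obtain r where r: "v = ?w r" "r < j" "even r" using par vC by auto
      have "Suc r < j" using r j(2) by (metis Suc_lessI even_Suc)
      then have "f v \<in> {N1 v, N2 v}" unfolding r(1) fw[OF r(2)] j(5)[rule_format, OF r(2)] using \<open>Suc r < j\<close> by simp
      then show ?thesis by blast
    qed simp
    define h where "h = (\<lambda>v. if v \<in> {v \<in> ?C. even v} then f v else g v)"
    have "bij_betw h ({v \<in> ?C. even v} \<union> {v \<in> X - ?C. even v}) ({v \<in> ?C. odd v} \<union> {v \<in> X - ?C. odd v})"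
      unfolding h_def by (rule bij_betw_disjoint_Un[OF f g(1)]) auto
    moreover have "{v \<in> ?C. even v} \<union> {v \<in> X - ?C. even v} = {v \<in> X. even v}"
      "{v \<in> ?C. odd v} \<union> {v \<in> X - ?C. odd v} = {v \<in> X. odd v}" using CX by auto
    ultimately have "bij_betw h {v \<in> X. even v} {v \<in> X. odd v}" by simp
    moreover have "\<forall>v\<in>X. h v \<in> {N1 v, N2 v} \<or> odd v"
      using fn g(2) unfolding h_def by auto
    ultimately show ?thesis by blast
  qed
qed

end

text \<open>Distinct vertices give distinct arcs. This turns the parity condition on Pfaffian
  orientations into the parity of a sum over positions.\<close>

lemma cycle_arcs_card:
  assumes "distinct C"
  shows "card (cycle_arcs C \<inter> D) = (\<Sum>m<length C. of_bool ((C ! m, C ! (Suc m mod length C)) \<in> D))"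
proof -
  let ?f = "\<lambda>m. (C ! m, C ! (Suc m mod length C))"
  have "inj_on ?f {..<length C}"
    using assms by (auto simp: inj_on_def nth_eq_iff_index_eq)
  then have "inj_on ?f {m \<in> {..<length C}. ?f m \<in> D}" by (rule inj_on_subset) auto
  moreover have "cycle_arcs C \<inter> D = ?f ` {m \<in> {..<length C}. ?f m \<in> D}"
    by (auto simp: cycle_arcs_def)
  ultimately have "card (cycle_arcs C \<inter> D) = card {m \<in> {..<length C}. ?f m \<in> D}"
    by (simp add: card_image)
  also have "\<dots> = (\<Sum>m<length C. of_bool (?f m \<in> D))"
    by (simp add: sum.If_cases of_bool_def Int_def)
  finally show ?thesis .
qed

section \<open>Pfaffian orientations along a Hamiltonian cycle\<close>

locale hamiltonian_graph =
  fixes G :: "'a graph" and V :: "nat \<Rightarrow> 'a" and n :: nat and D :: "('a \<times> 'a) set"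
  assumes simple: "simple_graph G" and bip: "bipartite G" and pf: "pfaffian_orientation G D"
    and deg: "v \<in> verts G \<Longrightarrow> 3 \<le> degree G v"
    and bij: "bij_betw V {..<n} (verts G)"
    and cycle_edge: "i < n \<Longrightarrow> {V i, V (Suc i mod n)} \<in> edges G" and n3: "3 \<le> n"
begin

definition A :: "nat \<Rightarrow> nat \<Rightarrow> bool" where
  "A i j \<longleftrightarrow> {V i, V j} \<in> edges G"

lemma V_eq_iff: "i < n \<Longrightarrow> j < n \<Longrightarrow> V i = V j \<longleftrightarrow> i = j"
  using bij by (auto simp: bij_betw_def inj_on_def)

lemma V_verts: "i < n \<Longrightarrow> V i \<in> verts G"
  using bij by (auto simp: bij_betw_def)

lemma verts_V: "verts G = V ` {..<n}"
  using bij by (auto simp: bij_betw_def)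

lemma A_sym: "A i j \<longleftrightarrow> A j i"
  by (simp add: A_def insert_commute)

lemma A_irrefl: "\<not> A i i"
  using simple unfolding A_def simple_graph_def by fastforce

lemma A_cycle: "i < n \<Longrightarrow> A i (Suc i mod n)"
  unfolding A_def by (rule cycle_edge)

lemma A_Suc: "Suc i < n \<Longrightarrow> A i (Suc i)"
  using A_cycle[of i] by simp

lemma two_colouring: "\<exists>c :: nat \<Rightarrow> bool. \<forall>i j. A i j \<longrightarrow> c i \<noteq> c j"
proof -
  obtain X Y where XY: "X \<inter> Y = {}" "\<forall>e\<in>edges G. \<exists>a\<in>X. \<exists>b\<in>Y. e = {a, b}"
    using bip unfolding bipartite_def by blast
  have "(V i \<in> X) \<noteq> (V j \<in> X)" if "A i j" for i j
  proof -
    obtain a b where "a \<in> X" "b \<in> Y" "{V i, V j} = {a, b}" using XY(2) \<open>A i j\<close> unfolding A_def by blast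
    then show ?thesis using XY(1) by (auto simp: doubleton_eq_iff)
  qed
  then show ?thesis by (intro exI[of _ "\<lambda>i. V i \<in> X"]) blast
qed

text \<open>The edges of \<open>H\<close> alternate between the two colour classes, so the class of
  a vertex is determined by the parity of its index.\<close>

lemma A_parity:
  assumes "i < n" "j < n" "A i j"
  shows "odd (i + j)"
proof -
  obtain c :: "nat \<Rightarrow> bool" where c: "A i j \<Longrightarrow> c i \<noteq> c j" for i j using two_colouring by blast
  have ci: "c i = (c 0 = even i)" if "i < n" for i
    using that
  proof (induction i)
    case (Suc i)
    then show ?case using c[OF A_Suc[of i]] by auto
  qed simp
  show ?thesis using ci[OF assms(1)] ci[OF assms(2)] c[OF assms(3)] by (cases "c 0") auto
qed

lemma even_n: "even n"
proof -
  have "A (n - 1) 0" using A_cycle[of "n - 1"] n3 by simp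
  then have "odd (n - 1 + 0)" by (rule A_parity[rotated 2]) (use n3 in auto)
  then show ?thesis using n3 by simp
qed

lemma n4: "4 \<le> n"
  using even_n n3 by presburger

text \<open>At most two neighbours are barred, and the degree is at least three.\<close>

lemma exists_chord:
  assumes "i < n"
  shows "\<exists>j<n. A i j \<and> j \<noteq> Suc i \<and> Suc j \<noteq> i"
proof (rule ccontr)
  assume none: "\<not> ?thesis"
  have "neighbours G (V i) \<subseteq> V ` {Suc i, i - 1}"
  proof
    fix u assume u: "u \<in> neighbours G (V i)"
    then have "{V i, u} \<in> edges G" by (simp add: neighbours_def)
    moreover from this have "u \<in> verts G"
      using simple unfolding simple_graph_def by (fastforce simp: doubleton_eq_iff)
    ultimately obtain j where "j < n" "u = V j" "A i j" unfolding A_def verts_V by blast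
    then show "u \<in> V ` {Suc i, i - 1}" using none by fastforce
  qed
  then have "card (neighbours G (V i)) \<le> card {Suc i, i - 1}"
    by (meson card_image_le card_mono dual_order.trans finite.emptyI finite.insertI finite_imageI)
  also have "\<dots> \<le> 2" by (simp add: card_insert_if)
  finally show False using deg[OF V_verts[OF assms]] by (simp add: degree_def)
qed

lemma orientation: "A i j \<Longrightarrow> ((V i, V j) \<in> D) \<noteq> ((V j, V i) \<in> D)"
  using pf unfolding pfaffian_orientation_def orientation_def A_def by blast

text \<open>A matching is given as a map \<open>g\<close> on one end of its edges; disjointness and
  covering become statements about index sets.\<close>

lemma matching_from_bijection:
  assumes "Y \<subseteq> {..<n}" "S \<subseteq> {..<n}" "inj_on g Y" "Y \<inter> g ` Y = {}" "Y \<union> g ` Y = {..<n} - S"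
    and "\<And>m. m \<in> Y \<Longrightarrow> A m (g m)"
  shows "\<exists>M. perfect_matching (delete_vertices G (V ` S)) M"
proof -
  define M where "M = (\<lambda>m. {V m, V (g m)}) ` Y"
  have gn: "g m < n" "m < n" "g m \<notin> S" "m \<notin> S" if "m \<in> Y" for m using assms(5) that by blast+
  have disj: "{V m, V (g m)} \<inter> V ` S = {}" if "m \<in> Y" for m
  proof -
    have "V m \<noteq> V s" "V (g m) \<noteq> V s" if "s \<in> S" for s
      using gn[OF \<open>m \<in> Y\<close>] that assms(2) V_eq_iff by (metis lessThan_iff subsetD)+
    then show ?thesis by auto
  qed
  have "M \<subseteq> edges (delete_vertices G (V ` S))"
  proof
    fix e assume "e \<in> M"
    then obtain m where "m \<in> Y" "e = {V m, V (g m)}" unfolding M_def by blast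
    then show "e \<in> edges (delete_vertices G (V ` S))"
      using disj assms(6) unfolding delete_vertices_def A_def by simp
  qed
  moreover have "pairwise disjnt M"
  proof (rule pairwiseI)
    fix e f assume "e \<in> M" "f \<in> M" "e \<noteq> f"
    then obtain l m where lm: "l \<in> Y" "m \<in> Y" "e = {V l, V (g l)}" "f = {V m, V (g m)}" "l \<noteq> m"
      unfolding M_def by blast
    have "g l \<noteq> g m" using lm assms(3) by (metis inj_onD)
    moreover have "l \<noteq> g m" "g l \<noteq> m" using lm assms(4) by blast+
    ultimately show "disjnt e f"
      using lm gn V_eq_iff by (auto simp: disjnt_def)
  qed
  moreover have "\<Union> M = verts (delete_vertices G (V ` S))"
  proof -
    have "\<Union> M = V ` (Y \<union> g ` Y)" unfolding M_def by auto
    also have "\<dots> = V ` ({..<n} - S)" by (simp add: assms(5))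
    also have "\<dots> = V ` {..<n} - V ` S"
      using bij assms(2) by (intro inj_on_image_set_diff[of V "{..<n}"]) (auto simp: bij_betw_def)
    finally show ?thesis by (simp add: delete_vertices_def verts_V)
  qed
  ultimately show ?thesis unfolding perfect_matching_def by blast
qed

lemma is_cycle_map:
  assumes "distinct C" "set C \<subseteq> {..<n}" "3 \<le> length C"
    and "\<And>m. m < length C \<Longrightarrow> A (C ! m) (C ! (Suc m mod length C))"
  shows "is_cycle G (map V C)"
proof -
  have "inj_on V (set C)" using bij assms(2) unfolding bij_betw_def by (meson inj_on_subset)
  then have "distinct (map V C)" using assms(1) by (simp add: distinct_map)
  moreover have "set (map V C) \<subseteq> verts G" using assms(2) V_verts by auto
  moreover have "{u, v} \<in> edges G" if uv: "(u, v) \<in> cycle_arcs (map V C)" for u v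
  proof -
    obtain m where m: "m < length C" "u = map V C ! m" "v = map V C ! (Suc m mod length C)"
      using uv unfolding cycle_arcs_def by auto
    have "Suc m mod length C < length C" using m(1) by (intro mod_less_divisor) auto
    then have "u = V (C ! m)" "v = V (C ! (Suc m mod length C))" "m < length C" using m by simp_all
    then show ?thesis using assms(4)[of m] by (simp add: A_def)
  qed
  then have "cycle_edges (map V C) \<subseteq> edges G" unfolding cycle_edges_def by blast
  ultimately show ?thesis using assms(3) unfolding is_cycle_def by simp
qed

lemma central_odd:
  assumes "distinct C" "set C \<subseteq> {..<n}" "3 \<le> length C"
    and "\<And>m. m < length C \<Longrightarrow> A (C ! m) (C ! (Suc m mod length C))"
    and "\<exists>M. perfect_matching (delete_vertices G (V ` set C)) M"
  shows "odd (\<Sum>m<length C. of_bool ((V (C ! m), V (C ! (Suc m mod length C))) \<in> D) :: nat)"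
proof -
  have cyc: "is_cycle G (map V C)" using is_cycle_map assms by blast
  then have "central_cycle G (map V C)" using assms(5) unfolding central_cycle_def by simp
  then have "odd (card (cycle_arcs (map V C) \<inter> D))" using pf unfolding pfaffian_orientation_def by blast
  moreover have "distinct (map V C)" using cyc unfolding is_cycle_def by blast
  ultimately have "odd (\<Sum>m<length C. of_bool ((map V C ! m, map V C ! (Suc m mod length C)) \<in> D) :: nat)"
    by (simp add: cycle_arcs_card)
  moreover have "(\<Sum>m<length C. of_bool ((map V C ! m, map V C ! (Suc m mod length C)) \<in> D) :: nat) =
    (\<Sum>m<length C. of_bool ((V (C ! m), V (C ! (Suc m mod length C))) \<in> D))"
  proof (rule sum.cong)
    fix m assume "m \<in> {..<length C}"
    then have "m < length C" "Suc m mod length C < length C" by (auto intro: mod_less_divisor)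
    then show "of_bool ((map V C ! m, map V C ! (Suc m mod length C)) \<in> D) =
      (of_bool ((V (C ! m), V (C ! (Suc m mod length C))) \<in> D) :: nat)" by simp
  qed simp
  ultimately show ?thesis by metis
qed

text \<open>Switching at the vertices with value \<open>True\<close> reverses exactly the arcs
  between vertices of different value. The values are chosen along the path \<open>V 0\<close>,
  \<open>V 1\<close>, ... so that its edges become forward.\<close>

primrec switch :: "nat \<Rightarrow> bool" where
  "switch 0 = False"
| "switch (Suc i) = (if (V i, V (Suc i)) \<in> D then switch i else \<not> switch i)"

text \<open>What remains of \<open>H\<close> is a cyclic interval of even length, running through
  \<open>n - 1\<close> and 0. Each remaining \<open>m\<close> with the parity of \<open>i\<close> is
  matched with its cyclic successor; parity survives the wrap-around because \<open>n\<close> is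
  even.\<close>

lemma interval_matching:
  assumes "i < j" "j < n" "odd (i + j)"
  shows "\<exists>M. perfect_matching (delete_vertices G (V ` {i..j})) M"
proof -
  define g where "g m = (if Suc m = n then 0 else Suc m)" for m
  define Y where "Y = {m. m < n \<and> even (m + i) \<and> m \<notin> {i..j}}"
  have Y: "m < n" "even (m + i)" "m < i \<or> j < m" if "m \<in> Y" for m
    using that unfolding Y_def by auto
  have g_less: "g m < n" if "m < n" for m using that n3 unfolding g_def by auto
  have g_par: "odd (g m + m)" if "m < n" for m
    using that even_n unfolding g_def by (cases "Suc m = n") auto
  have g_A: "A m (g m)" if "m < n" for m
    using A_cycle[OF that] that unfolding g_def by (cases "Suc m = n") auto
  \<comment> \<open>The successor cannot enter the interval at \<open>i\<close>, whose parity is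
    that of \<open>m\<close>. If it wraps around to 0, then \<open>m = n - 1\<close> is odd, so
    \<open>i\<close> is odd and 0 lies below it.\<close>
  have g_out: "g m < i \<or> j < g m" if "m \<in> Y" for m
  proof (cases "Suc m = n")
    case True
    then have "odd m" using even_n by auto
    then have "odd i" using Y(2)[OF that] by simp
    then show ?thesis using True unfolding g_def by (cases i) auto
  next
    case False
    then have "g m = Suc m" unfolding g_def by simp
    moreover have "Suc m \<noteq> i" using Y(2)[OF that] by auto
    ultimately show ?thesis using Y(3)[OF that] by linarith
  qed
  have surj: "v \<in> g ` Y" if v: "v < n" "odd (v + i)" "v < i \<or> j < v" for v
  proof (cases "v = 0")
    case True
    have o: "odd i" using v(2) True by simp
    then have "even j" using assms(3) by simp
    moreover have "odd (n - 1)" using even_n n3 by simp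
    ultimately have "j \<noteq> n - 1" by metis
    then have "j < n - 1" using assms(2) by linarith
    moreover have "even (n - 1 + i)" using o \<open>odd (n - 1)\<close> by simp
    ultimately have "n - 1 \<in> Y" unfolding Y_def using n3 by auto
    moreover have "g (n - 1) = v" using True n3 unfolding g_def by simp
    ultimately show ?thesis by blast
  next
    case False
    then obtain m where m: "v = Suc m" by (cases v) auto
    have "even (m + i)" using v(2) m by simp
    moreover from this have "m \<noteq> j" using assms(3) by (metis add.commute)
    ultimately have "m \<in> Y" unfolding Y_def using v m by auto
    moreover have "g m = v" using m v(1) unfolding g_def by simp
    ultimately show ?thesis by blast
  qed
  show ?thesis
  proof (rule matching_from_bijection)
    show "Y \<subseteq> {..<n}" using Y by blast
    show "{i..j} \<subseteq> {..<n}" using assms by auto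
    show "inj_on g Y" by (rule inj_onI) (use Y(1) in \<open>auto simp: g_def split: if_splits\<close>)
    show "A m (g m)" if "m \<in> Y" for m using g_A Y(1) that by blast
    have "g m \<notin> Y" if "m \<in> Y" for m
    proof
      assume "g m \<in> Y"
      then have "even (g m + i)" "even (m + i)" using Y(2) that by blast+
      then show False using g_par[OF Y(1)[OF that]] by simp
    qed
    then show "Y \<inter> g ` Y = {}" by blast
    show "Y \<union> g ` Y = {..<n} - {i..j}"
    proof
      show "Y \<union> g ` Y \<subseteq> {..<n} - {i..j}"
      proof
        fix v assume "v \<in> Y \<union> g ` Y"
        then have "v < n \<and> (v < i \<or> j < v)" using Y g_less g_out by blast
        then show "v \<in> {..<n} - {i..j}" by auto
      qed
      show "{..<n} - {i..j} \<subseteq> Y \<union> g ` Y"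
      proof
        fix v assume "v \<in> {..<n} - {i..j}"
        then have v: "v < n" "v < i \<or> j < v" by auto
        show "v \<in> Y \<union> g ` Y"
        proof (cases "even (v + i)")
          case True
          then show ?thesis unfolding Y_def using v by auto
        next
          case False
          then show ?thesis using surj v by blast
        qed
      qed
    qed
  qed
qed

text \<open>Every backward edge of the path flips \<open>switch\<close>, so the number of backward
  edges, the length minus the sum, is odd exactly if the end values differ.\<close>

lemma sum_interval_switch:
  assumes "i \<le> j"
  shows "even ((\<Sum>m\<in>{i..<j}. of_bool ((V m, V (Suc m)) \<in> D)) + (j - i) + of_bool (switch i \<noteq> switch j) :: nat)"
  using assms
proof (induction j rule: dec_induct)
  case (step j)
  define S :: nat where "S = (\<Sum>m\<in>{i..<j}. of_bool ((V m, V (Suc m)) \<in> D))"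
  have "(\<Sum>m\<in>{i..<Suc j}. of_bool ((V m, V (Suc m)) \<in> D)) = S + of_bool ((V j, V (Suc j)) \<in> D)"
    "Suc j - i = Suc (j - i)"
    using step.hyps by (simp_all add: S_def Suc_diff_le)
  then show ?case
    using step.IH[folded S_def] by (cases "switch i"; cases "switch j"; cases "(V j, V (Suc j)) \<in> D") simp_all
qed simp

text \<open>Up to switching at vertices, the Pfaffian orientation directs every edge from lower to
  higher index, because the Hamiltonian cycle makes each cycle formed by an interval and a chord
  central.\<close>

lemma switch_orientation_less:
  assumes "i < j" "j < n" "A i j"
  shows "(V i, V j) \<in> D \<longleftrightarrow> switch i = switch j"
proof (cases "j = Suc i")
  case True
  then show ?thesis by simp
next
  case False
  define C where "C = [i..<Suc j]"
  have len: "length C = Suc (j - i)" using assms by (simp add: C_def Suc_diff_le)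
  have nth: "C ! m = i + m" if "m \<le> j - i" for m using that assms by (simp add: C_def nth_append)
  have par: "odd (i + j)" using A_parity assms by simp
  have sm: "Suc m mod length C = (if m = j - i then 0 else Suc m)" if "m < length C" for m
    using that len by simp
  have "odd (\<Sum>m<length C. of_bool ((V (C ! m), V (C ! (Suc m mod length C))) \<in> D) :: nat)"
  proof (rule central_odd)
    show "distinct C" "set C \<subseteq> {..<n}" using assms by (auto simp: C_def)
    \<comment> \<open>\<open>j\<close> differs from \<open>i + 1\<close>, and \<open>i + 2\<close>
      has the wrong parity.\<close>
    show "3 \<le> length C" using False assms par len by (cases "j = Suc (Suc i)") auto
    show "A (C ! m) (C ! (Suc m mod length C))" if m: "m < length C" for m
    proof (cases "m = j - i")
      case True
      then show ?thesis using nth[of m] nth[of 0] sm[OF m] assms A_sym by simp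
    next
      case False
      then show ?thesis using nth[of m] nth[of "Suc m"] sm[OF m] m len assms A_Suc[of "i + m"] by simp
    qed
    have "set C = {i..j}" by (auto simp: C_def)
    then show "\<exists>M. perfect_matching (delete_vertices G (V ` set C)) M"
      using interval_matching assms par by simp
  qed
  moreover have "(\<Sum>m<length C. of_bool ((V (C ! m), V (C ! (Suc m mod length C))) \<in> D) :: nat) =
      (\<Sum>m<j - i. of_bool ((V (i + m), V (Suc (i + m))) \<in> D)) + of_bool ((V j, V i) \<in> D)"
  proof -
    have "(\<Sum>m<j - i. of_bool ((V (C ! m), V (C ! (Suc m mod length C))) \<in> D) :: nat) =
      (\<Sum>m<j - i. of_bool ((V (i + m), V (Suc (i + m))) \<in> D))"
      by (rule sum.cong) (use nth sm len in auto)
    moreover have "C ! (j - i) = j" "C ! (Suc (j - i) mod length C) = i"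
      using nth[of "j - i"] nth[of 0] len assms by auto
    ultimately show ?thesis unfolding len by simp
  qed
  moreover have "(\<Sum>m<j - i. of_bool ((V (i + m), V (Suc (i + m))) \<in> D) :: nat) =
      (\<Sum>m\<in>{i..<j}. of_bool ((V m, V (Suc m)) \<in> D))"
    by (rule sum.reindex_bij_witness[of _ "\<lambda>m. m - i" "\<lambda>m. i + m"]) auto
  moreover note sum_interval_switch[of i j]
  moreover have "odd (j - i)" using par assms by simp
  \<comment> \<open>The length \<open>j - i\<close> is odd, so the path part of the odd total has
    the parity of \<open>1 + of_bool (switch i \<noteq> switch j)\<close>, and the closing arc
    contributes the rest.\<close>
  ultimately have "((V j, V i) \<in> D) = (switch i \<noteq> switch j)"
    using assms(1) by (auto split: if_splits simp: of_bool_def)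
  then show ?thesis using orientation[OF assms(3)] by blast
qed

lemma switch_orientation:
  assumes "i < n" "j < n" "A i j"
  shows "(V i, V j) \<in> D \<longleftrightarrow> (i < j) = (switch i = switch j)"
proof -
  have "i \<noteq> j" using assms A_irrefl by blast
  then consider "i < j" | "j < i" by linarith
  then show ?thesis
  proof cases
    case 1
    then show ?thesis using switch_orientation_less assms by simp
  next
    case 2
    then have "(V j, V i) \<in> D \<longleftrightarrow> switch j = switch i"
      using switch_orientation_less[of j i] assms A_sym by blast
    then show ?thesis using 2 orientation[OF assms(3)] by auto
  qed
qed

end

section \<open>The exchanged 2-factor\<close>

text \<open>For a variable that is conditionally overwritten at each step: its final value comes
  from the last write, if there was one. Which index wrote it is left open.\<close>

lemma last_write:
  assumes "\<And>m. f (Suc m) = (if P (s m) then g (s m) else f m)"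
  shows "(\<exists>i<m. P (s i) \<and> f m = g (s i)) \<or> (\<forall>i<m. \<not> P (s i)) \<and> f m = f 0"
proof (induction m)
  case (Suc m)
  show ?case
  proof (cases "P (s m)")
    case True
    then show ?thesis using assms[of m] by (metis lessI)
  next
    case False
    then have "f (Suc m) = f m" using assms[of m] by simp
    then show ?thesis using Suc False by (metis less_Suc_eq)
  qed
qed simp

context hamiltonian_graph
begin

sublocale chords n A
  by unfold_locales (use exists_chord A_irrefl in auto)

text \<open>The inner black vertices: 0 is left out, and \<open>n - 2\<close> is the last even
  index.\<close>

definition blacks :: "nat set" where
  "blacks = {i. even i \<and> 2 \<le> i \<and> i \<le> n - 2}"

lemma chord_parity: "i < n \<Longrightarrow> odd (i + chord i)"
  using is_chord_chord[of i] A_parity[of i "chord i"] unfolding is_chord_def by blast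

lemma black_less: "i \<in> blacks \<Longrightarrow> i < n"
  using n4 unfolding blacks_def by auto

lemma odd_last: "odd (n - 1)"
  using even_n n3 by simp

lemma odd_chord: "i \<in> blacks \<Longrightarrow> odd (chord i)"
  using chord_parity[OF black_less[of i]] unfolding blacks_def by auto

text \<open>Upwards a chord ends at most at \<open>n - 1\<close>, and \<open>jump\<close> steps down
  to at most \<open>n - 2\<close>; downwards it ends at an odd index, hence at least 1, and
  \<open>jump\<close> steps up to at least 2. So 0 is never reached.\<close>

lemma jump_black:
  assumes "i \<in> blacks"
  shows "jump i \<in> blacks"
proof -
  have i: "i < n" "even i" "2 \<le> i" using assms black_less unfolding blacks_def by auto
  have c: "chord i < n" "odd (chord i)" using chord_less[OF i(1)] odd_chord[OF assms] by auto
  obtain d where d: "chord i = Suc d" using c(2) by (cases "chord i") auto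
  note ne = chord_neq[OF i(1)]
  show ?thesis
  proof (cases "i < chord i")
    case True
    then show ?thesis using i c d ne unfolding jump_def blacks_def by auto
  next
    case False
    have "Suc (chord i) \<le> i" using False ne by auto
    moreover have "i \<le> n - 2" using assms unfolding blacks_def by simp
    ultimately show ?thesis using False c d unfolding jump_def blacks_def by auto
  qed
qed

lemma two_black: "2 \<in> blacks"
  using n4 unfolding blacks_def by auto

lemma jump_funpow_black: "(jump ^^ m) 2 \<in> blacks"
  by (induction m) (use two_black jump_black in auto)

definition orbit :: "nat set" where
  "orbit = (\<lambda>m. (jump ^^ m) start) ` {..<n}"

lemma orbit_eq: "(jump ^^ m) start = (jump ^^ (n + m)) 2"
  unfolding start_def by (metis add.commute comp_apply funpow_add)

lemma orbit_black: "i \<in> orbit \<Longrightarrow> i \<in> blacks"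
  unfolding orbit_def orbit_eq using jump_funpow_black by blast

lemma start_orbit: "start \<in> orbit"
proof -
  have "start = (jump ^^ 0) start" "0 \<in> {..<n}" using n3 by auto
  then show ?thesis unfolding orbit_def by (rule image_eqI)
qed

text \<open>The sequence is periodic from some index below \<open>n\<close> on, with a period of at
  most \<open>n\<close>. Hence the \<open>n\<close> iterates after \<open>start\<close> run through
  complete periods and are mapped onto themselves.\<close>

lemma jump_image_orbit: "jump ` orbit = orbit"
proof -
  define s where "s m = (jump ^^ m) 2" for m
  have "\<not> inj_on s {..n}"
  proof
    assume "inj_on s {..n}"
    moreover have "s ` {..n} \<subseteq> {..<n}" unfolding s_def using jump_funpow_black black_less by blast
    ultimately have "card {..n} \<le> card {..<n}" by (metis card_inj_on_le finite_lessThan)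
    then show False by simp
  qed
  then obtain i j where ij: "i < j" "j \<le> n" "s i = s j"
    unfolding inj_on_def by (metis atMost_iff linorder_neqE_nat)
  define p where "p = j - i"
  have p: "0 < p" "p \<le> n" using ij by (auto simp: p_def)
  have per: "s (m + p) = s m" if im: "i \<le> m" for m
  proof -
    obtain d where d: "m = d + i" using im by (metis le_add_diff_inverse2)
    have mp: "m + p = d + j" using d ij by (simp add: p_def)
    have sh: "s (d + k) = (jump ^^ d) (s k)" for k by (simp add: s_def funpow_add)
    have "s (m + p) = (jump ^^ d) (s j)" unfolding mp by (rule sh)
    moreover have "s m = (jump ^^ d) (s i)" unfolding d by (rule sh)
    ultimately show ?thesis using ij(3) by metis
  qed
  have orbit: "orbit = (\<lambda>m. s (n + m)) ` {..<n}" unfolding orbit_def orbit_eq s_def ..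
  \<comment> \<open>Later iterates are brought back into the window of length \<open>n\<close> by
    subtracting the period.\<close>
  have all: "s (n + m) \<in> orbit" for m
  proof (induction m rule: less_induct)
    case (less m)
    show ?case
    proof (cases "m < n")
      case True
      then show ?thesis unfolding orbit by blast
    next
      case False
      then have "n + m = n + (m - p) + p" using p by simp
      moreover have "s (n + (m - p) + p) = s (n + (m - p))" by (rule per) (use ij in linarith)
      ultimately have "s (n + m) = s (n + (m - p))" by metis
      moreover have "s (n + (m - p)) \<in> orbit" by (rule less) (use False p n3 in linarith)
      ultimately show ?thesis by metis
    qed
  qed
  have js: "jump (s m) = s (Suc m)" for m unfolding s_def by simp
  show ?thesis
  proof
    show "jump ` orbit \<subseteq> orbit"
    proof
      fix v assume "v \<in> jump ` orbit"
      then obtain m where "v = jump (s (n + m))" unfolding orbit by blast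
      then have "v = s (n + Suc m)" using js by simp
      then show "v \<in> orbit" using all by blast
    qed
    show "orbit \<subseteq> jump ` orbit"
    proof
      fix v assume "v \<in> orbit"
      then obtain m where m: "v = s (n + m)" unfolding orbit by blast
      obtain q where q: "p = Suc q" using p(1) by (cases p) auto
      have "s (n + m + p) = s (n + m)" by (rule per) (use ij in linarith)
      moreover have "n + m + p = Suc (n + (m + q))" using q by simp
      ultimately have "v = jump (s (n + (m + q)))" using m js by metis
      then show "v \<in> jump ` orbit" using all by blast
    qed
  qed
qed

text \<open>A map of a finite set onto itself is injective. This is what makes the 2-factor well
  defined: no edge of \<open>H\<close> is given up for two different chords.\<close>

lemma inj_jump: "i \<in> orbit \<Longrightarrow> i' \<in> orbit \<Longrightarrow> jump i = jump i' \<Longrightarrow> i = i'"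
proof -
  have "finite orbit" unfolding orbit_def by simp
  then have "inj_on jump orbit" using jump_image_orbit by (metis eq_card_imp_inj_on)
  then show "i \<in> orbit \<Longrightarrow> i' \<in> orbit \<Longrightarrow> jump i = jump i' \<Longrightarrow> i = i'" by (metis inj_onD)
qed

text \<open>The condition under which \<open>update\<close> at \<open>i\<close> overwrites the lower
  slot of \<open>v\<close>. The case \<open>jump i = v\<close> takes precedence because
  \<open>update\<close> handles it last; on the orbit it excludes \<open>chord i = v\<close> by
  parity.\<close>

definition sets_lower :: "nat \<Rightarrow> nat \<Rightarrow> bool" where
  "sets_lower v i \<longleftrightarrow> (if jump i = v \<and> \<not> i < v then True else chord i = v \<and> i < v)"

definition sets_upper :: "nat \<Rightarrow> nat \<Rightarrow> bool" where
  "sets_upper v i \<longleftrightarrow> (if jump i = v \<and> i < v then True else chord i = v \<and> \<not> i < v)"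

lemma fst_update: "fst (update v i lh) =
    (if sets_lower v i then if jump i = v \<and> \<not> i < v then chord v else i else fst lh)"
  unfolding update_def sets_lower_def by (cases lh) auto

lemma snd_update: "snd (update v i lh) =
    (if sets_upper v i then if jump i = v \<and> i < v then chord v else i else snd lh)"
  unfolding update_def sets_upper_def by (cases lh) auto

text \<open>Some orbit vertex determines the value unless none applies; parity and
  \<open>inj_jump\<close> identify that vertex afterwards.\<close>

lemma lower_cases:
  "(\<exists>i\<in>orbit. sets_lower v i \<and> lower v = (if jump i = v \<and> \<not> i < v then chord v else i)) \<or>
   (\<forall>i\<in>orbit. \<not> sets_lower v i) \<and> lower v = (if v = 0 then n - 1 else v - 1)"
proof -
  let ?s = "\<lambda>m. (jump ^^ m) start"
  let ?g = "\<lambda>i. if jump i = v \<and> \<not> i < v then chord v else i"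
  have "fst (scan_cycle v (Suc m)) = (if sets_lower v (?s m) then ?g (?s m) else fst (scan_cycle v m))" for m
    unfolding scan_cycle.simps fst_update ..
  from last_write[of "\<lambda>m. fst (scan_cycle v m)" "sets_lower v" ?s ?g n, OF this]
  show ?thesis unfolding lower_def orbit_def scan_cycle.simps(1) fst_conv snd_conv by blast
qed

lemma upper_cases:
  "(\<exists>i\<in>orbit. sets_upper v i \<and> upper v = (if jump i = v \<and> i < v then chord v else i)) \<or>
   (\<forall>i\<in>orbit. \<not> sets_upper v i) \<and> upper v = (if Suc v = n then 0 else Suc v)"
proof -
  let ?s = "\<lambda>m. (jump ^^ m) start"
  let ?g = "\<lambda>i. if jump i = v \<and> i < v then chord v else i"
  have "snd (scan_cycle v (Suc m)) = (if sets_upper v (?s m) then ?g (?s m) else snd (scan_cycle v m))" for m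
    unfolding scan_cycle.simps snd_update ..
  from last_write[of "\<lambda>m. snd (scan_cycle v m)" "sets_upper v" ?s ?g n, OF this]
  show ?thesis unfolding upper_def orbit_def scan_cycle.simps(1) fst_conv snd_conv by blast
qed

lemma orbit_facts:
  assumes "i \<in> orbit"
  shows "even i" "2 \<le> i" "Suc i < n" "odd (chord i)" "even (jump i)" "chord i < n" "jump i \<noteq> i"
    "i < chord i \<Longrightarrow> chord i = Suc (jump i)" "\<not> i < chord i \<Longrightarrow> jump i = Suc (chord i)"
    "i < chord i \<longleftrightarrow> i < jump i" "chord i \<noteq> i" "chord i \<noteq> Suc i" "Suc (chord i) \<noteq> i"
proof -
  note b = orbit_black[OF assms]
  show "even i" "2 \<le> i" "Suc i < n" using b n4 unfolding blacks_def by auto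
  show "odd (chord i)" using odd_chord[OF b] .
  show "even (jump i)" using jump_black[OF b] unfolding blacks_def by simp
  have i: "i < n" using black_less[OF b] .
  show "chord i < n" using chord_less[OF i] .
  show "chord i \<noteq> i" "chord i \<noteq> Suc i" "Suc (chord i) \<noteq> i" using chord_neq[OF i] by auto
  then show "i < chord i \<Longrightarrow> chord i = Suc (jump i)" "\<not> i < chord i \<Longrightarrow> jump i = Suc (chord i)"
    "i < chord i \<longleftrightarrow> i < jump i" "jump i \<noteq> i"
    unfolding jump_def by auto
qed

text \<open>The edges of the second cycle, between a white (odd) index and a black (even) one: the
  edges of the Hamiltonian cycle alternate with the chords along the orbit \<open>orbit\<close>, and are exchanged.\<close>

definition factor :: "nat \<Rightarrow> nat \<Rightarrow> bool" where
  "factor w b \<longleftrightarrow> odd w \<and> even b \<and> w < n \<and> b < n \<and>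
     (b \<in> orbit \<and> w = chord b \<or>
      (w = Suc b \<or> b = Suc w \<or> w = n - 1 \<and> b = 0) \<and> (\<forall>i\<in>orbit. chord i = w \<longrightarrow> jump i \<noteq> b))"

text \<open>Orbit vertices below \<open>w\<close> whose chord ends at \<open>w\<close> all jump to
  \<open>w - 1\<close>, so by \<open>inj_jump\<close> there is at most one. The clause on
  \<open>n - 1\<close> and 0 is due to the numbering: 0 lies below the last vertex but fills its
  upper slot.\<close>

lemma lower_white:
  assumes "odd w" "w < n"
  shows "b = lower w \<longleftrightarrow> factor w b \<and> b < w \<and> \<not> (w = n - 1 \<and> b = 0)"
proof -
  have sl: "sets_lower w i \<longleftrightarrow> chord i = w \<and> i < w" if "i \<in> orbit" for i
    using orbit_facts(5)[OF that] assms unfolding sets_lower_def by auto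
  have jw: "jump i \<noteq> w" if "i \<in> orbit" for i using orbit_facts(5)[OF that] assms by auto
  consider i where "i \<in> orbit" "chord i = w" "i < w" "lower w = i"
    | "\<forall>i\<in>orbit. \<not> (chord i = w \<and> i < w)" "lower w = w - 1"
    using lower_cases[of w] sl jw assms(1) by (metis even_zero)
  then show ?thesis
  proof cases
    case 1
    have j: "w = Suc (jump i)" using orbit_facts(8)[OF 1(1)] 1 by simp
    show ?thesis
    proof
      assume "b = lower w"
      then show "factor w b \<and> b < w \<and> \<not> (w = n - 1 \<and> b = 0)"
        using 1 orbit_facts[OF 1(1)] assms unfolding factor_def by auto
    next
      assume f: "factor w b \<and> b < w \<and> \<not> (w = n - 1 \<and> b = 0)"
      show "b = lower w"
      proof (cases "b \<in> orbit \<and> w = chord b")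
        case True
        then have "jump b = jump i" using orbit_facts(8)[of b] f j by auto
        then show ?thesis using inj_jump True 1 by blast
      next
        case False
        then have "w = Suc b" "\<forall>i\<in>orbit. chord i = w \<longrightarrow> jump i \<noteq> b" using f unfolding factor_def by auto
        then show ?thesis using 1 j by auto
      qed
    qed
  next
    case 2
    obtain v where v: "w = Suc v" using assms(1) by (cases w) auto
    have nr: "jump i \<noteq> v" if "i \<in> orbit" "chord i = w" for i
    proof
      assume "jump i = v"
      then have "i < chord i" using orbit_facts(9)[OF that(1)] that v by fastforce
      then show False using 2 that by auto
    qed
    have v0: "\<not> (w = n - 1 \<and> v = 0)" using v n4 by auto
    show ?thesis
    proof
      assume "b = lower w"
      then show "factor w b \<and> b < w \<and> \<not> (w = n - 1 \<and> b = 0)"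
        using 2 v v0 nr assms unfolding factor_def by auto
    next
      assume f: "factor w b \<and> b < w \<and> \<not> (w = n - 1 \<and> b = 0)"
      then have "w = Suc b" using 2 unfolding factor_def by auto
      then show "b = lower w" using 2 by simp
    qed
  qed
qed

text \<open>Mirror image of \<open>lower_white\<close>. No orbit vertex lies above
  \<open>n - 1\<close>, so the upper slot of the last vertex keeps 0.\<close>

lemma upper_white:
  assumes "odd w" "w < n"
  shows "b = upper w \<longleftrightarrow> factor w b \<and> \<not> (b < w \<and> \<not> (w = n - 1 \<and> b = 0))"
proof -
  have sl: "sets_upper w i \<longleftrightarrow> chord i = w \<and> w < i" if "i \<in> orbit" for i
    using orbit_facts(5,11)[OF that] assms unfolding sets_upper_def by auto
  have jw: "jump i \<noteq> w" if "i \<in> orbit" for i using orbit_facts(5)[OF that] assms by auto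
  have no: "\<not> w < i" if "w = n - 1" "i \<in> orbit" for i using orbit_facts(3)[OF that(2)] that(1) by simp
  consider i where "i \<in> orbit" "chord i = w" "w < i" "upper w = i"
    | "\<forall>i\<in>orbit. \<not> (chord i = w \<and> w < i)" "upper w = (if Suc w = n then 0 else Suc w)"
    using upper_cases[of w] sl jw by metis
  then show ?thesis
  proof cases
    case 1
    have j: "jump i = Suc w" using orbit_facts(9)[OF 1(1)] 1 by simp
    have wn: "w \<noteq> n - 1" using no 1 by blast
    show ?thesis
    proof
      assume "b = upper w"
      then show "factor w b \<and> \<not> (b < w \<and> \<not> (w = n - 1 \<and> b = 0))"
        using 1 orbit_facts[OF 1(1)] assms wn unfolding factor_def by auto
    next
      assume f: "factor w b \<and> \<not> (b < w \<and> \<not> (w = n - 1 \<and> b = 0))"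
      show "b = upper w"
      proof (cases "b \<in> orbit \<and> w = chord b")
        case True
        then have "jump b = jump i" using orbit_facts(9)[of b] f j wn by auto
        then show ?thesis using inj_jump True 1 by blast
      next
        case False
        then have "b = Suc w" "\<forall>i\<in>orbit. chord i = w \<longrightarrow> jump i \<noteq> b" using f wn unfolding factor_def by auto
        then show ?thesis using 1 j by auto
      qed
    qed
  next
    case 2
    have nr: "jump i \<noteq> Suc w" if "i \<in> orbit" "chord i = w" for i
    proof
      assume "jump i = Suc w"
      then have "\<not> i < chord i" using orbit_facts(8)[OF that(1)] that by fastforce
      then show False using 2 that orbit_facts(11)[OF that(1)] by auto
    qed
    have nz: "jump i \<noteq> 0" if "i \<in> orbit" for i
      using jump_black[OF orbit_black[OF that]] unfolding blacks_def by auto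
    show ?thesis
    proof (cases "Suc w = n")
      case True
      show ?thesis
      proof
        assume "b = upper w"
        then show "factor w b \<and> \<not> (b < w \<and> \<not> (w = n - 1 \<and> b = 0))"
          using 2 True nz assms unfolding factor_def by auto
      next
        assume f: "factor w b \<and> \<not> (b < w \<and> \<not> (w = n - 1 \<and> b = 0))"
        have "b \<noteq> w" using f unfolding factor_def by auto
        then have "b = 0" using f True unfolding factor_def by auto
        then show "b = upper w" using 2 True by simp
      qed
    next
      case False
      have sn: "Suc w < n" using False assms by simp
      show ?thesis
      proof
        assume "b = upper w"
        then show "factor w b \<and> \<not> (b < w \<and> \<not> (w = n - 1 \<and> b = 0))"
          using 2 False sn nr assms unfolding factor_def by auto
      next
        assume f: "factor w b \<and> \<not> (b < w \<and> \<not> (w = n - 1 \<and> b = 0))"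
        have "w < b" using f False unfolding factor_def by (metis Suc_pred' diff_Suc_1 linorder_neqE_nat n3 not_numeral_le_zero zero_less_iff_neq_zero)
        then have "b = Suc w" using f 2(1) False unfolding factor_def by auto
        then show "b = upper w" using 2 False by simp
      qed
    qed
  qed
qed

lemma factor_black_default:
  assumes "even b" "b < n" "b \<notin> orbit"
  shows "{lower b, upper b} = {w. factor w b}" "lower b \<noteq> upper b"
    "lower b = (if b = 0 then n - 1 else b - 1)" "upper b = Suc b"
proof -
  have nj: "jump i \<noteq> b" if "i \<in> orbit" for i using jump_image_orbit assms(3) that by blast
  have nc: "chord i \<noteq> b" if "i \<in> orbit" for i using orbit_facts(4)[OF that] assms(1) by auto
  have "b \<noteq> n - 1" using odd_last assms(1) by metis
  then have sn: "Suc b < n" using assms(2) by linarith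
  have sl: "\<not> sets_lower b i" "\<not> sets_upper b i" if "i \<in> orbit" for i
    using nj[OF that] nc[OF that] unfolding sets_lower_def sets_upper_def by simp_all
  show lo: "lower b = (if b = 0 then n - 1 else b - 1)"
    using lower_cases[of b] sl(1) by blast
  have "upper b = (if Suc b = n then 0 else Suc b)"
    using upper_cases[of b] sl(2) by blast
  then show up: "upper b = Suc b" using sn by simp
  show "lower b \<noteq> upper b" unfolding lo up using n4 by auto
  have fac: "factor w b \<longleftrightarrow> odd w \<and> w < n \<and> (w = Suc b \<or> b = Suc w \<or> w = n - 1 \<and> b = 0)" for w
    unfolding factor_def using assms nj by blast
  show "{lower b, upper b} = {w. factor w b}"
  proof (cases b)
    case 0
    then have "lower b = n - 1" "upper b = 1" using lo up by simp_all
    moreover have "factor w b \<longleftrightarrow> w = n - 1 \<or> w = 1" for w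
      using fac[of w] odd_last n3 0 by auto
    ultimately show ?thesis by auto
  next
    case (Suc d)
    then have "lower b = d" "upper b = Suc b" using lo up by simp_all
    moreover have "factor w b \<longleftrightarrow> w = d \<or> w = Suc b" for w
      unfolding fac using sn assms(1) Suc by auto
    ultimately show ?thesis by auto
  qed
qed

text \<open>Exactly one orbit vertex \<open>i\<close> jumps to \<open>b\<close>. The edge to
  \<open>chord i\<close> is given up for the chord at \<open>b\<close>, which differs from the edge
  of \<open>H\<close> that is kept because chords avoid \<open>b - 1\<close> and
  \<open>b + 1\<close>.\<close>

lemma factor_black_orbit:
  assumes "b \<in> orbit"
  shows "{lower b, upper b} = {w. factor w b}" "lower b \<noteq> upper b"
proof -
  obtain i where i: "i \<in> orbit" "jump i = b" using assms jump_image_orbit by (metis imageE)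
  have un: "i' = i" if "i' \<in> orbit" "jump i' = b" for i' using inj_jump[OF that(1) i(1)] that(2) i(2) by simp
  have nc: "chord i' \<noteq> b" if "i' \<in> orbit" for i' using orbit_facts(4)[OF that] orbit_facts(1)[OF assms] by auto
  note bf = orbit_facts[OF assms] and fi = orbit_facts[OF i(1)]
  have sl: "sets_lower b i' \<longleftrightarrow> i' = i \<and> b < i" if "i' \<in> orbit" for i'
    using un[OF that] nc[OF that] i(2) fi(7) unfolding sets_lower_def by (cases "i' = i") auto
  have su: "sets_upper b i' \<longleftrightarrow> i' = i \<and> i < b" if "i' \<in> orbit" for i'
    using un[OF that] nc[OF that] i(2) fi(7) unfolding sets_upper_def by (cases "i' = i") auto
  have q: "(\<forall>i'\<in>orbit. chord i' = w \<longrightarrow> jump i' \<noteq> b) \<longleftrightarrow> chord i \<noteq> w" for w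
    using un i by blast
  have bn: "b < n" "b \<noteq> 0" using bf(2,3) by auto
  have fac: "factor w b \<longleftrightarrow> w = chord b \<or> odd w \<and> w < n \<and> (w = Suc b \<or> b = Suc w) \<and> chord i \<noteq> w" for w
    unfolding factor_def q using assms bf(1,4,6) bn by (cases "w = chord b") simp_all
  show "{lower b, upper b} = {w. factor w b}" "lower b \<noteq> upper b"
  proof -
    consider "i < b" | "b < i" using fi(7) i(2) by (metis linorder_neqE_nat)
    then have "{lower b, upper b} = {w. factor w b} \<and> lower b \<noteq> upper b"
    proof cases
      case 1
      have "\<not> sets_lower b i'" if "i' \<in> orbit" for i' using sl[OF that] 1 by simp
      then have "lower b = (if b = 0 then n - 1 else b - 1)" using lower_cases[of b] by blast
      then have lo: "lower b = b - 1" using bf(2) by simp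
      have "sets_upper b i" using su[OF i(1)] 1 by simp
      then obtain i' where "i' \<in> orbit" "sets_upper b i'"
        "upper b = (if jump i' = b \<and> i' < b then chord b else i')"
        using upper_cases[of b] i(1) by blast
      moreover from this have "i' = i" using su by blast
      ultimately have "upper b = (if jump i = b \<and> i < b then chord b else i)" by metis
      then have up: "upper b = chord b" using i(2) 1 by simp
      \<comment> \<open>The jump came from below, so \<open>chord i\<close> is the successor of
        \<open>b\<close>, and the edge kept is the one to \<open>b - 1\<close>.\<close>
      have "i < chord i" unfolding fi(10) using 1 i(2) by simp
      from fi(8)[OF this] have ci: "chord i = Suc b" unfolding i(2) .
      obtain d where d: "b = Suc d" using bn(2) by (cases b) auto
      have "factor w b \<longleftrightarrow> w = d \<or> w = chord b" for w
      proof -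
        have "b = Suc w \<longleftrightarrow> w = d" "d < n" "odd d" "chord i \<noteq> d" using d bn(1) bf(1) ci by auto
        moreover have "chord i = w" if "w = Suc b" using that ci by simp
        ultimately show ?thesis using fac[of w] by blast
      qed
      moreover have "b - 1 = d" using d by simp
      ultimately have "{b - 1, chord b} = {w. factor w b}" by blast
      moreover have "b - 1 \<noteq> chord b" using bf(2) bf(13) by linarith
      ultimately show ?thesis unfolding lo up by (rule conjI)
    next
      case 2
      have "sets_lower b i" using sl[OF i(1)] 2 by simp
      then obtain i' where "i' \<in> orbit" "sets_lower b i'"
        "lower b = (if jump i' = b \<and> \<not> i' < b then chord b else i')"
        using lower_cases[of b] i(1) by blast
      moreover from this have "i' = i" using sl by blast
      ultimately have "lower b = (if jump i = b \<and> \<not> i < b then chord b else i)" by metis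
      then have lo: "lower b = chord b" using i(2) 2 by simp
      have "\<not> sets_upper b i'" if "i' \<in> orbit" for i' using su[OF that] 2 by simp
      then have "upper b = (if Suc b = n then 0 else Suc b)" using upper_cases[of b] by blast
      then have up: "upper b = Suc b" using bf(3) by simp
      have "\<not> i < chord i" unfolding fi(10) using 2 i(2) by simp
      from fi(9)[OF this] have ci: "b = Suc (chord i)" unfolding i(2) .
      have "factor w b \<longleftrightarrow> w = chord b \<or> w = Suc b" for w
      proof -
        have 1: "odd (Suc b)" using bf(1) by simp
        have 2: "chord i \<noteq> Suc b" using ci by linarith
        have 3: "chord i = w" if "b = Suc w" using that ci by linarith
        show ?thesis
        proof (cases "w = Suc b")
          case True
          then show ?thesis unfolding fac True using 1 2 bf(3) by metis
        next
          case False
          then show ?thesis unfolding fac using 3 by metis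
        qed
      qed
      then have "{chord b, Suc b} = {w. factor w b}" by auto
      moreover have "chord b \<noteq> Suc b" by (rule bf(12))
      ultimately show ?thesis unfolding lo up by (rule conjI)
    qed
    then show "{lower b, upper b} = {w. factor w b}" "lower b \<noteq> upper b" by blast+
  qed
qed

lemma factor_black:
  assumes "even b" "b < n"
  shows "{lower b, upper b} = {w. factor w b}" "lower b \<noteq> upper b"
proof -
  show "{lower b, upper b} = {w. factor w b}"
  proof (cases "b \<in> orbit")
    case True
    then show ?thesis by (rule factor_black_orbit(1))
  next
    case False
    with assms show ?thesis by (rule factor_black_default(1))
  qed
  show "lower b \<noteq> upper b"
  proof (cases "b \<in> orbit")
    case True
    then show ?thesis by (rule factor_black_orbit(2))
  next
    case False
    with assms show ?thesis by (rule factor_black_default(2))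
  qed
qed

end

section \<open>The 2-factor is a single cycle\<close>

context hamiltonian_graph
begin

lemma factor_white:
  assumes "odd w" "w < n"
  shows "{lower w, upper w} = {b. factor w b}" "lower w \<noteq> upper w"
proof -
  have l: "lower w < w \<and> \<not> (w = n - 1 \<and> lower w = 0)"
    using lower_white[OF assms, of "lower w"] by blast
  have u: "\<not> (upper w < w \<and> \<not> (w = n - 1 \<and> upper w = 0))"
    using upper_white[OF assms, of "upper w"] by blast
  show "{lower w, upper w} = {b. factor w b}"
  proof (rule set_eqI)
    fix b
    have "b = lower w \<or> b = upper w \<longleftrightarrow> factor w b"
      unfolding lower_white[OF assms, of b] upper_white[OF assms, of b] by blast
    then show "b \<in> {lower w, upper w} \<longleftrightarrow> b \<in> {b. factor w b}" by simp
  qed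
  show "lower w \<noteq> upper w"
  proof
    assume e: "lower w = upper w"
    show False using l u unfolding e by blast
  qed
qed

lemma white_between:
  assumes "odd w" "w < n" "w \<noteq> n - 1"
  shows "lower w < w" "w < upper w"
proof -
  show "lower w < w" using lower_white[OF assms(1,2), of "lower w"] by blast
  have "\<not> upper w < w" "factor w (upper w)"
    using upper_white[OF assms(1,2), of "upper w"] assms(3) by blast+
  moreover from this have "upper w \<noteq> w" unfolding factor_def by metis
  ultimately show "w < upper w" by linarith
qed

lemma nbrs_factor:
  assumes "v < n"
  shows "{lower v, upper v} = {u. factor v u \<or> factor u v}" "lower v \<noteq> upper v"
proof -
  show "{lower v, upper v} = {u. factor v u \<or> factor u v}"
  proof (cases "even v")
    case True
    then have "\<not> factor v u" for u unfolding factor_def by simp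
    then show ?thesis using factor_black(1)[OF True assms] by simp
  next
    case False
    then have "\<not> factor u v" for u unfolding factor_def by simp
    then show ?thesis using factor_white(1)[OF False assms] by simp
  qed
  show "lower v \<noteq> upper v" using factor_black(2) factor_white(2) assms by blast
qed

sublocale two_regular n lower upper
proof
  fix v u assume v: "v < n"
  show "lower v \<noteq> upper v" using nbrs_factor(2)[OF v] .
  assume u: "u \<in> {lower v, upper v}"
  then have f: "factor v u \<or> factor u v" unfolding nbrs_factor(1)[OF v] by blast
  then show u_less: "u < n" unfolding factor_def by auto
  show "v \<in> {lower u, upper u}" unfolding nbrs_factor(1)[OF u_less] using f by blast
  show "odd (u + v)" using f unfolding factor_def by auto
qed

lemma factor_A:
  assumes f: "factor w b"
  shows "A w b"
proof -
  have wb: "w < n" "b < n" using f unfolding factor_def by simp_all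
  consider "b \<in> orbit" "w = chord b" | "w = Suc b" | "b = Suc w" | "w = n - 1" "b = 0"
    using f unfolding factor_def by blast
  then show ?thesis
  proof cases
    case 1
    have "is_chord b (chord b)" by (rule is_chord_chord[OF wb(2)])
    then have "A b w" unfolding is_chord_def 1(2) by simp
    then show ?thesis by (rule A_sym[THEN iffD1])
  next
    case 2
    have "A b w" using A_Suc[of b] wb(1) unfolding 2 by simp
    then show ?thesis by (rule A_sym[THEN iffD1])
  next
    case 3
    then show ?thesis using A_Suc[of w] wb(2) by simp
  next
    case 4
    have "Suc (n - 1) mod n = 0" "n - 1 < n" using n3 by simp_all
    then show ?thesis using A_cycle[of "n - 1"] unfolding 4 by simp
  qed
qed

lemma nbr_A:
  assumes "v < n" "u \<in> {lower v, upper v}"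
  shows "A v u"
proof -
  have "factor v u \<or> factor u v" using assms(2) unfolding nbrs_factor(1)[OF assms(1)] by simp
  then show ?thesis using factor_A[of v u] factor_A[of u v] A_sym[of u v] by argo
qed

text \<open>The orbit consists of inner vertices, so both edges of \<open>H\<close> at 0 survive;
  one of them is \<open>e\<close>.\<close>

lemma zero_nbrs: "lower 0 = n - 1" "upper 0 = 1"
proof -
  have "0 \<notin> orbit" using orbit_facts(2)[of 0] by auto
  moreover have "even (0 :: nat)" "0 < n" using n3 by simp_all
  ultimately have "lower 0 = (if (0 :: nat) = 0 then n - 1 else 0 - 1)" "upper 0 = Suc 0"
    using factor_black_default(3,4)[of 0] by simp_all
  then show "lower 0 = n - 1" "upper 0 = 1" by simp_all
qed

lemma start_walk: "n - 1 \<in> {lower 0, upper 0}"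
  using zero_nbrs by simp

lemma walk_trace: "walk m = trace (n - 1) 0 m"
proof -
  have "advance_walk = other" by (rule ext) (simp add: advance_walk_def other_def)
  then show ?thesis unfolding walk_def trace_def by simp
qed

text \<open>A telescoping argument modulo 2: a pair has odd sum exactly when \<open>g\<close>
  changes, and over the whole range \<open>g\<close> returns to its initial value.\<close>

lemma even_sum_pairs:
  fixes f :: "nat \<Rightarrow> nat"
  assumes "\<And>i. i < q \<Longrightarrow> even (f (2 * i) + f (2 * i + 1) + of_bool (g i \<noteq> g (Suc i)))" "g 0 = (g q :: bool)"
  shows "even (\<Sum>m<2 * q. f m)"
proof -
  have "i \<le> q \<Longrightarrow> even (\<Sum>m<2 * i. f m) \<longleftrightarrow> g 0 = g i" for i
  proof (induction i)
    case (Suc i)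
    have "(\<Sum>m<2 * Suc i. f m) = (\<Sum>m<2 * i. f m) + (f (2 * i) + f (2 * i + 1))" by simp
    moreover have "even (f (2 * i) + f (2 * i + 1)) \<longleftrightarrow> g i = g (Suc i)"
      using assms(1)[of i] Suc.prems by auto
    moreover have "even (\<Sum>m<2 * i. f m) \<longleftrightarrow> g 0 = g i" using Suc by simp
    ultimately show ?case by (auto simp: even_add)
  qed simp
  then show ?thesis using assms(2) by blast
qed

text \<open>Off the last vertex every white vertex of the 2-factor lies between its two neighbours, so a
  cycle avoiding the last vertex would have an even number of arcs in the Pfaffian orientation,
  although it is central.\<close>

lemma trace_not_avoiding:
  assumes b: "b < n" "even b" and avoid: "\<And>m. trace (lower b) b m \<noteq> n - 1"
  shows False
proof -
  let ?w = "trace (lower b) b"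
  have lb: "lower b \<in> {lower b, upper b}" by simp
  obtain j where j: "3 \<le> j" "even j" "inj_on ?w {..<j}" "closed (?w ` {..<j})"
      "\<forall>m<j. {lower (?w m), upper (?w m)} = {?w (if m = 0 then j - 1 else m - 1), ?w (Suc m mod j)}"
    using cycle_through[OF b(1) lb] by blast
  define C where "C = map ?w [0..<j]"
  have nth: "C ! m = ?w m" if "m < j" for m
    using that by (simp add: C_def)
  have lenC: "length C = j" by (simp add: C_def)
  have mj: "Suc m mod j < j" for m using j(1) by simp
  have wn: "?w m < n" for m by (rule trace_less[OF b(1) lb])
  have setC: "set C = ?w ` {..<j}" unfolding C_def by (simp add: atLeast0LessThan)
  have Cn: "set C \<subseteq> {..<n}" unfolding setC using wn by blast
  have "closed ({..<n} - set C)" unfolding setC by (rule closed_Diff[OF order_refl closed_all j(4)])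
  then obtain g where g: "bij_betw g {v \<in> {..<n} - set C. even v} {v \<in> {..<n} - set C. odd v}"
    "\<forall>v\<in>{..<n} - set C. g v \<in> {lower v, upper v} \<or> odd v"
    using closed_matching[of "{..<n} - set C"] by blast
  let ?Y = "{v \<in> {..<n} - set C. even v}"
  have gY: "g ` ?Y = {v \<in> {..<n} - set C. odd v}" using g(1) by (rule bij_betw_imp_surj_on)
  have pm: "\<exists>M. perfect_matching (delete_vertices G (V ` set C)) M"
  proof (rule matching_from_bijection)
    show "?Y \<subseteq> {..<n}" by blast
    show "set C \<subseteq> {..<n}" by (rule Cn)
    show "inj_on g ?Y" using g(1) by (rule bij_betw_imp_inj_on)
    show "?Y \<inter> g ` ?Y = {}" unfolding gY by blast
    show "?Y \<union> g ` ?Y = {..<n} - set C" unfolding gY by blast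
    show "A m (g m)" if "m \<in> ?Y" for m
    proof -
      have "m < n" "g m \<in> {lower m, upper m}" using that g(2) by blast+
      then show ?thesis by (rule nbr_A)
    qed
  qed
  have nbr: "A (C ! m) (C ! (Suc m mod length C))" if "m < length C" for m
  proof -
    have mj': "m < j" using that lenC by simp
    have "?w (Suc m mod j) \<in> {lower (?w m), upper (?w m)}" using j(5) mj' by blast
    then have "A (?w m) (?w (Suc m mod j))" using nbr_A wn by blast
    then show ?thesis unfolding lenC nth[OF mj'] nth[OF mj] .
  qed
  have "odd (\<Sum>m<length C. of_bool ((V (C ! m), V (C ! (Suc m mod length C))) \<in> D) :: nat)"
  proof (rule central_odd)
    show "distinct C" unfolding C_def distinct_map using j(3) by (simp add: atLeast0LessThan)
    show "3 \<le> length C" unfolding lenC by (rule j(1))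
  qed (use Cn nbr pm in blast)+
  moreover
  define f :: "nat \<Rightarrow> nat" where "f m = of_bool ((V (?w m), V (?w (Suc m mod j))) \<in> D)" for m
  have "(\<Sum>m<length C. of_bool ((V (C ! m), V (C ! (Suc m mod length C))) \<in> D) :: nat) = (\<Sum>m<j. f m)"
    unfolding lenC f_def by (rule sum.cong) (use nth mj in simp_all)
  moreover obtain q where q: "j = 2 * q" using j(2) by blast
  have "even (\<Sum>m<2 * q. f m)"
  proof (rule even_sum_pairs)
    \<comment> \<open>The arcs are paired at the white vertices, which have odd positions. The
      switch value of a white vertex cancels within its pair, and those of the black ends telescope
      around the cycle.\<close>
    let ?g = "\<lambda>i. switch (?w (2 * i mod j))"
    show "?g 0 = ?g q" using q by simp
    fix i assume i: "i < q"
    let ?b = "?w (2 * i)" and ?v = "?w (2 * i + 1)" and ?c = "?w (Suc (2 * i + 1) mod j)"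
    have ij: "2 * i < j" "2 * i + 1 < j" using i q by simp_all
    have "even (?v + b + (2 * i + 1))" by (rule trace_parity[OF b(1) lb])
    then have v: "odd ?v" "?v < n" "?v \<noteq> n - 1" using b(2) wn avoid by auto
    have nbv: "{lower ?v, upper ?v} = {?b, ?c}"
      using j(5)[rule_format, OF ij(2)] by simp
    \<comment> \<open>\<open>?v\<close> lies between its neighbours, so the walk passes it either
      upwards or downwards in both arcs.\<close>
    have bc: "?b < ?v \<longleftrightarrow> ?v < ?c"
    proof -
      have "lower ?v \<in> {?b, ?c}" "upper ?v \<in> {?b, ?c}" unfolding nbv[symmetric] by simp_all
      moreover have "lower ?v \<noteq> upper ?v" "?b \<in> {lower ?v, upper ?v}" "?c \<in> {lower ?v, upper ?v}"
        using nbr_distinct[OF v(2)] unfolding nbv by simp_all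
      ultimately have "(?b = lower ?v \<and> ?c = upper ?v) \<or> (?b = upper ?v \<and> ?c = lower ?v)"
        by (metis empty_iff insert_iff)
      then show ?thesis using white_between[OF v] by (metis order_less_asym)
    qed
    have "A ?v ?b" "A ?v ?c" using nbr_A[OF v(2)] unfolding nbv by blast+
    then have "A ?b ?v" "A ?v ?c" using A_sym by blast+
    then have o: "(V ?b, V ?v) \<in> D \<longleftrightarrow> (?b < ?v) = (switch ?b = switch ?v)"
      "(V ?v, V ?c) \<in> D \<longleftrightarrow> (?v < ?c) = (switch ?v = switch ?c)"
      using switch_orientation wn by blast+
    have f: "f (2 * i) = of_bool ((V ?b, V ?v) \<in> D)" "f (2 * i + 1) = of_bool ((V ?v, V ?c) \<in> D)"
      using ij by (simp_all add: f_def)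
    have gi: "?g i = switch ?b" "?g (Suc i) = switch ?c" using ij by simp_all
    show "even (f (2 * i) + f (2 * i + 1) + of_bool (?g i \<noteq> ?g (Suc i)))"
      unfolding f gi o bc by (cases "?v < ?c"; cases "switch ?b"; cases "switch ?v"; cases "switch ?c") simp_all
  qed
  ultimately show False using q by simp
qed

text \<open>The cycle traced from 0 contains \<open>n - 1\<close>. A vertex off this cycle would lie
  in a component that avoids \<open>n - 1\<close>, which \<open>trace_not_avoiding\<close>
  excludes.\<close>

lemma walk_closed_cycle:
  obtains "inj_on walk {..<n}" "walk ` {..<n} = {..<n}" "walk (n - 1) = n - 1"
    "\<And>m. m < n \<Longrightarrow> {lower (walk m), upper (walk m)} = {walk (if m = 0 then n - 1 else m - 1), walk (Suc m mod n)}"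
proof -
  have n0: "0 < n" using n3 by simp
  obtain j where j: "3 \<le> j" "even j" "inj_on walk {..<j}" "walk (j - 1) = n - 1" "closed (walk ` {..<j})"
      "\<forall>m<j. {lower (walk m), upper (walk m)} = {walk (if m = 0 then j - 1 else m - 1), walk (Suc m mod j)}"
    using cycle_through[OF n0 start_walk, folded walk_trace[abs_def]] unfolding walk_trace by blast
  have wn: "walk m < n" for m unfolding walk_trace by (rule trace_less[OF n0 start_walk])
  let ?S = "walk ` {..<j}"
  have Sn: "?S \<subseteq> {..<n}" using wn by blast
  have "?S = {..<n}"
  proof (rule ccontr)
    assume "?S \<noteq> {..<n}"
    then obtain v where v: "v < n" "v \<notin> ?S" using Sn by auto
    have X: "closed ({..<n} - ?S)" by (rule closed_Diff[OF order_refl closed_all j(5)])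
    \<comment> \<open>\<open>trace_not_avoiding\<close> wants an even vertex; a neighbour serves if
      \<open>v\<close> is odd.\<close>
    define b where "b = (if even v then v else lower v)"
    have "v \<in> {..<n} - ?S" using v by simp
    moreover from this have "lower v \<in> {..<n} - ?S" using X unfolding closed_def by blast
    ultimately have b: "b \<in> {..<n} - ?S" unfolding b_def by simp
    have "odd (lower v + v)" using nbr_parity[OF v(1)] by blast
    then have be: "even b" unfolding b_def by simp
    have bn: "b < n" using b by simp
    have "j - 1 \<in> {..<j}" using j(1) by simp
    then have last: "n - 1 \<in> ?S" using j(4) by (metis image_eqI)
    have "trace (lower b) b m \<in> {..<n} - ?S" for m
      by (rule trace_closed[OF bn _ X b]) simp
    then have "trace (lower b) b m \<noteq> n - 1" for m using last by (metis DiffD2)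
    then show False by (rule trace_not_avoiding[OF bn be])
  qed
  moreover from this have "j = n" using card_image[OF j(3)] by simp
  ultimately show thesis using that j(3,4,6) by blast
qed

end

section \<open>The second Hamiltonian cycle\<close>

context hamiltonian_graph
begin

definition second :: "'a list" where
  "second = map V (map walk [0..<n])"

lemma second_cycle_edge:
  assumes "m < n"
  shows "{V (walk m), V (walk (Suc m mod n))} \<in> cycle_edges second"
proof -
  have "Suc m mod n < n" using assms by (intro mod_less_divisor) auto
  then have "(V (walk m), V (walk (Suc m mod n))) = (second ! m, second ! (Suc m mod length second))"
    "m < length second" using assms by (simp_all add: second_def)
  then have "(V (walk m), V (walk (Suc m mod n))) \<in> cycle_arcs second"
    unfolding cycle_arcs_def by blast
  then show ?thesis unfolding cycle_edges_def by blast
qed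

lemma second_hamiltonian: "hamiltonian_cycle G second"
proof -
  obtain w: "inj_on walk {..<n}" "walk ` {..<n} = {..<n}" and
    nb: "\<And>m. m < n \<Longrightarrow> {lower (walk m), upper (walk m)} = {walk (if m = 0 then n - 1 else m - 1), walk (Suc m mod n)}"
    using walk_closed_cycle by blast
  let ?C = "map walk [0..<n]"
  have "set ?C = {..<n}" using w(2) by (simp add: atLeast0LessThan)
  moreover have "is_cycle G (map V ?C)"
  proof (rule is_cycle_map)
    show "distinct ?C" unfolding distinct_map using w(1) by (simp add: atLeast0LessThan)
    show "set ?C \<subseteq> {..<n}" using \<open>set ?C = {..<n}\<close> by simp
    show "3 \<le> length ?C" using n3 by simp
    fix m assume "m < length ?C"
    then have m: "m < n" by simp
    have "Suc m mod n < n" using m by (intro mod_less_divisor) auto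
    then have "?C ! m = walk m" "?C ! (Suc m mod length ?C) = walk (Suc m mod n)" using m by simp_all
    moreover have "walk m < n" using w(2) m by blast
    moreover have "walk (Suc m mod n) \<in> {lower (walk m), upper (walk m)}" unfolding nb[OF m] by simp
    ultimately show "A (?C ! m) (?C ! (Suc m mod length ?C))" using nbr_A by simp
  qed
  moreover have "set (map V ?C) = V ` set ?C" by (rule set_map)
  ultimately show ?thesis unfolding hamiltonian_cycle_def second_def verts_V by metis
qed

lemma second_contains: "{V 0, V (n - 1)} \<in> cycle_edges second"
proof -
  have "walk (n - 1) = n - 1" using walk_closed_cycle by blast
  moreover have "walk 0 = 0" unfolding walk_def by simp
  moreover have "Suc (n - 1) mod n = 0" "n - 1 < n" using n3 by simp_all
  ultimately have "{V (n - 1), V 0} \<in> cycle_edges second" using second_cycle_edge[of "n - 1"] by simp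
  then show ?thesis by (simp add: insert_commute)
qed

text \<open>The chord at \<open>start\<close> belongs to the 2-factor, and since
  \<open>start\<close> is an inner vertex, the chord is no edge of \<open>H\<close>.\<close>

lemma second_new_edge: "\<exists>e\<in>cycle_edges second. \<forall>i<n. e \<noteq> {V i, V (Suc i mod n)}"
proof -
  obtain w: "walk ` {..<n} = {..<n}" and
    nb: "\<And>m. m < n \<Longrightarrow> {lower (walk m), upper (walk m)} = {walk (if m = 0 then n - 1 else m - 1), walk (Suc m mod n)}"
    using walk_closed_cycle by blast
  note st = orbit_facts[OF start_orbit]
  define u where "u = chord start"
  have sn: "start < n" using st(3) by simp
  have un: "u < n" using st(6) by (simp add: u_def)
  have "factor u start" unfolding factor_def u_def using st(1,4,6) sn start_orbit by blast
  then have u: "u \<in> {lower start, upper start}" unfolding nbrs_factor(1)[OF sn] by simp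
  obtain m where m: "m < n" "start = walk m" using w sn by (metis imageE lessThan_iff)
  \<comment> \<open>\<open>u\<close> is a neighbour of \<open>start\<close> on the walk, either the
    next vertex or the previous one, so the chord is one of its edges.\<close>
  have e: "{V start, V u} \<in> cycle_edges second"
  proof (cases "u = walk (Suc m mod n)")
    case True
    then show ?thesis using second_cycle_edge[OF m(1)] m(2) by simp
  next
    case False
    define m' where "m' = (if m = 0 then n - 1 else m - 1)"
    have "u = walk m'" using u False unfolding m(2) nb[OF m(1)] m'_def by blast
    moreover have "m' < n" "Suc m' mod n = m" using m(1) by (auto simp: m'_def)
    ultimately show ?thesis using second_cycle_edge[of m'] m(2) by (simp add: insert_commute)
  qed
  have "{V start, V u} \<noteq> {V i, V (Suc i mod n)}" if i: "i < n" for i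
  proof
    assume eq: "{V start, V u} = {V i, V (Suc i mod n)}"
    have si: "Suc i mod n < n" using i by (intro mod_less_divisor) auto
    have "(start = i \<and> u = Suc i mod n) \<or> (start = Suc i mod n \<and> u = i)"
      using eq V_eq_iff sn un i si by (auto simp: doubleton_eq_iff)
    moreover have "start \<noteq> 0" "Suc start \<noteq> n" using st(2,3) by auto
    moreover have "u \<noteq> Suc start" "Suc u \<noteq> start" using st(12,13) by (auto simp: u_def)
    ultimately show False using i by (cases "Suc i = n") auto
  qed
  then show ?thesis using e by blast
qed

end

section \<open>The logarithmic-space algorithm\<close>

lemma cyclic_shift_bij: "k < n \<Longrightarrow> bij_betw (\<lambda>j. (k + j) mod n) {..<n} {..<(n :: nat)}"
proof -
  assume k: "k < n"
  have "inj_on (\<lambda>j. (k + j) mod n) {..<n}"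
  proof (rule inj_onI)
    fix i j assume "i \<in> {..<n}" "j \<in> {..<n}" "(k + i) mod n = (k + j) mod n"
    then show "i = j" using k by (auto simp: mod_if split: if_splits)
  qed
  moreover have "(\<lambda>j. (k + j) mod n) ` {..<n} \<subseteq> {..<n}" using k by auto
  ultimately show ?thesis by (simp add: bij_betw_def endo_inj_surj)
qed

text \<open>Registers 0 to 40 occur, 40 being the scratch register of \<open>copy\<close> and
  \<open>seek\<close>; each gets a work tape.\<close>

lemma regs_main: "regs main \<subseteq> {..<41}"
  unfolding main_def setup_registers_def find_first_loop_def count_def
    advance_def advances_def locate_def adjacent_def print_vertex_def print_digits_def
    second_cycle_def walk_loop_def neighbours_of_def neighbour_loop_def
    start_loop_def find_jump_def find_chord_def find_chord_loop_def
    scan_rows_def scan_row_def same_word_def same_word_step_def mark_def seek_def forward_def rewind_def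
    skip_to_def back_to_def compare_def copy_def move1_def move2_def clear_def
  by simp

lemma main_correct:
  fixes G :: "nat graph"
  assumes G: "simple_graph G" "bipartite G" "pfaffian G" "\<forall>v\<in>verts G. degree G v \<ge> 3"
    and adj: "adjacency_list G adj" and H: "hamiltonian_cycle G H" and ab: "{a, b} \<in> cycle_edges H"
  shows "\<exists>H'. hamiltonian_cycle G H' \<and> cycle_edges H' \<noteq> cycle_edges H \<and> {a, b} \<in> cycle_edges H' \<and>
    wp (encode_input adj H (a, b)) main (\<lambda>s. snd (snd s) = encode_vertices H') (0, \<lambda>_. 0, [])"
proof -
  define n where "n = length H"
  define x where "x = encode_input adj H (a, b)"
  have n3: "3 \<le> n" and dist: "distinct H" and setH: "set H = verts G" and eH: "cycle_edges H \<subseteq> edges G"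
    using H unfolding hamiltonian_cycle_def is_cycle_def n_def by auto
  have edges_H: "cycle_edges H = {{H ! l, H ! (Suc l mod n)} | l. l < n}"
    unfolding cycle_edges_def cycle_arcs_def n_def by blast
  interpret input adj H a b x n
    by unfold_locales (use n3 in \<open>auto simp: x_def n_def\<close>)
  obtain l where l: "l < n" "{a, b} = {H ! l, H ! (Suc l mod n)}" using ab unfolding edges_H by blast
  have modn: "Suc i mod n < n" for i using n3 by simp
  have "a \<in> set H" using l modn by (auto simp: doubleton_eq_iff n_def)
  obtain i where i: "i < n" "H ! i = a" using \<open>a \<in> set H\<close> unfolding n_def by (metis in_set_conv_nth)
  have i_unique: "i' = i" if "i' < n" "H ! i' = a" for i'
    using that i dist nth_eq_iff_index_eq unfolding n_def by metis
  define k where "k = (if H ! (Suc i mod n) = b then Suc i mod n else i)"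
  have k: "k < n" using i modn by (simp add: k_def)
  define W where "W = vertex k"
  have W: "W j = H ! ((k + j) mod n)" for j by (simp add: W_def vertex_def)
  have ends: "{W 0, W (n - 1)} = {a, b}"
  proof (cases "H ! (Suc i mod n) = b")
    case True
    have "(k + (n - 1)) mod n = i"
      using i(1) True n3 unfolding k_def by (cases "Suc i = n") auto
    then show ?thesis using True i(2) k unfolding W by (auto simp: k_def)
  next
    case False
    \<comment> \<open>\<open>{a, b}\<close> is an edge of \<open>H\<close> and \<open>b\<close> does
      not follow \<open>a\<close>, so \<open>a\<close> follows \<open>b\<close>.\<close>
    have "H ! l = b \<and> H ! (Suc l mod n) = a"
    proof (rule ccontr)
      assume "\<not> ?thesis"
      then have "H ! l = a" "H ! (Suc l mod n) = b" using l(2) by (auto simp: doubleton_eq_iff)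
      then show False using i_unique[OF l(1)] False by simp
    qed
    then have "i = Suc l mod n" "H ! l = b" using i_unique[OF modn] by metis+
    then have "(k + (n - 1)) mod n = l"
      using l(1) n3 False unfolding k_def by (cases "Suc l = n") auto
    then show ?thesis using \<open>H ! l = b\<close> i(2) k False unfolding W by (auto simp: k_def)
  qed
  obtain D where D: "pfaffian_orientation G D" using G(3) unfolding pfaffian_def by blast
  have shift: "bij_betw (\<lambda>j. (k + j) mod n) {..<n} {..<n}" by (rule cyclic_shift_bij[OF k])
  have "bij_betw ((!) H) {..<n} (set H)"
    using dist unfolding n_def by (intro bij_betw_nth) auto
  from bij_betw_trans[OF shift this] have bijW: "bij_betw W {..<n} (verts G)"
    unfolding setH W_def comp_def vertex_def .
  have sucW: "W (Suc j mod n) = H ! (Suc ((k + j) mod n) mod n)" for j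
    unfolding W by (simp add: mod_simps)
  have edgeW: "{W j, W (Suc j mod n)} \<in> cycle_edges H" for j
    unfolding edges_H sucW unfolding W using n3 by auto
  interpret ham: hamiltonian_graph G W n D
    by unfold_locales (use G D bijW edgeW eH n3 in auto)
  have listed: "listed (vertex k i) (vertex k j) \<longleftrightarrow> ham.A i j" for i j
  proof -
    have "(k + i) mod n < length H" unfolding n_def[symmetric] using n3 by simp
    then have "vertex k i \<in> verts G" unfolding vertex_def setH[symmetric] by (rule nth_mem)
    then have "vertex k i \<in> set (map fst adj)" using adj unfolding adjacency_list_def by simp
    then obtain ns where ns: "(vertex k i, ns) \<in> set adj" by auto
    have row: "set ns' = neighbours G v" if "(v, ns') \<in> set adj" for v ns'
      using adj that unfolding adjacency_list_def by blast
    have "listed (vertex k i) (vertex k j) \<longleftrightarrow> vertex k j \<in> neighbours G (vertex k i)"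
    proof
      assume "listed (vertex k i) (vertex k j)"
      then obtain ns' where "(vertex k i, ns') \<in> set adj" "vertex k j \<in> set ns'"
        unfolding listed_def by auto
      then show "vertex k j \<in> neighbours G (vertex k i)" using row by simp
    next
      assume "vertex k j \<in> neighbours G (vertex k i)"
      then have "vertex k j \<in> set ns" using row[OF ns] by simp
      then show "listed (vertex k i) (vertex k j)" using ns unfolding listed_def by auto
    qed
    then show ?thesis using ham.A_def[of i j] unfolding W_def neighbours_def by simp
  qed
  \<comment> \<open>Hence the chords found on the tape are those of the graph, and the walk that is
    printed is the one shown to be Hamiltonian.\<close>
  then have A_eq: "(\<lambda>i j. listed (vertex k i) (vertex k j)) = ham.A" by (intro ext)
  interpret prog: program adj H a b x n k
    by (unfold_locales, unfold listed) (use ham.exists_chord ham.A_irrefl k n3 in auto)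
  let ?H' = "ham.second"
  have walk: "map (vertex k) (map (chords.walk n (\<lambda>i j. listed (vertex k i) (vertex k j))) [0..<n]) = ?H'"
    using ham.second_def unfolding A_eq W_def by (rule sym)
  have "wp x second_cycle (\<lambda>s. snd (snd s) = encode_vertices ?H') (h, (\<lambda>_. 0)(0 := n, 1 := pos k), [])" for h
    by (rule prog.wp_second_cycle) (simp add: walk[symmetric])
  moreover have "(if H ! (Suc i' mod n) = b then Suc i' mod n else i') = k" if "i' < n" "H ! i' = a" for i'
    unfolding i_unique[OF that] k_def ..
  ultimately have "wp x main (\<lambda>s. snd (snd s) = encode_vertices ?H') (0, \<lambda>_. 0, [])"
    unfolding main_def by (intro wp_Seq, intro wp_setup_registers[OF \<open>a \<in> set H\<close>]) simp
  moreover have "cycle_edges ?H' \<noteq> cycle_edges H"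
  proof -
    have "\<exists>j<n. e = {W j, W (Suc j mod n)}" if e: "e \<in> cycle_edges H" for e
    proof -
      obtain l where l: "l < n" "e = {H ! l, H ! (Suc l mod n)}" using e unfolding edges_H by blast
      have "l \<in> (\<lambda>j. (k + j) mod n) ` {..<n}" using bij_betw_imp_surj_on[OF shift] l(1) by simp
      then obtain j where "j < n" "l = (k + j) mod n" by blast
      moreover from this have "e = {W j, W (Suc j mod n)}" using l(2) unfolding sucW unfolding W by simp
      ultimately show ?thesis by blast
    qed
    moreover obtain e where "e \<in> cycle_edges ?H'" "\<forall>j<n. e \<noteq> {W j, W (Suc j mod n)}"
      using ham.second_new_edge by blast
    ultimately show ?thesis by blast
  qed
  moreover have "{a, b} \<in> cycle_edges ?H'" using ham.second_contains unfolding ends .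
  ultimately show ?thesis using ham.second_hamiltonian unfolding x_def by blast
qed

text \<open>\<open>B\<close> is \<open>log 2 (N + 2)\<close> rounded up. Since
  \<open>N + 2 \<le> N ^ 2\<close>, it is at most \<open>2 * log 2 N + 1\<close>, and
  \<open>log 2 N\<close> is at least 1, so the remaining 3 cells are absorbed by the factor
  5.\<close>

lemma log_space_bound:
  assumes "2 \<le> N"
  obtains B where "N + 1 < 2 ^ B" "real B + 2 \<le> 5 * log 2 (real N)"
proof -
  define B where "B = nat \<lceil>log 2 (real (N + 2))\<rceil>"
  have pos: "0 \<le> log 2 (real (N + 2))" by simp
  have "real (N + 2) = 2 powr log 2 (real (N + 2))" by simp
  also have "\<dots> \<le> 2 powr real B" unfolding B_def using pos by (intro powr_mono) linarith+
  also have "\<dots> = real (2 ^ B)" by (simp add: powr_realpow)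
  finally have "N + 2 \<le> 2 ^ B" by (metis of_nat_le_iff)
  have "N + 2 \<le> N ^ 2"
  proof -
    have "2 * N \<le> N * N" using assms by simp
    moreover have "N + 2 \<le> 2 * N" using assms by simp
    ultimately show ?thesis unfolding power2_eq_square by linarith
  qed
  then have "real (N + 2) \<le> real (N ^ 2)" by (metis of_nat_le_iff)
  then have "log 2 (real (N + 2)) \<le> log 2 (real (N ^ 2))" using assms by (subst log_le_cancel_iff) auto
  also have "\<dots> = 2 * log 2 (real N)" using assms by (simp add: log_nat_power)
  finally have "log 2 (real (N + 2)) \<le> 2 * log 2 (real N)" .
  moreover have "1 \<le> log 2 (real N)" using assms by (simp add: le_log_iff)
  moreover have "real B \<le> log 2 (real (N + 2)) + 1" unfolding B_def using pos by linarith
  ultimately have "real B + 2 \<le> 5 * log 2 (real N)" by linarith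
  moreover have "N + 1 < 2 ^ B" using \<open>N + 2 \<le> 2 ^ B\<close> by linarith
  ultimately show thesis using that by blast
qed

theorem theorem1p2:
  "\<exists>M :: (nat, nat) tm. valid_tm M \<and>
     (\<forall>c :: real. \<exists>d :: real. \<forall>(G :: nat graph) adj H a b.
        simple_graph G \<and> bipartite G \<and> pfaffian G \<and> (\<forall>v\<in>verts G. degree G v \<ge> 3) \<and>
        log_bit_labels c G \<and> adjacency_list G adj \<and>
        hamiltonian_cycle G H \<and> {a, b} \<in> cycle_edges H \<longrightarrow>
        runs_in_space M (encode_input adj H (a, b))
          (d * log 2 (real (length (encode_input adj H (a, b))))) \<and>
        (\<exists>H'. halts_with_output M (encode_input adj H (a, b)) (encode_vertices H') \<and>
              hamiltonian_cycle G H' \<and> cycle_edges H' \<noteq> cycle_edges H \<and>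
              {a, b} \<in> cycle_edges H'))"
proof (intro exI[of _ "compile 41 main"] conjI allI exI[of _ 5] impI; (elim conjE)?)
  \<comment> \<open>One tape for each of the 41 registers; the constant 5 chosen above is the factor
    in \<open>log_space_bound\<close>.\<close>
  show "valid_tm (compile 41 main)" by (rule valid_compile)
next
  fix G :: "nat graph" and adj H a b
  assume hyps: "simple_graph G" "bipartite G" "pfaffian G" "\<forall>v\<in>verts G. degree G v \<ge> 3"
    "adjacency_list G adj" "hamiltonian_cycle G H" "{a, b} \<in> cycle_edges H"
  let ?x = "encode_input adj H (a, b)"
  obtain H' where H': "hamiltonian_cycle G H'" "cycle_edges H' \<noteq> cycle_edges H" "{a, b} \<in> cycle_edges H'"
    "wp ?x main (\<lambda>s. snd (snd s) = encode_vertices H') (0, \<lambda>_. 0, [])"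
    using main_correct[OF hyps] by blast
  obtain h \<rho> where run: "exec ?x main (0, \<lambda>_. 0, []) (h, \<rho>, encode_vertices H')"
    using H'(4) unfolding wp_def by auto
  have "2 \<le> length ?x" by (simp add: encode_input_def)
  then obtain B where B: "length ?x + 1 < 2 ^ B" "real B + 2 \<le> 5 * log 2 (real (length ?x))"
    by (rule log_space_bound)
  note run = compile_correct[OF run regs_main B]
  show "runs_in_space (compile 41 main) ?x (5 * log 2 (real (length ?x)))" by (rule run(1))
  show "\<exists>H'. halts_with_output (compile 41 main) ?x (encode_vertices H') \<and>
      hamiltonian_cycle G H' \<and> cycle_edges H' \<noteq> cycle_edges H \<and> {a, b} \<in> cycle_edges H'"
    using run(2) H' by blast
qed

end
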